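(* For any $\gamma>0$ and any thresholds $\{\overline{\Delta}^k,\underline{\Delta}^k\}_{1\le k\le K}$ (positive reals), the D-CUSUM rule $\tilde{\mathcal S}$ and the centralized CUSUM rule $\mathcal S$, with thresholds $\tilde\nu$ and $\nu$ chosen so that $\mathsf E_\infty[-u_{\tilde{\mathcal S}}]=\gamma=\mathsf E_\infty[-u_{\mathcal S}]$, satisfy $$\mathcal J[\tilde{\mathcal S}]-\mathcal J[\mathcal S]\le 4\,K\,\Delta_{\max},\qquad\text{where } \Delta_{\max}:=\max_{1\le k\le K}\max\{\overline{\Delta}^k,\underline{\Delta}^k\}.$$
   Context: Time is continuous, $t\in[0,\infty)$. $\xi_t=(\xi^1_t,\dots,\xi^K_t)$ is a $K$-dimensional process with $\xi_0^k=0$; $\mathscr F^k_t=\sigma(\xi^k_s,0\le s\le t)$ and $\mathscr F_t=\vee_k\mathscr F^k_t$ (filtrations taken right-continuous). $\mathsf P_0,\mathsf P_\infty$ are two completely specified, locally equivalent probability measures on the canonical space of $\xi$, and under both the components $\xi^1,\dots,\xi^K$ are independent, i.e. $\mathsf P_i=\mathsf P_i^1\times\dots\times\mathsf P_i^K$. Put $$u^k_t=\log\frac{d\mathsf P^k_0}{d\mathsf P^k_\infty}\Big|_{\mathscr F^k_t},\qquad u_t=\sum_{k=1}^K u^k_t=\log\frac{d\mathsf P_0}{d\mathsf P_\infty}\Big|_{\mathscr F_t},\qquad u_0=0.$$ The numbers $\mathsf E_0[u^k_1]$ and $-\mathsf E_\infty[u^k_1]$ are positive and finite for each $k$. For a deterministic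 change time $\tau\ge0$, $\mathsf P_\tau$ is the measure which coincides with $\mathsf P_\infty$ on $\mathscr F_t$ for $t\le\tau$ and satisfies $\log\frac{d\mathsf P_\tau}{d\mathsf P_\infty}|_{\mathscr F_t}=u_t-u_\tau$ for $t\ge\tau$. $\mathsf E_\tau$ denotes expectation under $\mathsf P_\tau$. Each $\{u^k_t\}$ has continuous paths, and the quadratic variation $\langle u\rangle_t$ of $u$ satisfies $\lim_{t\to\infty}\langle u\rangle_t=\infty$ $\mathsf P_0$- and $\mathsf P_\infty$-a.s. For an $\{\mathscr F_t\}$-stopping time $\mathcal T$, $$\mathcal J[\mathcal T]=\sup_{\tau\ge0}\operatorname{ess\,sup}\mathsf E_\tau\big[(u_{\mathcal T}-u_\tau)\mathbf 1_{\{\mathcal T>\tau\}}\,\big|\,\mathscr F_\tau\big].$$ Centralized CUSUM: $\mathcal S=\inf\{t\ge0:y_t\ge\nu\}$, $y_t=u_t-\inf_{0\le s<t}u_s$ ($y_0=0$). D-CUSUM: for positive thresholds $\overline{\Delta}^k,\underline{\Delta}^k$ let $\tau^k_0=0$ and $$\tau^k_n=\inf\{t>\tau^k_{n-1}:u^k_t-u^k_{\tau^k_{n-1}}\notin(-\underline{\Delta}^k,\overline{\Delta}^k)\},\quad n\ge1,$$ be the communication times of sensor $k$; $m^k_t=\max\{n:\tau^k_n\le t\}$; $\tau^k(t)=\tau^k_{m^k_t}$; $\tilde u^k_t=u^k_{\tau^k(t)}$; $\tilde u_t=\sum_{k=1}^K\tilde u^k_t$; $\tilde y_t=\tilde u_t-\inf_{0\le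 s\le t}\tilde u_s$; and $\tilde{\mathcal S}=\inf\{t\ge0:\tilde y_t\ge\tilde\nu\}$. *)

theory Defs
  imports "HOL-Probability.Probability"
begin

section \<open>Filtrations\<close>

text \<open>The sigma-algebra on \<open>\<Omega>\<close> generated by the observations of the sensors in \<open>I\<close> at the
  times in \<open>T\<close>.\<close>

definition obs_sigma :: "'a set \<Rightarrow> (nat \<Rightarrow> real \<Rightarrow> 'a \<Rightarrow> real) \<Rightarrow> nat set \<Rightarrow> real set \<Rightarrow> 'a measure" where
  "obs_sigma \<Omega> \<xi> I T = sigma \<Omega> (\<Union>k\<in>I. \<Union>s\<in>T. {\<xi> k s -` B \<inter> \<Omega> | B. B \<in> sets borel})"

text \<open>The right-continuous version of the history up to time \<open>t\<close>. The filtration of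
  sensor \<open>k\<close> is the case \<open>I = {k}\<close>; the global filtration is the case \<open>I = {1..K}\<close>.\<close>

definition history :: "'a set \<Rightarrow> (nat \<Rightarrow> real \<Rightarrow> 'a \<Rightarrow> real) \<Rightarrow> nat set \<Rightarrow> real \<Rightarrow> 'a measure" where
  "history \<Omega> \<xi> I t = sigma \<Omega> (\<Inter>s\<in>{t<..}. sets (obs_sigma \<Omega> \<xi> I {0..s}))"


section \<open>Quadratic variation\<close>

text \<open>\<open>q\<close> is (a version of) the quadratic variation of the continuous process \<open>x\<close> under \<open>P\<close>:
  an adapted process, almost surely continuous, nondecreasing and null at \<open>0\<close>, such that for
  each \<open>t\<close> the sums of squared increments of \<open>x\<close> along partitions of \<open>[0, t]\<close> converge to \<open>q t\<close>
  in \<open>P\<close>-probability as the mesh tends to \<open>0\<close>. Continuity is only almost sure because the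
  filtrations are not completed.\<close>

definition is_quadratic_variation ::
  "'a measure \<Rightarrow> (real \<Rightarrow> 'a measure) \<Rightarrow> (real \<Rightarrow> 'a \<Rightarrow> real) \<Rightarrow> (real \<Rightarrow> 'a \<Rightarrow> real) \<Rightarrow> bool" where
  "is_quadratic_variation P F x q \<longleftrightarrow>
     (\<forall>t\<ge>0. q t \<in> borel_measurable (F t)) \<and>
     (AE \<omega> in P. q 0 \<omega> = 0 \<and> continuous_on {0..} (\<lambda>t. q t \<omega>) \<and> mono_on {0..} (\<lambda>t. q t \<omega>)) \<and>
     (\<forall>t\<ge>0. \<forall>\<epsilon>>0. \<forall>\<eta>>0. \<exists>\<delta>>0. \<forall>(n::nat) (p :: nat \<Rightarrow> real).
        p 0 = 0 \<and> p n = t \<and> (\<forall>i<n. p i \<le> p (Suc i) \<and> p (Suc i) - p i < \<delta>) \<longrightarrow>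
        measure P {\<omega> \<in> space P. \<epsilon> < \<bar>(\<Sum>i<n. (x (p (Suc i)) \<omega> - x (p i) \<omega>)\<^sup>2) - q t \<omega>\<bar>} < \<eta>)"


section \<open>The observation model\<close>

text \<open>\<open>u k t\<close> is the continuous version of the log-likelihood ratio of sensor \<open>k\<close> at time \<open>t\<close>;
  that of all the observations is the sum over the sensors.\<close>

definition total_llr :: "nat \<Rightarrow> (nat \<Rightarrow> real \<Rightarrow> 'a \<Rightarrow> real) \<Rightarrow> real \<Rightarrow> 'a \<Rightarrow> real" where
  "total_llr K u t \<omega> = (\<Sum>k\<in>{1..K}. u k t \<omega>)"

text \<open>\<open>P0\<close> and \<open>Pinf\<close> are the laws with the change at time \<open>0\<close> and without change; \<open>P \<tau>\<close> is the
  law with the change at the deterministic time \<open>\<tau> \<ge> 0\<close>. Any path space with its coordinate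
  processes is an instance of \<open>\<Omega>\<close> and \<open>\<xi>\<close>; there, independence of the sensors says that the law
  is the product of its marginals. The statement ``\<open>u\<close> is the logarithm of the density'' is
  expressed by saying that the restricted law has density \<open>exp u\<close>.\<close>

locale change_model =
  fixes K :: nat
    and \<Omega> :: "'a set"
    and \<xi> :: "nat \<Rightarrow> real \<Rightarrow> 'a \<Rightarrow> real"
    and P0 Pinf :: "'a measure"
    and P :: "real \<Rightarrow> 'a measure"
    and u :: "nat \<Rightarrow> real \<Rightarrow> 'a \<Rightarrow> real"
    and qv :: "real \<Rightarrow> 'a \<Rightarrow> real"
  assumes K_pos: "1 \<le> K"
    and \<xi>_0: "\<And>k \<omega>. k \<in> {1..K} \<Longrightarrow> \<omega> \<in> \<Omega> \<Longrightarrow> \<xi> k 0 \<omega> = 0"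
    and prob_P0: "prob_space P0"
    and prob_Pinf: "prob_space Pinf"
    and prob_P: "\<And>\<tau>. 0 \<le> \<tau> \<Longrightarrow> prob_space (P \<tau>)"
    and space_P0: "space P0 = \<Omega>"
    and space_Pinf: "space Pinf = \<Omega>"
    and space_P: "\<And>\<tau>. 0 \<le> \<tau> \<Longrightarrow> space (P \<tau>) = \<Omega>"
    and sets_P0: "sets P0 = sets (obs_sigma \<Omega> \<xi> {1..K} {0..})"
    and sets_Pinf: "sets Pinf = sets (obs_sigma \<Omega> \<xi> {1..K} {0..})"
    and sets_P: "\<And>\<tau>. 0 \<le> \<tau> \<Longrightarrow> sets (P \<tau>) = sets (obs_sigma \<Omega> \<xi> {1..K} {0..})"
    and locally_equivalent: "\<And>t. 0 \<le> t \<Longrightarrow>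
      null_sets (restr_to_subalg P0 (history \<Omega> \<xi> {1..K} t)) =
      null_sets (restr_to_subalg Pinf (history \<Omega> \<xi> {1..K} t))"
    and indep_P0: "prob_space.indep_sets P0 (\<lambda>k. sets (obs_sigma \<Omega> \<xi> {k} {0..})) {1..K}"
    and indep_Pinf: "prob_space.indep_sets Pinf (\<lambda>k. sets (obs_sigma \<Omega> \<xi> {k} {0..})) {1..K}"
    and u_adapted: "\<And>k t. k \<in> {1..K} \<Longrightarrow> 0 \<le> t \<Longrightarrow> u k t \<in> borel_measurable (history \<Omega> \<xi> {k} t)"
    and u_density: "\<And>k t. k \<in> {1..K} \<Longrightarrow> 0 \<le> t \<Longrightarrow>
      restr_to_subalg P0 (history \<Omega> \<xi> {k} t) =
      density (restr_to_subalg Pinf (history \<Omega> \<xi> {k} t)) (\<lambda>\<omega>. ennreal (exp (u k t \<omega>)))"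
    and u_continuous: "\<And>k \<omega>. k \<in> {1..K} \<Longrightarrow> \<omega> \<in> \<Omega> \<Longrightarrow> continuous_on {0..} (\<lambda>t. u k t \<omega>)"
    and u_0: "\<And>\<omega>. \<omega> \<in> \<Omega> \<Longrightarrow> total_llr K u 0 \<omega> = 0"
    and information_P0: "\<And>k. k \<in> {1..K} \<Longrightarrow> integrable P0 (u k 1) \<and> 0 < (\<integral>\<omega>. u k 1 \<omega> \<partial>P0)"
    and information_Pinf: "\<And>k. k \<in> {1..K} \<Longrightarrow> integrable Pinf (u k 1) \<and> 0 < - (\<integral>\<omega>. u k 1 \<omega> \<partial>Pinf)"
    and P_before_change: "\<And>\<tau> t. 0 \<le> t \<Longrightarrow> t \<le> \<tau> \<Longrightarrow>
      restr_to_subalg (P \<tau>) (history \<Omega> \<xi> {1..K} t) =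
      restr_to_subalg Pinf (history \<Omega> \<xi> {1..K} t)"
    and P_after_change: "\<And>\<tau> t. 0 \<le> \<tau> \<Longrightarrow> \<tau> \<le> t \<Longrightarrow>
      restr_to_subalg (P \<tau>) (history \<Omega> \<xi> {1..K} t) =
      density (restr_to_subalg Pinf (history \<Omega> \<xi> {1..K} t))
        (\<lambda>\<omega>. ennreal (exp (total_llr K u t \<omega> - total_llr K u \<tau> \<omega>)))"
    and qv_P0: "is_quadratic_variation P0 (history \<Omega> \<xi> {1..K}) (total_llr K u) qv"
    and qv_Pinf: "is_quadratic_variation Pinf (history \<Omega> \<xi> {1..K}) (total_llr K u) qv"
    and qv_diverges_P0: "AE \<omega> in P0. filterlim (\<lambda>t. qv t \<omega>) at_top at_top"
    and qv_diverges_Pinf: "AE \<omega> in Pinf. filterlim (\<lambda>t. qv t \<omega>) at_top at_top"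


section \<open>The performance measure\<close>

text \<open>Expectation and conditional expectation of an extended real variable, as the difference of
  those of the positive and the negative part. The integral and \<^const>\<open>real_cond_exp\<close> of the
  library return the default value \<open>0\<close> for infinite expectations. The form \<open>\<infinity> - \<infinity>\<close> has the
  value \<open>\<infinity>\<close>.\<close>

definition ext_expectation :: "'a measure \<Rightarrow> ('a \<Rightarrow> ereal) \<Rightarrow> ereal" where
  "ext_expectation M X =
     enn2ereal (\<integral>\<^sup>+ \<omega>. e2ennreal (X \<omega>) \<partial>M) - enn2ereal (\<integral>\<^sup>+ \<omega>. e2ennreal (- X \<omega>) \<partial>M)"

definition ext_cond_exp :: "'a measure \<Rightarrow> 'a measure \<Rightarrow> ('a \<Rightarrow> ereal) \<Rightarrow> 'a \<Rightarrow> ereal" where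
  "ext_cond_exp M F X = (\<lambda>\<omega>.
     enn2ereal (nn_cond_exp M F (\<lambda>\<omega>. e2ennreal (X \<omega>)) \<omega>)
     - enn2ereal (nn_cond_exp M F (\<lambda>\<omega>. e2ennreal (- X \<omega>)) \<omega>))"

text \<open>Stopping rules take values in \<open>[0, \<infinity>]\<close>. On the event that the rule never stops, the
  process is evaluated at infinity as its upper limit.\<close>

definition stopped_at :: "(real \<Rightarrow> 'a \<Rightarrow> real) \<Rightarrow> ('a \<Rightarrow> ereal) \<Rightarrow> 'a \<Rightarrow> ereal" where
  "stopped_at x T \<omega> =
     (if T \<omega> = \<infinity> then Limsup at_top (\<lambda>t. ereal (x t \<omega>)) else ereal (x (real_of_ereal (T \<omega>)) \<omega>))"

definition worst_case_info ::
  "(real \<Rightarrow> 'a measure) \<Rightarrow> (real \<Rightarrow> 'a measure) \<Rightarrow> (real \<Rightarrow> 'a \<Rightarrow> real) \<Rightarrow> ('a \<Rightarrow> ereal) \<Rightarrow> ereal" where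
  "worst_case_info P F x T =
     (SUP \<tau>\<in>{0..}. esssup (P \<tau>) (ext_cond_exp (P \<tau>) (F \<tau>)
        (\<lambda>\<omega>. if ereal \<tau> < T \<omega> then stopped_at x T \<omega> - ereal (x \<tau> \<omega>) else 0)))"


section \<open>Centralized CUSUM\<close>

text \<open>The rules are defined path by path.\<close>

definition cusum_stat :: "(real \<Rightarrow> real) \<Rightarrow> real \<Rightarrow> real" where
  "cusum_stat x t = (if t = 0 then 0 else x t - (INF s\<in>{0..<t}. x s))"

definition cusum_time :: "real \<Rightarrow> (real \<Rightarrow> real) \<Rightarrow> ereal" where
  "cusum_time \<nu> x = Inf (ereal ` {t. 0 \<le> t \<and> \<nu> \<le> cusum_stat x t})"

definition cusum_rule :: "nat \<Rightarrow> (nat \<Rightarrow> real \<Rightarrow> 'a \<Rightarrow> real) \<Rightarrow> real \<Rightarrow> 'a \<Rightarrow> ereal" where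
  "cusum_rule K u \<nu> \<omega> = cusum_time \<nu> (\<lambda>t. total_llr K u t \<omega>)"


section \<open>D-CUSUM\<close>

text \<open>\<open>comm_time lo up x n\<close> is the \<open>n\<close>-th communication time of a sensor with path \<open>x\<close> and
  thresholds \<open>lo\<close> (lower) and \<open>up\<close> (upper). It is \<open>\<infinity>\<close> from the first communication that does
  not take place.\<close>

primrec comm_time :: "real \<Rightarrow> real \<Rightarrow> (real \<Rightarrow> real) \<Rightarrow> nat \<Rightarrow> ereal" where
  "comm_time lo up x 0 = 0"
| "comm_time lo up x (Suc n) =
     Inf (ereal ` {t. comm_time lo up x n < ereal t \<and>
                      x t - x (real_of_ereal (comm_time lo up x n)) \<notin> {- lo<..<up}})"

definition comm_count :: "real \<Rightarrow> real \<Rightarrow> (real \<Rightarrow> real) \<Rightarrow> real \<Rightarrow> nat" where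
  "comm_count lo up x t = Max {n. comm_time lo up x n \<le> ereal t}"

definition last_comm :: "real \<Rightarrow> real \<Rightarrow> (real \<Rightarrow> real) \<Rightarrow> real \<Rightarrow> real" where
  "last_comm lo up x t = real_of_ereal (comm_time lo up x (comm_count lo up x t))"

definition sampled_llr ::
  "nat \<Rightarrow> (nat \<Rightarrow> real) \<Rightarrow> (nat \<Rightarrow> real) \<Rightarrow> (nat \<Rightarrow> real \<Rightarrow> 'a \<Rightarrow> real) \<Rightarrow> real \<Rightarrow> 'a \<Rightarrow> real" where
  "sampled_llr K lo up u t \<omega> =
     (\<Sum>k\<in>{1..K}. u k (last_comm (lo k) (up k) (\<lambda>s. u k s \<omega>) t) \<omega>)"

definition dcusum_stat :: "(real \<Rightarrow> real) \<Rightarrow> real \<Rightarrow> real" where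
  "dcusum_stat x t = x t - (INF s\<in>{0..t}. x s)"

definition dcusum_rule ::
  "nat \<Rightarrow> (nat \<Rightarrow> real) \<Rightarrow> (nat \<Rightarrow> real) \<Rightarrow> (nat \<Rightarrow> real \<Rightarrow> 'a \<Rightarrow> real) \<Rightarrow> real \<Rightarrow> 'a \<Rightarrow> ereal" where
  "dcusum_rule K lo up u \<nu> \<omega> =
     Inf (ereal ` {t. 0 \<le> t \<and> \<nu> \<le> dcusum_stat (\<lambda>s. sampled_llr K lo up u s \<omega>) t})"

definition max_threshold :: "nat \<Rightarrow> (nat \<Rightarrow> real) \<Rightarrow> (nat \<Rightarrow> real) \<Rightarrow> real" where
  "max_threshold K lo up = Max ((\<lambda>k. max (up k) (lo k)) ` {1..K})"

end

theory Submission
  imports Defs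
begin

text \<open>
  Let \<open>U\<close> be the log-likelihood ratio of all the observations, \<open>m\<close> its running minimum and
  \<open>y = U - m\<close> the CUSUM statistic. Everything follows from one identity. If \<open>exp (\<theta> U)\<close> is a
  martingale, then so is, up to localization, \<open>exp (\<theta> y) + \<theta> m\<close>: the minimum \<open>m\<close> moves only while
  \<open>y = 0\<close>, and there the function \<open>exp (\<theta> y)\<close> of \<open>y = U - m\<close> has slope \<open>\<theta>\<close>. This is the
  Azema-Yor martingale. Without change, \<open>\<theta> = 1\<close> is admissible, and for every rule \<open>T\<close> that keeps
  \<open>y\<close> bounded it gives \<open>E (- U_T) = E (pre_info y_T)\<close> with \<open>pre_info v = exp v - v - 1\<close>. When
  the change occurs at \<open>\<tau>\<close>, the reciprocal likelihood ratio is a martingale from \<open>\<tau>\<close> on, hence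
  \<open>\<theta> = - 1\<close>, and on every event of \<open>F \<tau>\<close> inside \<open>{\<tau> \<le> T}\<close> the increment \<open>U_T - U_\<tau>\<close>
  has the same expectation as \<open>post_info y_T - post_info y_\<tau>\<close> with
  \<open>post_info v = v + exp (- v) - 1\<close>. Both functions increase on \<open>[0, \<infinity>)\<close> and vanish at \<open>0\<close>.

  The centralized rule stops with \<open>y = \<nu>\<close>. Hence \<open>\<gamma> = pre_info \<nu>\<close>, and the change time \<open>0\<close> shows
  that its worst case is at least \<open>post_info \<nu>\<close>. Each sensor communicates before its own ratio has
  moved by one of its thresholds, so the sampled ratio stays within \<open>D = K \<Delta>_max\<close> of \<open>U\<close> and the
  two statistics differ by at most \<open>2 D\<close>. The decentralized rule therefore keeps
  \<open>y \<le> \<nu>' + 2 D\<close> and stops with \<open>y \<ge> \<nu>' - 2 D\<close>. The second bound and the common value of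
  \<open>\<gamma>\<close> force \<open>\<nu>' - 2 D \<le> \<nu>\<close> (\<open>threshold_comparison\<close>). The first one bounds the worst case by
  \<open>post_info (\<nu>' + 2 D) \<le> post_info (\<nu> + 4 D)\<close> (\<open>worst_case_info_le\<close>), and \<open>post_info\<close> has slope
  at most \<open>1\<close>, whence the difference \<open>4 D\<close>.

  The identity is proved in three stages. The lemma \<open>optional_stopping\<close> treats the exponential
  martingale at a bounded stopping time. Sums of its increments along finer and finer partitions,
  weighted with \<open>exp (- \<theta> m)\<close>, give \<open>azema_yor_bounded\<close> for a process that is bounded up to the
  stopping time. Finally \<open>azema_yor\<close> removes the bound by a monotone limit, which needs a rule that
  stops almost surely: a path confined to a bounded interval would have squared increments of
  bounded expectation (\<open>exit_finite\<close>), in contradiction to the divergence of the quadratic variation.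
\<close>

section \<open>Running minima of continuous paths\<close>

definition running_min :: "(real \<Rightarrow> real) \<Rightarrow> real \<Rightarrow> real" where
  "running_min x t = (INF s\<in>{0..t}. x s)"

lemma running_min_attained:
  assumes "continuous_on {0..} x" "0 \<le> t"
  obtains s where "0 \<le> s" "s \<le> t" "running_min x t = x s" "\<And>r. 0 \<le> r \<Longrightarrow> r \<le> t \<Longrightarrow> x s \<le> x r"
proof -
  have "continuous_on {0..t} x"
    using assms(1) by (rule continuous_on_subset) auto
  then obtain s where s: "s \<in> {0..t}" "\<And>r. r \<in> {0..t} \<Longrightarrow> x s \<le> x r"
    using continuous_attains_inf[of "{0..t}" x] assms(2) by auto
  have "running_min x t = x s"
    unfolding running_min_def by (rule cInf_eq_minimum) (use s in auto)
  with s that show thesis by auto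
qed

lemma running_min_le:
  assumes "continuous_on {0..} x" "0 \<le> s" "s \<le> t"
  shows "running_min x t \<le> x s"
  using running_min_attained[OF assms(1), of t] assms(2,3) by (metis order_trans)

lemma running_min_antimono:
  assumes "continuous_on {0..} x" "0 \<le> s" "s \<le> t"
  shows "running_min x t \<le> running_min x s"
  using running_min_attained[OF assms(1,2)] running_min_le[OF assms(1), of _ t] assms(3)
  by (metis order_trans)

text \<open>A new minimum over a longer interval can only be attained in the part that was added.\<close>

lemma running_min_drop:
  assumes x: "continuous_on {0..} x" and "0 \<le> s" "s \<le> t" "running_min x t \<noteq> running_min x s"
  obtains r where "s \<le> r" "r \<le> t" "running_min x t = x r"
proof -
  have t: "0 \<le> t" using assms by auto
  obtain r where r: "0 \<le> r" "r \<le> t" "running_min x t = x r"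
    using running_min_attained[OF x t] by metis
  have "s \<le> r"
  proof (rule ccontr)
    assume "\<not> s \<le> r"
    then have "running_min x s \<le> running_min x t"
      using running_min_le[OF x r(1), of s] r(3) by auto
    with running_min_antimono[OF x assms(2,3)] assms(4) show False by auto
  qed
  with r that show thesis by auto
qed

lemma running_min_diff_le:
  assumes x: "continuous_on {0..} x" and "0 \<le> s" "s \<le> t"
    and osc: "\<And>r. s \<le> r \<Longrightarrow> r \<le> t \<Longrightarrow> x s - e \<le> x r" and e: "0 \<le> e"
  shows "running_min x s - running_min x t \<le> e"
proof (cases "running_min x t = running_min x s")
  case False
  obtain r where r: "s \<le> r" "r \<le> t" "running_min x t = x r"
    using running_min_drop[OF x assms(2,3) False] by metis
  show ?thesis
    using osc[OF r(1,2)] running_min_le[OF x assms(2), of s] r(3) by auto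
qed (use e in auto)

lemma continuous_running_min:
  assumes x: "continuous_on {0..} x"
  shows "continuous_on {0..} (running_min x)"
proof (unfold continuous_on_iff, intro ballI allI impI)
  fix t e :: real assume t: "t \<in> {0..}" and e: "0 < e"
  obtain d where d: "0 < d" "\<And>r. r \<in> {0..} \<Longrightarrow> dist r t < d \<Longrightarrow> dist (x r) (x t) < e / 4"
    using x[unfolded continuous_on_iff] t e by (metis divide_pos_pos zero_less_numeral)
  have close: "\<bar>running_min x a - running_min x b\<bar> < e"
    if ab: "0 \<le> a" "a \<le> b" and near: "\<And>r. a \<le> r \<Longrightarrow> r \<le> b \<Longrightarrow> dist r t < d" for a b
  proof -
    have "x a - e / 2 \<le> x r" if r: "a \<le> r" "r \<le> b" for r
      using d(2)[of a] d(2)[of r] ab near[of a] near[of r] r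
      unfolding dist_real_def abs_less_iff by auto
    then have "running_min x a - running_min x b \<le> e / 2"
      using e ab by (intro running_min_diff_le[OF x]) auto
    with running_min_antimono[OF x ab] e show ?thesis by auto
  qed
  show "\<exists>d>0. \<forall>r\<in>{0..}. dist r t < d \<longrightarrow> dist (running_min x r) (running_min x t) < e"
  proof (intro exI conjI ballI impI)
    fix r assume r: "r \<in> {0..}" "dist r t < d"
    show "dist (running_min x r) (running_min x t) < e"
    proof (cases "r \<le> t")
      case True
      then show ?thesis using close[of r t] r by (auto simp: dist_real_def)
    next
      case False
      then show ?thesis using close[of t r] r t by (auto simp: dist_real_def abs_minus_commute)
    qed
  qed (use d in auto)
qed

text \<open>By continuity, it makes no difference whether the running minimum includes the present.\<close>

lemma cusum_stat_eq:
  assumes x: "continuous_on {0..} x" and "0 \<le> t"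
  shows "cusum_stat x t = x t - running_min x t"
proof (cases "t = 0")
  case True
  then show ?thesis by (simp add: cusum_stat_def running_min_def)
next
  case False
  then have t: "0 < t" using assms by auto
  have "(INF s\<in>{0..<t}. x s) = running_min x t"
  proof (rule antisym)
    have bdd: "bdd_below (x ` {0..<t})"
      using running_min_le[OF x, of _ t] by (intro bdd_belowI[of _ "running_min x t"]) auto
    show "running_min x t \<le> (INF s\<in>{0..<t}. x s)"
      using t by (intro cINF_greatest) (auto intro: running_min_le[OF x])
    have below: "(INF s\<in>{0..<t}. x s) \<le> x s" if "0 \<le> s" "s < t" for s
      using that by (intro cINF_lower[OF bdd]) auto
    have "(x \<longlongrightarrow> x t) (at_left t)"
    proof -
      have "(x \<longlongrightarrow> x t) (at t within {0..})"
        using x t by (auto simp: continuous_on_def)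
      then have "(x \<longlongrightarrow> x t) (at t within {0..t})"
        by (rule tendsto_within_subset) auto
      then show ?thesis
        using t by (simp add: at_within_Icc_at_left)
    qed
    moreover have "\<forall>\<^sub>F s in at_left t. (INF s\<in>{0..<t}. x s) \<le> x s"
      using eventually_at_left_field[of _ t] t below
      by (metis (mono_tags, lifting) less_eq_real_def)
    ultimately have "(INF s\<in>{0..<t}. x s) \<le> x t"
      by (intro tendsto_lowerbound) auto
    then show "(INF s\<in>{0..<t}. x s) \<le> running_min x t"
      using running_min_attained[OF x, of t] below t by (metis less_eq_real_def)
  qed
  with False show ?thesis by (simp add: cusum_stat_def)
qed

lemma floor_grid_tendsto:
  fixes c :: real
  shows "(\<lambda>n. real_of_int \<lfloor>c * real (Suc n)\<rfloor> / real (Suc n)) \<longlonglongrightarrow> c"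
proof (rule tendsto_sandwich)
  show "\<forall>\<^sub>F n in sequentially. c - 1 / real (Suc n) \<le> real_of_int \<lfloor>c * real (Suc n)\<rfloor> / real (Suc n)"
  proof (intro always_eventually allI)
    fix n
    have "c * real (Suc n) - 1 \<le> real_of_int \<lfloor>c * real (Suc n)\<rfloor>" by linarith
    then have "(c * real (Suc n) - 1) / real (Suc n) \<le> real_of_int \<lfloor>c * real (Suc n)\<rfloor> / real (Suc n)"
      by (rule divide_right_mono) simp
    then show "c - 1 / real (Suc n) \<le> real_of_int \<lfloor>c * real (Suc n)\<rfloor> / real (Suc n)"
      by (simp add: diff_divide_distrib del: of_nat_Suc)
  qed
  show "\<forall>\<^sub>F n in sequentially. real_of_int \<lfloor>c * real (Suc n)\<rfloor> / real (Suc n) \<le> c"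
    by (intro always_eventually allI) (simp add: divide_le_eq del: of_nat_Suc)
  have "(\<lambda>n. c - 1 / real (Suc n)) \<longlonglongrightarrow> c - 0"
    by (intro tendsto_intros LIMSEQ_Suc[OF lim_1_over_n])
  then show "(\<lambda>n. c - 1 / real (Suc n)) \<longlonglongrightarrow> c" by simp
qed simp

text \<open>A continuous adapted process evaluated at a random time is approximated by the values
  at the grid points just before that time, which are countably many.\<close>

lemma measurable_at_random_time:
  fixes x :: "real \<Rightarrow> 'a \<Rightarrow> real"
  assumes x: "\<And>s. 0 \<le> s \<Longrightarrow> s \<le> t \<Longrightarrow> x s \<in> borel_measurable N"
    and cont: "\<And>\<omega>. \<omega> \<in> space N \<Longrightarrow> continuous_on {0..} (\<lambda>s. x s \<omega>)"
    and \<rho>: "\<rho> \<in> borel_measurable N" "\<And>\<omega>. \<omega> \<in> space N \<Longrightarrow> 0 \<le> \<rho> \<omega>" "\<And>\<omega>. \<omega> \<in> space N \<Longrightarrow> \<rho> \<omega> \<le> t"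
  shows "(\<lambda>\<omega>. x (\<rho> \<omega>) \<omega>) \<in> borel_measurable N"
proof (cases "0 \<le> t")
  case True
  define g where "g n \<omega> = real_of_int \<lfloor>\<rho> \<omega> * real (Suc n)\<rfloor> / real (Suc n)" for n \<omega>
  have g: "0 \<le> g n \<omega>" "g n \<omega> \<le> t" "g n \<omega> \<le> \<rho> \<omega>" if "\<omega> \<in> space N" for n \<omega>
  proof -
    show "0 \<le> g n \<omega>" using \<rho>(2)[OF that] by (simp add: g_def)
    show "g n \<omega> \<le> \<rho> \<omega>" by (simp add: g_def divide_le_eq del: of_nat_Suc)
    with \<rho>(3)[OF that] show "g n \<omega> \<le> t" by simp
  qed
  show ?thesis
  proof (rule borel_measurable_LIMSEQ_real)
    fix \<omega> assume \<omega>: "\<omega> \<in> space N"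
    have "(\<lambda>n. g n \<omega>) \<longlonglongrightarrow> \<rho> \<omega>"
      unfolding g_def by (rule floor_grid_tendsto)
    then show "(\<lambda>n. x (g n \<omega>) \<omega>) \<longlonglongrightarrow> x (\<rho> \<omega>) \<omega>"
      using continuous_on_tendsto_compose[OF cont[OF \<omega>], of "\<lambda>n. g n \<omega>" "\<rho> \<omega>"] g[OF \<omega>] \<rho>(2)[OF \<omega>]
      by auto
  next
    fix n
    have "(\<lambda>\<omega>. x (min t (max 0 (real_of_int \<lfloor>\<rho> \<omega> * real (Suc n)\<rfloor> / real (Suc n)))) \<omega>)
        \<in> borel_measurable N"
    proof (rule measurable_compose_countable[where
        f = "\<lambda>i \<omega>. x (min t (max 0 (real_of_int i / real (Suc n)))) \<omega>"
        and g = "\<lambda>\<omega>. \<lfloor>\<rho> \<omega> * real (Suc n)\<rfloor>"])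
      show "(\<lambda>\<omega>. \<lfloor>\<rho> \<omega> * real (Suc n)\<rfloor>) \<in> measurable N (count_space UNIV)"
        using \<rho>(1) by measurable
    qed (use True in \<open>auto intro!: x\<close>)
    also have "?this \<longleftrightarrow> (\<lambda>\<omega>. x (g n \<omega>) \<omega>) \<in> borel_measurable N"
      by (intro measurable_cong) (use g in \<open>auto simp: g_def[symmetric] max_absorb2 min_absorb2 simp del: of_nat_Suc\<close>)
    finally show "(\<lambda>\<omega>. x (g n \<omega>) \<omega>) \<in> borel_measurable N" .
  qed
next
  case False
  then have "space N = {}" using \<rho> by fastforce
  then show ?thesis by (simp add: measurable_def)
qed

lemma measurable_running_min:
  fixes x :: "real \<Rightarrow> 'a \<Rightarrow> real"
  assumes x: "\<And>s. 0 \<le> s \<Longrightarrow> s \<le> t \<Longrightarrow> x s \<in> borel_measurable N"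
    and cont: "\<And>\<omega>. \<omega> \<in> space N \<Longrightarrow> continuous_on {0..} (\<lambda>s. x s \<omega>)"
    and t: "0 \<le> t"
  shows "(\<lambda>\<omega>. running_min (\<lambda>s. x s \<omega>) t) \<in> borel_measurable N"
proof -
  define p :: "nat \<times> nat \<Rightarrow> real" where "p i = min t (real (fst i) / real (Suc (snd i)))" for i
  have p: "0 \<le> p i" "p i \<le> t" for i using t by (auto simp: p_def)
  have "(\<lambda>\<omega>. INF i. x (p i) \<omega>) \<in> borel_measurable N"
    by (intro borel_measurable_cINF_real x p) auto
  also have "?this \<longleftrightarrow> ?thesis"
  proof (intro measurable_cong antisym)
    fix \<omega> assume "\<omega> \<in> space N"
    note c = cont[OF this]
    have bdd: "bdd_below (range (\<lambda>i. x (p i) \<omega>))"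
      using running_min_le[OF c p] by (intro bdd_belowI[of _ "running_min (\<lambda>s. x s \<omega>) t"]) auto
    show "running_min (\<lambda>s. x s \<omega>) t \<le> (INF i. x (p i) \<omega>)"
      by (intro cINF_greatest) (auto intro: running_min_le[OF c] p)
    obtain s where s: "0 \<le> s" "s \<le> t" "running_min (\<lambda>s. x s \<omega>) t = x s \<omega>"
      using running_min_attained[OF c t] by metis
    define q where "q n = p (nat \<lfloor>s * real (Suc n)\<rfloor>, n)" for n
    have "q n = real_of_int \<lfloor>s * real (Suc n)\<rfloor> / real (Suc n)" for n
    proof -
      have "real_of_int \<lfloor>s * real (Suc n)\<rfloor> / real (Suc n) \<le> s"
        by (simp add: divide_le_eq del: of_nat_Suc)
      with s show ?thesis by (simp add: q_def p_def min_def del: of_nat_Suc)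
    qed
    then have "q \<longlonglongrightarrow> s" using floor_grid_tendsto[of s] by presburger
    then have "(\<lambda>n. x (q n) \<omega>) \<longlonglongrightarrow> x s \<omega>"
      using continuous_on_tendsto_compose[OF c, of q s] p s by (auto simp: q_def)
    moreover have "(INF i. x (p i) \<omega>) \<le> x (q n) \<omega>" for n
      unfolding q_def by (rule cINF_lower[OF bdd]) auto
    ultimately show "(INF i. x (p i) \<omega>) \<le> running_min (\<lambda>s. x s \<omega>) t"
      using s(3) by (intro tendsto_lowerbound[of "\<lambda>n. x (q n) \<omega>"]) auto
  qed
  finally show ?thesis .
qed

lemma measurable_at_unbounded_random_time:
  fixes x :: "real \<Rightarrow> 'a \<Rightarrow> real"
  assumes x: "\<And>s. 0 \<le> s \<Longrightarrow> x s \<in> borel_measurable N"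
    and cont: "\<And>\<omega>. \<omega> \<in> space N \<Longrightarrow> continuous_on {0..} (\<lambda>s. x s \<omega>)"
    and \<rho>: "\<rho> \<in> borel_measurable N" "\<And>\<omega>. \<omega> \<in> space N \<Longrightarrow> 0 \<le> \<rho> \<omega>"
  shows "(\<lambda>\<omega>. x (\<rho> \<omega>) \<omega>) \<in> borel_measurable N"
proof (rule borel_measurable_LIMSEQ_real)
  fix \<omega> assume "\<omega> \<in> space N"
  obtain k :: nat where k: "\<rho> \<omega> < real k" using reals_Archimedean2 by blast
  show "(\<lambda>n. x (min (\<rho> \<omega>) (real n)) \<omega>) \<longlonglongrightarrow> x (\<rho> \<omega>) \<omega>"
    by (rule tendsto_eventually, rule eventually_sequentiallyI[of k]) (use k in \<open>auto simp: min_def\<close>)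
next
  fix n
  show "(\<lambda>\<omega>. x (min (\<rho> \<omega>) (real n)) \<omega>) \<in> borel_measurable N"
  proof (rule measurable_at_random_time[where t = "real n" and \<rho> = "\<lambda>\<omega>. min (\<rho> \<omega>) (real n)"])
    show "(\<lambda>\<omega>. min (\<rho> \<omega>) (real n)) \<in> borel_measurable N" using \<rho>(1) by measurable
  qed (use x cont \<rho>(2) in simp_all)
qed

section \<open>Stopping times\<close>

locale filtered_measure =
  fixes M :: "'a measure" and F :: "real \<Rightarrow> 'a measure"
  assumes subalg: "\<And>t. 0 \<le> t \<Longrightarrow> subalgebra M (F t)"
    and F_mono: "\<And>s t. 0 \<le> s \<Longrightarrow> s \<le> t \<Longrightarrow> sets (F s) \<subseteq> sets (F t)"
begin

lemma space_F [simp]: "0 \<le> t \<Longrightarrow> space (F t) = space M"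
  using subalg by (auto simp: subalgebra_def)

lemma sets_F_M: "0 \<le> t \<Longrightarrow> A \<in> sets (F t) \<Longrightarrow> A \<in> sets M"
  using subalg by (auto simp: subalgebra_def)

lemma measurable_F_mono:
  "0 \<le> s \<Longrightarrow> s \<le> t \<Longrightarrow> f \<in> measurable (F s) N \<Longrightarrow> f \<in> measurable (F t) N"
  using F_mono[of s t] by (auto simp: measurable_def)

lemma measurable_F_M: "0 \<le> t \<Longrightarrow> f \<in> measurable (F t) N \<Longrightarrow> f \<in> measurable M N"
  using measurable_from_subalg[OF subalg] by auto

text \<open>For a right-continuous filtration these are the stopping times. Approximation of \<open>T\<close> from above
  along a grid uses exactly the events \<open>T < r\<close>.\<close>

definition stopping :: "('a \<Rightarrow> ereal) \<Rightarrow> bool" where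
  "stopping T \<longleftrightarrow> (\<forall>r\<ge>0. {\<omega> \<in> space M. T \<omega> < ereal r} \<in> sets (F r))"

text \<open>The increment of a process stopped at \<open>T\<close> over a step \<open>[s, t]\<close> of a partition is, on
  \<open>s \<le> T\<close>, the increment from \<open>s\<close> to the clamped time, and it vanishes otherwise.\<close>

definition clamp :: "real \<Rightarrow> real \<Rightarrow> ('a \<Rightarrow> ereal) \<Rightarrow> 'a \<Rightarrow> real" where
  "clamp s t T \<omega> = real_of_ereal (max (ereal s) (min (ereal t) (T \<omega>)))"

lemma ereal_clamp: "ereal (clamp s t T \<omega>) = max (ereal s) (min (ereal t) (T \<omega>))"
  unfolding clamp_def by (cases "T \<omega>") (auto simp: max_def min_def)

lemma clamp_bounds: "s \<le> t \<Longrightarrow> s \<le> clamp s t T \<omega> \<and> clamp s t T \<omega> \<le> t"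
  using ereal_clamp[of s t T \<omega>] by (metis ereal_less_eq(3) max.boundedI max.cobounded1 min.cobounded1)

lemma stopping_clamp:
  assumes T: "stopping T" and st: "0 \<le> s" "s \<le> t"
  shows "stopping (\<lambda>\<omega>. ereal (clamp s t T \<omega>))"
  unfolding stopping_def
proof (intro allI impI)
  fix r :: real assume r: "0 \<le> r"
  consider "r \<le> s" | "t < r" | "s < r" "r \<le> t" by linarith
  then show "{\<omega> \<in> space M. ereal (clamp s t T \<omega>) < ereal r} \<in> sets (F r)"
  proof cases
    case 1
    then have "\<not> ereal (clamp s t T \<omega>) < ereal r" for \<omega>
      using clamp_bounds[OF st(2), of T \<omega>] by auto
    then show ?thesis by simp
  next
    case 2
    then have "{\<omega> \<in> space M. ereal (clamp s t T \<omega>) < ereal r} = space (F r)"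
      using le_less_trans[OF conjunct2[OF clamp_bounds[OF st(2)]]] r by auto
    then show ?thesis by (simp only: sets.top)
  next
    case 3
    then have "{\<omega> \<in> space M. ereal (clamp s t T \<omega>) < ereal r} = {\<omega> \<in> space M. T \<omega> < ereal r}"
      by (auto simp: ereal_clamp min_less_iff_disj)
    then show ?thesis using T r by (simp add: stopping_def)
  qed
qed

lemma stopping_min:
  assumes "stopping S" "stopping T"
  shows "stopping (\<lambda>\<omega>. min (S \<omega>) (T \<omega>))"
  unfolding stopping_def
proof (intro allI impI)
  fix r :: real assume r: "0 \<le> r"
  have "{\<omega> \<in> space M. min (S \<omega>) (T \<omega>) < ereal r} =
      {\<omega> \<in> space M. S \<omega> < ereal r} \<union> {\<omega> \<in> space M. T \<omega> < ereal r}"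
    by (auto simp: min_less_iff_disj)
  then show "{\<omega> \<in> space M. min (S \<omega>) (T \<omega>) < ereal r} \<in> sets (F r)"
    using assms r by (auto simp: stopping_def)
qed

lemma stopping_borel:
  assumes T: "stopping T" and pos: "\<And>\<omega>. \<omega> \<in> space M \<Longrightarrow> 0 \<le> T \<omega>"
  shows "T \<in> borel_measurable M"
proof (rule borel_measurableI_less)
  fix y :: ereal
  show "{\<omega> \<in> space M. T \<omega> < y} \<in> sets M"
  proof (cases y)
    case (real r)
    show ?thesis
    proof (cases "0 \<le> r")
      case True
      then have "{\<omega> \<in> space M. T \<omega> < ereal r} \<in> sets (F r)" using T by (simp add: stopping_def)
      then have "{\<omega> \<in> space M. T \<omega> < ereal r} \<in> sets M" by (rule sets_F_M[OF True])
      then show ?thesis by (simp only: real)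
    next
      case False
      have "\<not> T \<omega> < y" if "\<omega> \<in> space M" for \<omega>
      proof -
        have "y \<le> 0" using False real by simp
        also have "0 \<le> T \<omega>" using pos[OF that] .
        finally show ?thesis by simp
      qed
      then have "{\<omega> \<in> space M. T \<omega> < y} = {}" by blast
      then show ?thesis by (simp only: sets.empty_sets)
    qed
  next
    case PInf
    have "{\<omega> \<in> space M. T \<omega> < y} = (\<Union>n. {\<omega> \<in> space M. T \<omega> < ereal (real n)})"
    proof (intro set_eqI iffI)
      fix \<omega> assume *: "\<omega> \<in> {\<omega> \<in> space M. T \<omega> < y}"
      then obtain n :: nat where "T \<omega> < ereal (real n)"
        using PInf less_PInf_Ex_of_nat[of "T \<omega>"] by auto
      with * show "\<omega> \<in> (\<Union>n. {\<omega> \<in> space M. T \<omega> < ereal (real n)})" by auto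
    qed (use PInf in auto)
    also have "\<dots> \<in> sets M"
    proof (rule sets.countable_UN'')
      show "{\<omega> \<in> space M. T \<omega> < ereal (real n)} \<in> sets M" for n
        using T by (intro sets_F_M[of "real n"]) (simp_all add: stopping_def)
    qed simp
    finally show ?thesis .
  qed auto
qed

lemma measurable_clamp:
  assumes "stopping T" "0 \<le> s" "s \<le> t"
  shows "clamp s t T \<in> borel_measurable M"
proof -
  have "(\<lambda>\<omega>. ereal (clamp s t T \<omega>)) \<in> borel_measurable M"
    using stopping_clamp[OF assms] clamp_bounds[OF assms(3)] assms(2)
    by (intro stopping_borel) (auto intro: order_trans)
  then have "(\<lambda>\<omega>. real_of_ereal (ereal (clamp s t T \<omega>))) \<in> borel_measurable M"
    by (rule borel_measurable_real_of_ereal)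
  then show ?thesis by simp
qed

lemma stopping_le_in:
  assumes "stopping T" "0 \<le> r"
  shows "{\<omega> \<in> space M. ereal r \<le> T \<omega>} \<in> sets (F r)"
proof -
  have "{\<omega> \<in> space M. ereal r \<le> T \<omega>} = space (F r) - {\<omega> \<in> space M. T \<omega> < ereal r}"
    using assms(2) by auto
  then show ?thesis using assms by (simp only: sets.compl_sets stopping_def)
qed

end

definition hit :: "(real \<Rightarrow> real) \<Rightarrow> real \<Rightarrow> ereal" where
  "hit x c = Inf (ereal ` {t. 0 \<le> t \<and> c \<le> x t})"

lemma hit_nonneg: "0 \<le> hit x c"
  unfolding hit_def by (rule Inf_greatest) auto

lemma before_hit: "0 \<le> t \<Longrightarrow> ereal t < hit x c \<Longrightarrow> x t < c"
  unfolding hit_def using Inf_lower[of "ereal t" "ereal ` {t. 0 \<le> t \<and> c \<le> x t}"]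
  by (force simp: not_le)

lemma hit_le_iff:
  assumes x: "continuous_on {0..} x" and "0 \<le> t"
  shows "hit x c \<le> ereal t \<longleftrightarrow> (\<exists>s. 0 \<le> s \<and> s \<le> t \<and> c \<le> x s)"
proof
  assume "\<exists>s. 0 \<le> s \<and> s \<le> t \<and> c \<le> x s"
  then obtain s where "0 \<le> s" "s \<le> t" "c \<le> x s" by auto
  then have "hit x c \<le> ereal s" unfolding hit_def by (intro Inf_lower) auto
  with \<open>s \<le> t\<close> show "hit x c \<le> ereal t" by (meson ereal_less_eq(3) order_trans)
next
  assume le: "hit x c \<le> ereal t"
  show "\<exists>s. 0 \<le> s \<and> s \<le> t \<and> c \<le> x s"
  proof (rule ccontr)
    assume no: "\<not> ?thesis"
    have nhit: "x s < c" if "0 \<le> s" "s \<le> t" for s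
      using no that by (meson not_le)
    obtain d where d: "0 < d" "\<And>r. 0 \<le> r \<Longrightarrow> dist r t < d \<Longrightarrow> dist (x r) (x t) < c - x t"
      using x[unfolded continuous_on_iff, rule_format, of t "c - x t"] nhit[of t] assms(2) by auto
    have "x r < c" if "0 \<le> r" "r < t + d" for r
    proof (cases "r \<le> t")
      case False
      then show ?thesis using d(2)[of r] that by (auto simp: dist_real_def)
    qed (use nhit that in auto)
    then have "ereal (t + d) \<le> hit x c"
      unfolding hit_def by (intro Inf_greatest) (force simp: not_le[symmetric])
    also note le
    finally show False using d(1) by simp
  qed
qed

lemma at_hit:
  assumes x: "continuous_on {0..} x" and "hit x c = ereal t" "0 \<le> t"
  shows "c \<le> x t"
proof -
  obtain s where s: "0 \<le> s" "s \<le> t" "c \<le> x s" using hit_le_iff[OF x assms(3), of c] assms(2) by auto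
  then have "hit x c \<le> ereal s" unfolding hit_def by (intro Inf_lower) auto
  with s assms(2) show ?thesis by (metis antisym ereal_less_eq(3))
qed

lemma until_hit:
  assumes x: "continuous_on {0..} x" and "x 0 < c" "0 \<le> t" "ereal t \<le> hit x c"
  shows "x t \<le> c"
proof (cases "t = 0")
  case False
  then have t: "0 < t" using assms by auto
  have "(x \<longlongrightarrow> x t) (at t within {0..})"
    using x t by (auto simp: continuous_on_def)
  then have "(x \<longlongrightarrow> x t) (at t within {0..t})"
    by (rule tendsto_within_subset) auto
  then have lim: "(x \<longlongrightarrow> x t) (at_left t)"
    using t by (simp add: at_within_Icc_at_left)
  have "x s \<le> c" if "0 < s" "s < t" for s
  proof -
    have "ereal s < hit x c" using that(2) assms(4) by (meson ereal_less_eq(3) less_le_trans less_ereal.simps(1))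
    then show ?thesis using before_hit[of s x c] that by auto
  qed
  then have "\<forall>\<^sub>F s in at_left t. x s \<le> c"
    using t by (auto simp: eventually_at_left_field)
  with lim show ?thesis by (intro tendsto_upperbound) auto
qed (use assms in auto)

context filtered_measure
begin

lemma hit_le_in:
  assumes x: "\<And>s. 0 \<le> s \<Longrightarrow> x s \<in> borel_measurable (F s)"
    and cont: "\<And>\<omega>. \<omega> \<in> space M \<Longrightarrow> continuous_on {0..} (\<lambda>s. x s \<omega>)" and t: "0 \<le> t"
  shows "{\<omega> \<in> space M. hit (\<lambda>s. x s \<omega>) c \<le> ereal t} \<in> sets (F t)"
proof -
  have "(\<lambda>\<omega>. running_min (\<lambda>s. - x s \<omega>) t) \<in> borel_measurable (F t)"
    using x t measurable_F_mono[of _ t]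
    by (intro measurable_running_min borel_measurable_uminus continuous_intros cont) auto
  then have "{\<omega> \<in> space (F t). running_min (\<lambda>s. - x s \<omega>) t \<le> - c} \<in> sets (F t)"
    by measurable
  moreover have "hit (\<lambda>s. x s \<omega>) c \<le> ereal t \<longleftrightarrow> running_min (\<lambda>s. - x s \<omega>) t \<le> - c"
    if "\<omega> \<in> space M" for \<omega>
  proof -
    have c': "continuous_on {0..} (\<lambda>s. - x s \<omega>)" using cont[OF that] by (intro continuous_intros)
    show ?thesis
      unfolding hit_le_iff[OF cont[OF that] t]
    proof
      assume "\<exists>s\<ge>0. s \<le> t \<and> c \<le> x s \<omega>"
      then obtain s where "0 \<le> s" "s \<le> t" "c \<le> x s \<omega>" by auto
      then show "running_min (\<lambda>s. - x s \<omega>) t \<le> - c"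
        using running_min_le[OF c', of s t] by auto
    next
      assume "running_min (\<lambda>s. - x s \<omega>) t \<le> - c"
      then show "\<exists>s\<ge>0. s \<le> t \<and> c \<le> x s \<omega>"
        using running_min_attained[OF c' t] by (metis neg_le_iff_le)
    qed
  qed
  then have "{\<omega> \<in> space (F t). running_min (\<lambda>s. - x s \<omega>) t \<le> - c} =
      {\<omega> \<in> space M. hit (\<lambda>s. x s \<omega>) c \<le> ereal t}"
    using t by auto
  ultimately show ?thesis by simp
qed

lemma stopping_hit:
  assumes x: "\<And>s. 0 \<le> s \<Longrightarrow> x s \<in> borel_measurable (F s)"
    and cont: "\<And>\<omega>. \<omega> \<in> space M \<Longrightarrow> continuous_on {0..} (\<lambda>s. x s \<omega>)"
  shows "stopping (\<lambda>\<omega>. hit (\<lambda>s. x s \<omega>) c)"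
  unfolding stopping_def
proof (intro allI impI)
  fix r :: real assume r: "0 \<le> r"
  have "{\<omega> \<in> space M. hit (\<lambda>s. x s \<omega>) c < ereal r} =
      (\<Union>q\<in>{q \<in> \<rat>. 0 \<le> q \<and> q < r}. {\<omega> \<in> space M. hit (\<lambda>s. x s \<omega>) c \<le> ereal q})" (is "?L = ?R")
  proof (intro set_eqI iffI)
    fix \<omega> assume *: "\<omega> \<in> ?L"
    then obtain h where h: "hit (\<lambda>s. x s \<omega>) c = ereal h" "0 \<le> h"
      using hit_nonneg[of "\<lambda>s. x s \<omega>" c] by (cases "hit (\<lambda>s. x s \<omega>) c") auto
    then obtain q where "q \<in> \<rat>" "h < q" "q < r" using * Rats_dense_in_real[of h r] by auto
    with * h show "\<omega> \<in> ?R" by (auto intro!: bexI[of _ q])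
  next
    fix \<omega> assume "\<omega> \<in> ?R"
    then show "\<omega> \<in> ?L" by (auto intro: le_less_trans)
  qed
  also have "\<dots> \<in> sets (F r)"
  proof (rule sets.countable_UN'')
    show "countable {q \<in> \<rat>. 0 \<le> q \<and> q < r}"
      by (rule countable_subset[OF _ countable_rat]) auto
  next
    fix q assume "q \<in> {q \<in> \<rat>. 0 \<le> q \<and> q < r}"
    then show "{\<omega> \<in> space M. hit (\<lambda>s. x s \<omega>) c \<le> ereal q} \<in> sets (F r)"
      using hit_le_in[OF x cont, of q c] F_mono[of q r] by auto
  qed
  finally show "?L \<in> sets (F r)" .
qed

end

section \<open>Optional stopping for the exponential martingale\<close>

text \<open>The exponent is normalized by the starting time \<open>a\<close>, because \<open>exp (\<theta> X)\<close> alone need not be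
  integrable: after a change at \<open>\<tau>\<close>, nothing is known about the integrability of the reciprocal
  likelihood ratio at \<open>\<tau>\<close>.\<close>

locale exp_martingale = prob_space M + filtered_measure M F
  for M :: "'a measure" and F +
  fixes X :: "real \<Rightarrow> 'a \<Rightarrow> real" and \<theta> a :: real
  assumes a_nonneg: "0 \<le> a"
    and X_adapted: "\<And>t. 0 \<le> t \<Longrightarrow> X t \<in> borel_measurable (F t)"
    and X_cont: "\<And>\<omega>. \<omega> \<in> space M \<Longrightarrow> continuous_on {0..} (\<lambda>t. X t \<omega>)"
    and exp_integrable: "\<And>t. a \<le> t \<Longrightarrow> integrable M (\<lambda>\<omega>. exp (\<theta> * (X t \<omega> - X a \<omega>)))"
    and exp_mart: "\<And>s t A. a \<le> s \<Longrightarrow> s \<le> t \<Longrightarrow> A \<in> sets (F s) \<Longrightarrow>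
      (\<integral>\<omega>\<in>A. exp (\<theta> * (X t \<omega> - X a \<omega>)) \<partial>M) = (\<integral>\<omega>\<in>A. exp (\<theta> * (X s \<omega> - X a \<omega>)) \<partial>M)"
begin

definition expX :: "real \<Rightarrow> 'a \<Rightarrow> real" where
  "expX t \<omega> = exp (\<theta> * (X t \<omega> - X a \<omega>))"

lemma X_measurable_F: "0 \<le> s \<Longrightarrow> s \<le> t \<Longrightarrow> X s \<in> borel_measurable (F t)"
  using X_adapted measurable_F_mono by blast

lemma X_measurable: "0 \<le> t \<Longrightarrow> X t \<in> borel_measurable M"
  using X_adapted measurable_F_M by blast

lemma expX_measurable_F: "a \<le> s \<Longrightarrow> s \<le> t \<Longrightarrow> expX s \<in> borel_measurable (F t)"
  using X_measurable_F[of s t] X_measurable_F[of a t] a_nonneg unfolding expX_def by simp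

lemma expX_pos: "0 < expX t \<omega>"
  by (simp add: expX_def)

lemma weighted_martingale:
  assumes st: "a \<le> s" "s \<le> t" and Z: "Z \<in> borel_measurable (F s)"
    and bd: "\<And>\<omega>. \<omega> \<in> space M \<Longrightarrow> \<bar>Z \<omega>\<bar> \<le> B"
  shows "integrable M (\<lambda>\<omega>. Z \<omega> * expX t \<omega>)"
    and "(\<integral>\<omega>. Z \<omega> * expX t \<omega> \<partial>M) = (\<integral>\<omega>. Z \<omega> * expX s \<omega> \<partial>M)"
proof -
  have s0: "0 \<le> s" using st a_nonneg by auto
  have Et: "integrable M (expX t)" and Es: "integrable M (expX s)"
    using exp_integrable[of t] exp_integrable[of s] st unfolding expX_def by auto
  have ZM: "Z \<in> borel_measurable M" using Z measurable_F_M[OF s0] by auto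
  show int: "integrable M (\<lambda>\<omega>. Z \<omega> * expX t \<omega>)"
  proof (rule Bochner_Integration.integrable_bound)
    show "integrable M (\<lambda>\<omega>. B * expX t \<omega>)" using Et by simp
    show "(\<lambda>\<omega>. Z \<omega> * expX t \<omega>) \<in> borel_measurable M" using ZM Et by measurable
    show "AE \<omega> in M. norm (Z \<omega> * expX t \<omega>) \<le> norm (B * expX t \<omega>)"
    proof (intro AE_I2)
      fix \<omega> assume "\<omega> \<in> space M"
      then have "\<bar>Z \<omega>\<bar> * expX t \<omega> \<le> \<bar>B\<bar> * expX t \<omega>"
        using bd[of \<omega>] expX_pos[of t \<omega>] by (intro mult_right_mono) auto
      then show "norm (Z \<omega> * expX t \<omega>) \<le> norm (B * expX t \<omega>)"
        using expX_pos[of t \<omega>] by (simp add: abs_mult)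
    qed
  qed
  interpret sub: finite_measure_subalgebra M "F s"
    using subalg[OF s0] by unfold_locales
  have ae: "AE \<omega> in M. real_cond_exp M (F s) (expX t) \<omega> = expX s \<omega>"
    using exp_mart[OF st] Et Es expX_measurable_F[OF st(1), of s]
    by (intro sub.real_cond_exp_charact) (simp_all add: expX_def[abs_def])
  have "(\<integral>\<omega>. Z \<omega> * expX t \<omega> \<partial>M) = (\<integral>\<omega>. Z \<omega> * real_cond_exp M (F s) (expX t) \<omega> \<partial>M)"
    using int Z Et by (intro sub.real_cond_exp_intg(2)[symmetric]) auto
  also have "\<dots> = (\<integral>\<omega>. Z \<omega> * expX s \<omega> \<partial>M)"
  proof (rule integral_cong_AE)
    show "(\<lambda>\<omega>. Z \<omega> * real_cond_exp M (F s) (expX t) \<omega>) \<in> borel_measurable M"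
      using ZM by measurable
    show "(\<lambda>\<omega>. Z \<omega> * expX s \<omega>) \<in> borel_measurable M"
      using ZM Es by measurable
  qed (use ae in auto)
  finally show "(\<integral>\<omega>. Z \<omega> * expX t \<omega> \<partial>M) = (\<integral>\<omega>. Z \<omega> * expX s \<omega> \<partial>M)" .
qed

text \<open>The stopping time is approximated from above by the next point of a grid of mesh
  \<open>1 / (n + 1)\<close>. The process may be unbounded between the stopping time and the grid point;
  the cutoff \<open>\<psi>\<close>, evaluated at the grid point, makes both sides of the identity at the grid
  points dominated, and it disappears in the limit.\<close>

lemma optional_stopping:
  assumes st: "a \<le> s" "s \<le> t" and Z: "Z \<in> borel_measurable (F s)"
    and bd: "\<And>\<omega>. \<omega> \<in> space M \<Longrightarrow> \<bar>Z \<omega>\<bar> \<le> B"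
    and \<sigma>: "stopping (\<lambda>\<omega>. ereal (\<sigma> \<omega>))" "\<sigma> \<in> borel_measurable M"
    and \<sigma>_st: "\<And>\<omega>. \<omega> \<in> space M \<Longrightarrow> s \<le> \<sigma> \<omega> \<and> \<sigma> \<omega> \<le> t"
    and c: "\<And>\<omega>. \<omega> \<in> space M \<Longrightarrow> Z \<omega> \<noteq> 0 \<Longrightarrow> \<bar>X (\<sigma> \<omega>) \<omega> - X a \<omega>\<bar> \<le> c"
  shows "integrable M (\<lambda>\<omega>. Z \<omega> * expX (\<sigma> \<omega>) \<omega>)"
    and "(\<integral>\<omega>. Z \<omega> * expX (\<sigma> \<omega>) \<omega> \<partial>M) = (\<integral>\<omega>. Z \<omega> * expX s \<omega> \<partial>M)"
proof -
  have s0: "0 \<le> s" and t0: "0 \<le> t" using st a_nonneg by auto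
  have ZM[measurable]: "Z \<in> borel_measurable M" using Z measurable_F_M[OF s0] by auto
  have [measurable]: "\<sigma> \<in> borel_measurable M" by fact
  have [measurable]: "X a \<in> borel_measurable M" using X_measurable a_nonneg by auto
  have B: "0 \<le> B" if "\<omega> \<in> space M" for \<omega> using bd[OF that] by auto
  define \<psi> :: "real \<Rightarrow> real" where "\<psi> v = max 0 (min 1 (c + 1 - \<bar>v\<bar>))" for v
  have \<psi>: "0 \<le> \<psi> v" "\<psi> v \<le> 1" "\<bar>v\<bar> \<le> c \<Longrightarrow> \<psi> v = 1" "\<psi> v \<noteq> 0 \<Longrightarrow> \<bar>v\<bar> \<le> c + 1" for v
    by (auto simp: \<psi>_def)
  have \<psi>_cont: "continuous_on UNIV \<psi>" unfolding \<psi>_def by (intro continuous_intros)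
  have \<psi>_meas[measurable]: "\<psi> \<in> borel_measurable borel"
    using \<psi>_cont by (rule borel_measurable_continuous_onI)
  define p where "p n j = min t (max s (real_of_int (j + 1) / real (Suc n)))" for n :: nat and j :: int
  have p: "s \<le> p n j" "p n j \<le> t" for n j using st by (auto simp: p_def)
  \<comment> \<open>\<open>J\<close> numbers the grid cell of \<open>\<sigma>\<close>, and \<open>p\<close> is its right end point, forced into \<open>[s, t]\<close>.\<close>
  define J where "J n \<omega> = \<lfloor>\<sigma> \<omega> * real (Suc n)\<rfloor>" for n \<omega>
  define g where "g n \<omega> = p n (J n \<omega>)" for n \<omega>
  have [measurable]: "g n \<in> borel_measurable M" for n unfolding g_def p_def J_def by measurable
  have [measurable]: "(\<lambda>\<omega>. X (g n \<omega>) \<omega>) \<in> borel_measurable M" for n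
  proof (rule measurable_at_random_time[where t = t and \<rho> = "g n"])
    show "0 \<le> g n \<omega>" "g n \<omega> \<le> t" for \<omega>
      using p[of n "J n \<omega>"] s0 by (simp_all add: g_def)
  qed (simp_all add: X_measurable X_cont)
  have X\<sigma>[measurable]: "(\<lambda>\<omega>. X (\<sigma> \<omega>) \<omega>) \<in> borel_measurable M"
  proof (rule measurable_at_random_time[where t = t and \<rho> = "\<sigma>"])
    show "0 \<le> \<sigma> \<omega>" "\<sigma> \<omega> \<le> t" if "\<omega> \<in> space M" for \<omega>
      using \<sigma>_st[OF that] s0 by simp_all
  qed (simp_all add: X_measurable X_cont)
  have Et: "integrable M (expX t)" using exp_integrable[of t] st unfolding expX_def by auto
  have [measurable]: "expX t \<in> borel_measurable M" using Et by auto
  have step_in: "{\<omega> \<in> space M. \<sigma> \<omega> < q} \<in> sets (F r)" if r: "0 \<le> r" "q \<le> r \<or> t \<le> r" for q r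
  proof -
    consider "q \<le> r" "0 \<le> q" | "q < 0" | "r < q" "t \<le> r" using r by linarith
    then show ?thesis
    proof cases
      case 1
      then have "{\<omega> \<in> space M. ereal (\<sigma> \<omega>) < ereal q} \<in> sets (F q)"
        using \<sigma>(1) by (simp only: stopping_def)
      then show ?thesis using F_mono[of q r] 1 by auto
    next
      case 2
      then have no: "\<not> \<sigma> \<omega> < q" if "\<omega> \<in> space M" for \<omega> using \<sigma>_st[OF that] s0 by auto
      have "{\<omega> \<in> space M. \<sigma> \<omega> < q} = {}" using no by blast
      then show ?thesis by (simp only: sets.empty_sets)
    next
      case 3
      then have yes: "\<sigma> \<omega> < q" if "\<omega> \<in> space M" for \<omega> using \<sigma>_st[OF that] by auto
      have "{\<omega> \<in> space M. \<sigma> \<omega> < q} = space (F r)" using yes r(1) by auto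
      then show ?thesis by (simp only: sets.top)
    qed
  qed
  \<comment> \<open>On each grid cell the weight is known at the right end point, so the martingale may be
    carried from there to \<open>t\<close>.\<close>
  have grid: "(\<integral>\<omega>. Z \<omega> * \<psi> (X (g n \<omega>) \<omega> - X a \<omega>) * expX (g n \<omega>) \<omega> \<partial>M) =
      (\<integral>\<omega>. Z \<omega> * \<psi> (X (g n \<omega>) \<omega> - X a \<omega>) * expX t \<omega> \<partial>M)" for n
  proof -
    define I where "I = {0..\<lfloor>t * real (Suc n)\<rfloor>}"
    define W where "W j \<omega> = Z \<omega> * \<psi> (X (p n j) \<omega> - X a \<omega>) * indicator {\<omega> \<in> space M. J n \<omega> = j} \<omega>" for j \<omega>
    have JI: "J n \<omega> \<in> I" if "\<omega> \<in> space M" for \<omega>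
      using \<sigma>_st[OF that] s0 by (auto simp: J_def I_def intro!: floor_mono mult_right_mono)
    have J_in: "{\<omega> \<in> space M. J n \<omega> = j} \<in> sets (F (p n j))" for j
    proof -
      have r0: "0 \<le> p n j" using p(1) s0 by (rule order_trans[rotated])
      have iff: "J n \<omega> = j \<longleftrightarrow> \<not> \<sigma> \<omega> < real_of_int j / real (Suc n) \<and>
          \<sigma> \<omega> < real_of_int (j + 1) / real (Suc n)" for \<omega>
        unfolding J_def floor_eq_iff by (auto simp: field_simps simp del: of_nat_Suc)
      have lt: "real_of_int j / real (Suc n) \<le> real_of_int (j + 1) / real (Suc n)"
        by (intro divide_right_mono) auto
      have "{\<omega> \<in> space M. J n \<omega> = j} = {\<omega> \<in> space M. \<sigma> \<omega> < real_of_int (j + 1) / real (Suc n)} -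
          {\<omega> \<in> space M. \<sigma> \<omega> < real_of_int j / real (Suc n)}"
        using iff by blast
      moreover have "real_of_int (j + 1) / real (Suc n) \<le> p n j \<or> t \<le> p n j"
        by (auto simp: p_def)
      ultimately show ?thesis
        using step_in[OF r0, of "real_of_int (j + 1) / real (Suc n)"]
          step_in[OF r0, of "real_of_int j / real (Suc n)"] lt by auto
    qed
    have W: "W j \<in> borel_measurable (F (p n j))" for j
    proof -
      have "0 \<le> p n j" using p(1) s0 by (rule order_trans[rotated])
      then have "X (p n j) \<in> borel_measurable (F (p n j))" "X a \<in> borel_measurable (F (p n j))"
        "Z \<in> borel_measurable (F (p n j))"
        using X_measurable_F[of "p n j"] X_measurable_F[of a] a_nonneg p(1)[of n j] st(1) s0
          measurable_F_mono[OF s0 p(1) Z] by auto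
      then show ?thesis
        unfolding W_def using J_in by measurable
    qed
    have W_bd: "\<bar>W j \<omega>\<bar> \<le> B" if "\<omega> \<in> space M" for j \<omega>
    proof -
      have "\<bar>Z \<omega>\<bar> * \<psi> (X (p n j) \<omega> - X a \<omega>) \<le> B * 1"
        using bd[OF that] \<psi>(1,2) B[OF that] by (intro mult_mono) auto
      then show ?thesis
        using \<psi>(1) B[OF that] by (auto simp: W_def abs_mult indicator_def)
    qed
    have aj: "a \<le> p n j" for j using p(1)[of n j] st by auto
    have collapse: "(\<Sum>j\<in>I. W j \<omega> * f j) = Z \<omega> * \<psi> (X (g n \<omega>) \<omega> - X a \<omega>) * f (J n \<omega>)"
      if "\<omega> \<in> space M" for \<omega> f
    proof -
      have "(\<Sum>j\<in>I. W j \<omega> * f j) = (\<Sum>j\<in>{J n \<omega>}. W j \<omega> * f j)"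
        using JI[OF that] that by (intro sum.mono_neutral_right) (auto simp: W_def I_def)
      then show ?thesis using that by (simp add: W_def g_def)
    qed
    have "(\<integral>\<omega>. Z \<omega> * \<psi> (X (g n \<omega>) \<omega> - X a \<omega>) * expX (g n \<omega>) \<omega> \<partial>M) =
        (\<integral>\<omega>. (\<Sum>j\<in>I. W j \<omega> * expX (p n j) \<omega>) \<partial>M)"
      by (intro Bochner_Integration.integral_cong) (auto simp: collapse g_def)
    also have "\<dots> = (\<Sum>j\<in>I. \<integral>\<omega>. W j \<omega> * expX (p n j) \<omega> \<partial>M)"
      using weighted_martingale(1)[OF aj order_refl W W_bd]
      by (intro Bochner_Integration.integral_sum) auto
    also have "\<dots> = (\<Sum>j\<in>I. \<integral>\<omega>. W j \<omega> * expX t \<omega> \<partial>M)"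
      using weighted_martingale(2)[OF aj p(2) W W_bd] by (intro sum.cong) auto
    also have "\<dots> = (\<integral>\<omega>. (\<Sum>j\<in>I. W j \<omega> * expX t \<omega>) \<partial>M)"
      using weighted_martingale(1)[OF aj p(2) W W_bd]
      by (intro Bochner_Integration.integral_sum[symmetric]) auto
    also have "\<dots> = (\<integral>\<omega>. Z \<omega> * \<psi> (X (g n \<omega>) \<omega> - X a \<omega>) * expX t \<omega> \<partial>M)"
      by (intro Bochner_Integration.integral_cong) (auto simp: collapse)
    finally show ?thesis .
  qed
  have g_lim: "(\<lambda>n. g n \<omega>) \<longlonglongrightarrow> \<sigma> \<omega>" if "\<omega> \<in> space M" for \<omega>
  proof -
    have "(\<lambda>n. min t (max s (real_of_int \<lfloor>\<sigma> \<omega> * real (Suc n)\<rfloor> / real (Suc n) + 1 / real (Suc n))))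
        \<longlonglongrightarrow> min t (max s (\<sigma> \<omega> + 0))"
      by (intro tendsto_intros floor_grid_tendsto LIMSEQ_Suc[OF lim_1_over_n])
    then show ?thesis
      using \<sigma>_st[OF that] by (simp add: g_def p_def J_def add_divide_distrib min_absorb2 max_absorb2 del: of_nat_Suc)
  qed
  have Xg_lim: "(\<lambda>n. X (g n \<omega>) \<omega>) \<longlonglongrightarrow> X (\<sigma> \<omega>) \<omega>" if "\<omega> \<in> space M" for \<omega>
    using continuous_on_tendsto_compose[OF X_cont[OF that] g_lim[OF that]] \<sigma>_st[OF that] s0
      order_trans[OF s0 p(1)]
    by (simp add: g_def)
  have \<psi>_lim: "(\<lambda>n. \<psi> (X (g n \<omega>) \<omega> - X a \<omega>)) \<longlonglongrightarrow> \<psi> (X (\<sigma> \<omega>) \<omega> - X a \<omega>)" if "\<omega> \<in> space M" for \<omega>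
    by (rule continuous_on_tendsto_compose[OF \<psi>_cont]) (auto intro!: tendsto_intros Xg_lim that)
  have Z\<psi>: "Z \<omega> * \<psi> (X (\<sigma> \<omega>) \<omega> - X a \<omega>) = Z \<omega>" if "\<omega> \<in> space M" for \<omega>
    using c[OF that] \<psi>(3) by (cases "Z \<omega> = 0") auto
  have E_le: "\<psi> (X r \<omega> - X a \<omega>) * expX r \<omega> \<le> exp (\<bar>\<theta>\<bar> * (c + 1))" for r \<omega>
  proof (cases "\<psi> (X r \<omega> - X a \<omega>) = 0")
    case False
    have "\<theta> * (X r \<omega> - X a \<omega>) \<le> \<bar>\<theta>\<bar> * \<bar>X r \<omega> - X a \<omega>\<bar>" by (metis abs_ge_self abs_mult)
    also have "\<dots> \<le> \<bar>\<theta>\<bar> * (c + 1)" using \<psi>(4)[OF False] by (intro mult_left_mono) auto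
    finally have "expX r \<omega> \<le> exp (\<bar>\<theta>\<bar> * (c + 1))" by (simp add: expX_def)
    moreover have "\<psi> (X r \<omega> - X a \<omega>) * expX r \<omega> \<le> 1 * expX r \<omega>"
      using \<psi>(2) expX_pos[of r \<omega>] by (intro mult_right_mono) auto
    ultimately show ?thesis by simp
  qed auto
  have bnd1: "norm (Z \<omega> * \<psi> (X r \<omega> - X a \<omega>) * expX r \<omega>) \<le> B * exp (\<bar>\<theta>\<bar> * (c + 1))"
    if "\<omega> \<in> space M" for r \<omega>
  proof -
    have "\<bar>Z \<omega>\<bar> * (\<psi> (X r \<omega> - X a \<omega>) * expX r \<omega>) \<le> B * exp (\<bar>\<theta>\<bar> * (c + 1))"
      using bd[OF that] E_le[of r \<omega>] B[OF that] \<psi>(1) expX_pos[of r \<omega>] by (intro mult_mono) (auto simp: less_imp_le)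
    then show ?thesis using \<psi>(1) expX_pos[of r \<omega>] by (simp add: abs_mult mult.assoc)
  qed
  have bnd2: "norm (Z \<omega> * \<psi> (X r \<omega> - X a \<omega>) * expX t \<omega>) \<le> B * expX t \<omega>" if "\<omega> \<in> space M" for r \<omega>
  proof -
    have "\<bar>Z \<omega>\<bar> * \<psi> (X r \<omega> - X a \<omega>) * expX t \<omega> \<le> B * 1 * expX t \<omega>"
      using bd[OF that] \<psi>(1,2) B[OF that] expX_pos[of t \<omega>] by (intro mult_mono) (auto simp: less_imp_le)
    then show ?thesis using \<psi>(1) expX_pos[of t \<omega>] by (simp add: abs_mult)
  qed
  have expX\<sigma>: "(\<lambda>\<omega>. expX (\<sigma> \<omega>) \<omega>) \<in> borel_measurable M" "(\<lambda>\<omega>. expX (g n \<omega>) \<omega>) \<in> borel_measurable M" for n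
    unfolding expX_def by measurable
  note [measurable] = expX\<sigma>
  have "(\<lambda>n. \<integral>\<omega>. Z \<omega> * \<psi> (X (g n \<omega>) \<omega> - X a \<omega>) * expX (g n \<omega>) \<omega> \<partial>M)
      \<longlonglongrightarrow> (\<integral>\<omega>. Z \<omega> * \<psi> (X (\<sigma> \<omega>) \<omega> - X a \<omega>) * expX (\<sigma> \<omega>) \<omega> \<partial>M)"
  proof (rule integral_dominated_convergence[where w = "\<lambda>_. B * exp (\<bar>\<theta>\<bar> * (c + 1))"])
    show "AE \<omega> in M. (\<lambda>n. Z \<omega> * \<psi> (X (g n \<omega>) \<omega> - X a \<omega>) * expX (g n \<omega>) \<omega>)
        \<longlonglongrightarrow> Z \<omega> * \<psi> (X (\<sigma> \<omega>) \<omega> - X a \<omega>) * expX (\<sigma> \<omega>) \<omega>"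
      unfolding expX_def by (intro AE_I2 tendsto_intros \<psi>_lim Xg_lim)
  qed (use bnd1 in auto)
  moreover have "(\<lambda>n. \<integral>\<omega>. Z \<omega> * \<psi> (X (g n \<omega>) \<omega> - X a \<omega>) * expX t \<omega> \<partial>M)
      \<longlonglongrightarrow> (\<integral>\<omega>. Z \<omega> * \<psi> (X (\<sigma> \<omega>) \<omega> - X a \<omega>) * expX t \<omega> \<partial>M)"
  proof (rule integral_dominated_convergence[where w = "\<lambda>\<omega>. B * expX t \<omega>"])
    show "AE \<omega> in M. (\<lambda>n. Z \<omega> * \<psi> (X (g n \<omega>) \<omega> - X a \<omega>) * expX t \<omega>)
        \<longlonglongrightarrow> Z \<omega> * \<psi> (X (\<sigma> \<omega>) \<omega> - X a \<omega>) * expX t \<omega>"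
      by (intro AE_I2 tendsto_intros \<psi>_lim)
  qed (use bnd2 Et in auto)
  ultimately have "(\<integral>\<omega>. Z \<omega> * \<psi> (X (\<sigma> \<omega>) \<omega> - X a \<omega>) * expX (\<sigma> \<omega>) \<omega> \<partial>M) =
      (\<integral>\<omega>. Z \<omega> * \<psi> (X (\<sigma> \<omega>) \<omega> - X a \<omega>) * expX t \<omega> \<partial>M)"
    unfolding grid by (rule LIMSEQ_unique)
  moreover have "(\<integral>\<omega>. Z \<omega> * \<psi> (X (\<sigma> \<omega>) \<omega> - X a \<omega>) * f \<omega> \<partial>M) = (\<integral>\<omega>. Z \<omega> * f \<omega> \<partial>M)" for f
    by (intro Bochner_Integration.integral_cong) (auto simp: Z\<psi>)
  ultimately show "(\<integral>\<omega>. Z \<omega> * expX (\<sigma> \<omega>) \<omega> \<partial>M) = (\<integral>\<omega>. Z \<omega> * expX s \<omega> \<partial>M)"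
    using weighted_martingale(2)[OF st Z bd] by simp
  show "integrable M (\<lambda>\<omega>. Z \<omega> * expX (\<sigma> \<omega>) \<omega>)"
  proof (rule Bochner_Integration.integrable_bound)
    show "integrable M (\<lambda>_. B * exp (\<bar>\<theta>\<bar> * (c + 1)))" by simp
    show "AE \<omega> in M. norm (Z \<omega> * expX (\<sigma> \<omega>) \<omega>) \<le> norm (B * exp (\<bar>\<theta>\<bar> * (c + 1)))"
    proof (intro AE_I2)
      fix \<omega> assume \<omega>: "\<omega> \<in> space M"
      have "norm (Z \<omega> * expX (\<sigma> \<omega>) \<omega>) \<le> B * exp (\<bar>\<theta>\<bar> * (c + 1))"
        using bnd1[OF \<omega>, of "\<sigma> \<omega>"] Z\<psi>[OF \<omega>] by simp
      then show "norm (Z \<omega> * expX (\<sigma> \<omega>) \<omega>) \<le> norm (B * exp (\<bar>\<theta>\<bar> * (c + 1)))" by simp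
    qed
  qed measurable
qed

end

section \<open>The Azema-Yor identity\<close>

lemma abs_exp_minus_one_le: "\<bar>exp v - 1\<bar> \<le> exp w - 1" if "\<bar>v\<bar> \<le> w" for v w :: real
proof (cases "0 \<le> v")
  case True
  then show ?thesis using that by simp
next
  case False
  have "1 - exp v \<le> - v" using exp_ge_add_one_self[of v] by linarith
  also have "\<dots> \<le> exp (- v) - 1" using exp_ge_add_one_self[of "- v"] by linarith
  also have "\<dots> \<le> exp w - 1" using that by simp
  finally show ?thesis using False by simp
qed

lemma exp_linear_error:
  fixes \<theta> w :: real
  assumes "u \<le> y" "- w \<le> u" "y \<le> w"
  shows "\<bar>exp (\<theta> * u) - exp (\<theta> * y) + \<theta> * (y - u)\<bar> \<le> \<bar>\<theta>\<bar> * (y - u) * (exp (\<bar>\<theta>\<bar> * w) - 1)"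
proof (cases "u = y")
  case False
  then have "u < y" using assms by auto
  moreover have "((\<lambda>v. exp (\<theta> * v) - \<theta> * v) has_real_derivative \<theta> * (exp (\<theta> * v) - 1)) (at v)" for v
    by (auto intro!: derivative_eq_intros simp: algebra_simps)
  ultimately obtain z where z: "u < z" "z < y"
    "(exp (\<theta> * y) - \<theta> * y) - (exp (\<theta> * u) - \<theta> * u) = (y - u) * (\<theta> * (exp (\<theta> * z) - 1))"
    using MVT2[of u y "\<lambda>v. exp (\<theta> * v) - \<theta> * v" "\<lambda>v. \<theta> * (exp (\<theta> * v) - 1)"] by metis
  have eq: "exp (\<theta> * u) - exp (\<theta> * y) + \<theta> * (y - u) = - ((y - u) * (\<theta> * (exp (\<theta> * z) - 1)))"
    using z(3) by (simp add: algebra_simps)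
  have "\<bar>\<theta> * z\<bar> \<le> \<bar>\<theta>\<bar> * w"
    unfolding abs_mult using z assms by (intro mult_left_mono) auto
  then have "\<bar>exp (\<theta> * z) - 1\<bar> \<le> exp (\<bar>\<theta>\<bar> * w) - 1"
    by (rule abs_exp_minus_one_le)
  then have "(y - u) * (\<bar>\<theta>\<bar> * \<bar>exp (\<theta> * z) - 1\<bar>) \<le> (y - u) * (\<bar>\<theta>\<bar> * (exp (\<bar>\<theta>\<bar> * w) - 1))"
    using assms by (intro mult_left_mono) auto
  moreover have "\<bar>- ((y - u) * (\<theta> * (exp (\<theta> * z) - 1)))\<bar> = (y - u) * (\<bar>\<theta>\<bar> * \<bar>exp (\<theta> * z) - 1\<bar>)"
    using assms by (simp add: abs_mult)
  ultimately show ?thesis unfolding eq by (simp add: mult_ac)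
qed simp

text \<open>In a step in which the minimum moves, the path comes within its oscillation \<open>w\<close> of the minimum.
  There \<open>exp (\<theta> \<cdot>)\<close> has slope \<open>\<theta>\<close> up to a relative error \<open>exp (\<bar>\<theta>\<bar> w) - 1\<close>. In all other
  steps there is no error.\<close>

lemma azema_yor_step:
  fixes \<theta> w :: real
  defines "y \<equiv> \<lambda>x t. x t - running_min x t"
  assumes x: "continuous_on {0..} x" and st: "0 \<le> s" "s \<le> t"
    and osc: "\<And>r. s \<le> r \<Longrightarrow> r \<le> t \<Longrightarrow> \<bar>x r - x t\<bar> \<le> w"
  shows "\<bar>(exp (\<theta> * (x t - running_min x s)) - exp (\<theta> * (x s - running_min x s)))
      - (exp (\<theta> * y x t) - exp (\<theta> * y x s) - \<theta> * (running_min x s - running_min x t))\<bar>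
    \<le> \<bar>\<theta>\<bar> * (running_min x s - running_min x t) * (exp (\<bar>\<theta>\<bar> * w) - 1)"
proof (cases "running_min x t = running_min x s")
  case False
  then obtain r where r: "s \<le> r" "r \<le> t" "running_min x t = x r"
    using running_min_drop[OF x st] by metis
  have "y x t \<le> w" using osc[OF r(1,2)] r(3) by (auto simp: y_def)
  moreover have "- w \<le> x t - running_min x s"
    using osc[of s] st running_min_le[OF x st(1), of s] by auto
  moreover have "x t - running_min x s \<le> y x t"
    using running_min_antimono[OF x st] by (simp add: y_def)
  ultimately show ?thesis
    using exp_linear_error[of "x t - running_min x s" "y x t" w \<theta>]
    by (simp add: y_def algebra_simps)
qed (simp add: y_def)

lemma azema_yor_path:
  fixes \<theta> w :: real and p :: "nat \<Rightarrow> real"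
  defines "y \<equiv> \<lambda>x t. x t - running_min x t"
  assumes x: "continuous_on {0..} x" and p: "0 \<le> p 0" "\<And>i. i < n \<Longrightarrow> p i \<le> p (Suc i)"
    and osc: "\<And>i r. i < n \<Longrightarrow> p i \<le> r \<Longrightarrow> r \<le> p (Suc i) \<Longrightarrow> \<bar>x r - x (p (Suc i))\<bar> \<le> w"
  shows "\<bar>(\<Sum>i<n. exp (\<theta> * (x (p (Suc i)) - running_min x (p i))) - exp (\<theta> * (x (p i) - running_min x (p i))))
      - (exp (\<theta> * y x (p n)) - exp (\<theta> * y x (p 0)) - \<theta> * (running_min x (p 0) - running_min x (p n)))\<bar>
    \<le> \<bar>\<theta>\<bar> * (running_min x (p 0) - running_min x (p n)) * (exp (\<bar>\<theta>\<bar> * w) - 1)"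
  using p(2) osc
proof (induction n)
  case (Suc n)
  have p_nonneg: "0 \<le> p i" if "i \<le> n" for i
    using that
  proof (induction i)
    case (Suc i)
    then show ?case using Suc.prems(1) \<open>\<And>i. i < Suc n \<Longrightarrow> p i \<le> p (Suc i)\<close>[of i] by auto
  qed (use p in auto)
  have IH: "\<bar>(\<Sum>i<n. exp (\<theta> * (x (p (Suc i)) - running_min x (p i))) - exp (\<theta> * (x (p i) - running_min x (p i))))
      - (exp (\<theta> * y x (p n)) - exp (\<theta> * y x (p 0)) - \<theta> * (running_min x (p 0) - running_min x (p n)))\<bar>
    \<le> \<bar>\<theta>\<bar> * (running_min x (p 0) - running_min x (p n)) * (exp (\<bar>\<theta>\<bar> * w) - 1)"
    using Suc.prems by (intro Suc.IH) auto
  have step: "\<bar>(exp (\<theta> * (x (p (Suc n)) - running_min x (p n))) - exp (\<theta> * (x (p n) - running_min x (p n))))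
      - (exp (\<theta> * y x (p (Suc n))) - exp (\<theta> * y x (p n)) - \<theta> * (running_min x (p n) - running_min x (p (Suc n))))\<bar>
    \<le> \<bar>\<theta>\<bar> * (running_min x (p n) - running_min x (p (Suc n))) * (exp (\<bar>\<theta>\<bar> * w) - 1)"
    unfolding y_def using Suc.prems p_nonneg[of n] by (intro azema_yor_step[OF x]) auto
  have rhs: "\<bar>\<theta>\<bar> * (running_min x (p 0) - running_min x (p (Suc n))) * (exp (\<bar>\<theta>\<bar> * w) - 1) =
      \<bar>\<theta>\<bar> * (running_min x (p 0) - running_min x (p n)) * (exp (\<bar>\<theta>\<bar> * w) - 1) +
      \<bar>\<theta>\<bar> * (running_min x (p n) - running_min x (p (Suc n))) * (exp (\<bar>\<theta>\<bar> * w) - 1)"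
    by (simp add: algebra_simps)
  have mid: "\<theta> * (running_min x (p 0) - running_min x (p (Suc n))) =
      \<theta> * (running_min x (p 0) - running_min x (p n)) + \<theta> * (running_min x (p n) - running_min x (p (Suc n)))"
    by (simp add: algebra_simps)
  show ?case
    unfolding rhs mid sum.lessThan_Suc using IH step by linarith
qed simp

context exp_martingale
begin

definition m :: "real \<Rightarrow> 'a \<Rightarrow> real" where
  "m t \<omega> = running_min (\<lambda>s. X s \<omega>) t"

definition y :: "real \<Rightarrow> 'a \<Rightarrow> real" where
  "y t \<omega> = X t \<omega> - m t \<omega>"

lemma m_adapted: "0 \<le> t \<Longrightarrow> m t \<in> borel_measurable (F t)"
  unfolding m_def using X_measurable_F X_cont by (intro measurable_running_min) auto

lemma m_measurable: "0 \<le> t \<Longrightarrow> m t \<in> borel_measurable M"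
  using m_adapted measurable_F_M by blast

lemma m_cont: "\<omega> \<in> space M \<Longrightarrow> continuous_on {0..} (\<lambda>t. m t \<omega>)"
  unfolding m_def using continuous_running_min[OF X_cont] by simp

lemma y_adapted: "0 \<le> t \<Longrightarrow> y t \<in> borel_measurable (F t)"
  unfolding y_def using m_adapted[of t] X_adapted[of t] by measurable

lemma y_cont: "\<omega> \<in> space M \<Longrightarrow> continuous_on {0..} (\<lambda>t. y t \<omega>)"
  unfolding y_def by (intro continuous_intros X_cont m_cont)

lemma m_antimono: "\<omega> \<in> space M \<Longrightarrow> 0 \<le> s \<Longrightarrow> s \<le> t \<Longrightarrow> m t \<omega> \<le> m s \<omega>"
  unfolding m_def by (rule running_min_antimono[OF X_cont])

lemma y_nonneg: "\<omega> \<in> space M \<Longrightarrow> 0 \<le> t \<Longrightarrow> 0 \<le> y t \<omega>"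
  unfolding y_def m_def using running_min_le[OF X_cont, of \<omega> t t] by auto

text \<open>Each summand is the increment of the exponential martingale over one step, stopped at \<open>T\<close> and
  weighted with \<open>exp (- \<theta> m)\<close> at the beginning of the step, which is known at that time.\<close>

lemma azema_yor_sums:
  fixes n :: nat
  assumes T: "stopping T" and ab: "a \<le> b" and A: "A \<in> sets (F a)"
    and aT: "\<And>\<omega>. \<omega> \<in> A \<Longrightarrow> ereal a \<le> T \<omega>"
    and c: "\<And>\<omega> s. \<omega> \<in> A \<Longrightarrow> 0 \<le> s \<Longrightarrow> s \<le> b \<Longrightarrow> ereal s \<le> T \<omega> \<Longrightarrow> \<bar>X s \<omega>\<bar> \<le> c"
  defines "p \<equiv> \<lambda>i. a + (b - a) * real i / real (Suc n)"
  defines "D \<equiv> \<lambda>\<omega>. \<Sum>i<Suc n. exp (\<theta> * (X (clamp a (p (Suc i)) T \<omega>) \<omega> - m (clamp a (p i) T \<omega>) \<omega>))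
                - exp (\<theta> * (X (clamp a (p i) T \<omega>) \<omega> - m (clamp a (p i) T \<omega>) \<omega>))"
  shows "integrable M (\<lambda>\<omega>. indicator A \<omega> * D \<omega>)" and "(\<integral>\<omega>. indicator A \<omega> * D \<omega> \<partial>M) = 0"
proof -
  have p0: "p 0 = a" and pn: "p (Suc n) = b" by (auto simp: p_def)
  have p_mono: "p i \<le> p j" if "i \<le> j" for i j
    unfolding p_def using ab that by (intro add_left_mono divide_right_mono mult_left_mono) auto
  have ap: "a \<le> p i" for i using p_mono[of 0 i] p0 by simp
  have p0': "0 \<le> p i" for i using ap[of i] a_nonneg by simp
  define \<sigma> where "\<sigma> i = clamp (p i) (p (Suc i)) T" for i
  define B where "B i = A \<inter> {\<omega> \<in> space M. ereal (p i) \<le> T \<omega>}" for i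
  define Z where "Z i \<omega> = indicator (B i) \<omega> * exp (- (\<theta> * (m (p i) \<omega> - X a \<omega>)))" for i \<omega>
  have AM: "A \<subseteq> space M" using sets.sets_into_space[OF A] a_nonneg by simp
  have \<sigma>_bounds: "p i \<le> \<sigma> i \<omega>" "\<sigma> i \<omega> \<le> p (Suc i)" for i \<omega>
    using clamp_bounds[OF p_mono[of i "Suc i"]] by (auto simp: \<sigma>_def)
  have \<sigma>_le_T: "ereal (\<sigma> i \<omega>) \<le> T \<omega>" if "\<omega> \<in> B i" for i \<omega>
    using that unfolding \<sigma>_def ereal_clamp by (auto simp: B_def max_def)
  have m_bd: "\<bar>m s \<omega>\<bar> \<le> c" if s: "\<omega> \<in> A" "0 \<le> s" "s \<le> b" "ereal s \<le> T \<omega>" for s \<omega>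
  proof -
    have "\<omega> \<in> space M" using s(1) AM by auto
    then obtain r where r: "0 \<le> r" "r \<le> s" "m s \<omega> = X r \<omega>"
      unfolding m_def using running_min_attained[OF X_cont s(2)] by metis
    then have "ereal r \<le> T \<omega>" using s(4) by (meson ereal_less_eq(3) order_trans)
    with c[OF s(1) r(1)] r s(3) show ?thesis by auto
  qed
  have B_in: "B i \<in> sets (F (p i))" for i
    unfolding B_def using A F_mono[OF a_nonneg ap[of i]] stopping_le_in[OF T p0'[of i]] by auto
  have Z_meas: "Z i \<in> borel_measurable (F (p i))" for i
  proof -
    note [measurable] = m_adapted[OF p0'[of i]] X_measurable_F[OF a_nonneg ap[of i]] B_in[of i]
    show ?thesis unfolding Z_def by measurable
  qed
  have le_b: "p i \<le> b" if "i < Suc n" for i using p_mono[of i "Suc n"] pn that by simp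
  have Z_bd: "\<bar>Z i \<omega>\<bar> \<le> exp (\<bar>\<theta>\<bar> * (2 * c))" if "i < Suc n" for i \<omega>
  proof (cases "\<omega> \<in> B i")
    case True
    then have \<omega>: "\<omega> \<in> A" "ereal (p i) \<le> T \<omega>" by (auto simp: B_def)
    have "\<bar>m (p i) \<omega>\<bar> \<le> c" using m_bd[OF \<omega>(1) p0' le_b[OF that] \<omega>(2)] .
    moreover have "\<bar>X a \<omega>\<bar> \<le> c" using c[OF \<omega>(1) a_nonneg ab aT[OF \<omega>(1)]] .
    ultimately have d: "\<bar>m (p i) \<omega> - X a \<omega>\<bar> \<le> 2 * c" by auto
    have "- (\<theta> * (m (p i) \<omega> - X a \<omega>)) \<le> \<bar>\<theta> * (m (p i) \<omega> - X a \<omega>)\<bar>" by auto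
    also have "\<dots> \<le> \<bar>\<theta>\<bar> * (2 * c)" unfolding abs_mult using d by (intro mult_left_mono) auto
    finally show ?thesis using True by (simp add: Z_def)
  qed (simp add: Z_def)
  have cl: "\<bar>X (\<sigma> i \<omega>) \<omega> - X a \<omega>\<bar> \<le> 2 * c" if "i < Suc n" "Z i \<omega> \<noteq> 0" for i \<omega>
  proof -
    have \<omega>: "\<omega> \<in> B i" using that(2) by (auto simp: Z_def indicator_def split: if_splits)
    then have \<omega>A: "\<omega> \<in> A" by (auto simp: B_def)
    have "\<sigma> i \<omega> \<le> b" using \<sigma>_bounds(2)[of i \<omega>] p_mono[of "Suc i" "Suc n"] pn that(1) by auto
    then have "\<bar>X (\<sigma> i \<omega>) \<omega>\<bar> \<le> c"
      using c[OF \<omega>A _ _ \<sigma>_le_T[OF \<omega>]] \<sigma>_bounds(1)[of i \<omega>] p0'[of i] by auto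
    moreover have "\<bar>X a \<omega>\<bar> \<le> c" using c[OF \<omega>A a_nonneg ab aT[OF \<omega>A]] .
    ultimately show ?thesis by auto
  qed
  have os: "integrable M (\<lambda>\<omega>. Z i \<omega> * expX (\<sigma> i \<omega>) \<omega>)"
    "(\<integral>\<omega>. Z i \<omega> * expX (\<sigma> i \<omega>) \<omega> \<partial>M) = (\<integral>\<omega>. Z i \<omega> * expX (p i) \<omega> \<partial>M)" if i: "i < Suc n" for i
  proof -
    have st: "stopping (\<lambda>\<omega>. ereal (\<sigma> i \<omega>))" "\<sigma> i \<in> borel_measurable M"
      unfolding \<sigma>_def using stopping_clamp[OF T p0' p_mono] measurable_clamp[OF T p0' p_mono] by auto
    note * = optional_stopping[OF ap[of i] p_mono[of i "Suc i"] Z_meas[of i] Z_bd[OF i] st _ cl[OF i]]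
    show "integrable M (\<lambda>\<omega>. Z i \<omega> * expX (\<sigma> i \<omega>) \<omega>)"
      "(\<integral>\<omega>. Z i \<omega> * expX (\<sigma> i \<omega>) \<omega> \<partial>M) = (\<integral>\<omega>. Z i \<omega> * expX (p i) \<omega> \<partial>M)"
      by (rule *; use \<sigma>_bounds in simp)+
  qed
  have Zp: "integrable M (\<lambda>\<omega>. Z i \<omega> * expX (p i) \<omega>)" if i: "i < Suc n" for i
    using weighted_martingale(1)[OF ap order_refl Z_meas[of i] Z_bd[OF i]] .
  have summand: "Z i \<omega> * expX (\<sigma> i \<omega>) \<omega> - Z i \<omega> * expX (p i) \<omega> =
      indicator A \<omega> * (exp (\<theta> * (X (clamp a (p (Suc i)) T \<omega>) \<omega> - m (clamp a (p i) T \<omega>) \<omega>))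
                - exp (\<theta> * (X (clamp a (p i) T \<omega>) \<omega> - m (clamp a (p i) T \<omega>) \<omega>)))"
    if "\<omega> \<in> space M" for i \<omega>
  proof (cases "\<omega> \<in> A")
    case \<omega>A: True
    show ?thesis
    proof (cases "ereal (p i) \<le> T \<omega>")
      case True
      then have "\<omega> \<in> B i" using \<omega>A that by (auto simp: B_def)
      moreover have "clamp a (p i) T \<omega> = p i"
      proof -
        have "ereal (clamp a (p i) T \<omega>) = ereal (p i)"
          unfolding ereal_clamp using True ap[of i] by (simp add: min_absorb1 max_absorb2)
        then show ?thesis by simp
      qed
      moreover have "clamp a (p (Suc i)) T \<omega> = \<sigma> i \<omega>"
      proof -
        have "ereal (clamp a (p (Suc i)) T \<omega>) = ereal (\<sigma> i \<omega>)"
          unfolding \<sigma>_def ereal_clamp using True aT[OF \<omega>A] ap[of "Suc i"] p_mono[of i "Suc i"]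
          by (simp add: max_absorb2)
        then show ?thesis by simp
      qed
      ultimately show ?thesis
        using \<omega>A by (simp add: Z_def expX_def exp_add[symmetric] algebra_simps)
    next
      case False
      then have "Z i \<omega> = 0" by (simp add: Z_def B_def)
      moreover have "clamp a (p (Suc i)) T \<omega> = clamp a (p i) T \<omega>"
      proof -
        have "min (ereal (p (Suc i))) (T \<omega>) = T \<omega>" "min (ereal (p i)) (T \<omega>) = T \<omega>"
          using False p_mono[of i "Suc i"] by (cases "T \<omega>"; force simp: min_def)+
        then have "ereal (clamp a (p (Suc i)) T \<omega>) = ereal (clamp a (p i) T \<omega>)"
          unfolding ereal_clamp by simp
        then show ?thesis by simp
      qed
      ultimately show ?thesis by simp
    qed
  qed (simp add: Z_def B_def)
  have sum_eq: "(\<Sum>i<Suc n. Z i \<omega> * expX (\<sigma> i \<omega>) \<omega> - Z i \<omega> * expX (p i) \<omega>) = indicator A \<omega> * D \<omega>"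
    if "\<omega> \<in> space M" for \<omega>
    unfolding D_def sum_distrib_left by (intro sum.cong refl summand that)
  have int: "integrable M (\<lambda>\<omega>. \<Sum>i<Suc n. Z i \<omega> * expX (\<sigma> i \<omega>) \<omega> - Z i \<omega> * expX (p i) \<omega>)"
    using os(1) Zp by (intro Bochner_Integration.integrable_sum Bochner_Integration.integrable_diff) auto
  then show "integrable M (\<lambda>\<omega>. indicator A \<omega> * D \<omega>)"
    by (rule Bochner_Integration.integrable_cong[THEN iffD1, rotated 2]) (simp_all only: sum_eq)
  have "(\<integral>\<omega>. indicator A \<omega> * D \<omega> \<partial>M) = (\<integral>\<omega>. (\<Sum>i<Suc n. Z i \<omega> * expX (\<sigma> i \<omega>) \<omega> - Z i \<omega> * expX (p i) \<omega>) \<partial>M)"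
    by (intro Bochner_Integration.integral_cong) (simp_all only: sum_eq)
  also have "\<dots> = (\<Sum>i<Suc n. \<integral>\<omega>. Z i \<omega> * expX (\<sigma> i \<omega>) \<omega> - Z i \<omega> * expX (p i) \<omega> \<partial>M)"
    using os(1) Zp by (intro Bochner_Integration.integral_sum Bochner_Integration.integrable_diff) auto
  also have "\<dots> = 0"
    using os Zp by (intro sum.neutral ballI) (simp add: Bochner_Integration.integral_diff)
  finally show "(\<integral>\<omega>. indicator A \<omega> * D \<omega> \<partial>M) = 0" .
qed

end

context exp_martingale
begin

lemma measurable_clamp_value:
  fixes x :: "real \<Rightarrow> 'a \<Rightarrow> real"
  assumes "stopping T" "0 \<le> s" "s \<le> t"
    and x: "\<And>r. 0 \<le> r \<Longrightarrow> x r \<in> borel_measurable M"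
    and cont: "\<And>\<omega>. \<omega> \<in> space M \<Longrightarrow> continuous_on {0..} (\<lambda>r. x r \<omega>)"
  shows "(\<lambda>\<omega>. x (clamp s t T \<omega>) \<omega>) \<in> borel_measurable M"
proof (rule measurable_at_random_time[where t = t and x = x and \<rho> = "clamp s t T"])
  show "clamp s t T \<in> borel_measurable M" using measurable_clamp[OF assms(1-3)] .
  show "0 \<le> clamp s t T \<omega>" "clamp s t T \<omega> \<le> t" for \<omega>
    using clamp_bounds[OF assms(3), of T \<omega>] assms(2) by simp_all
qed (simp_all add: x cont)

lemma y_measurable: "0 \<le> t \<Longrightarrow> y t \<in> borel_measurable M"
  using y_adapted measurable_F_M by blast

lemma clamp_increment:
  assumes "a \<le> s" "s \<le> t"
  shows "clamp a s T \<omega> \<le> clamp a t T \<omega>" "clamp a t T \<omega> - clamp a s T \<omega> \<le> t - s"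
proof -
  have "clamp a s T \<omega> \<le> clamp a t T \<omega> \<and> clamp a t T \<omega> - clamp a s T \<omega> \<le> t - s"
    using assms unfolding clamp_def by (cases "T \<omega>") (auto simp: max_def min_def)
  then show "clamp a s T \<omega> \<le> clamp a t T \<omega>" "clamp a t T \<omega> - clamp a s T \<omega> \<le> t - s" by auto
qed

lemma m_bound:
  assumes "\<omega> \<in> space M" "0 \<le> s" "\<And>r. 0 \<le> r \<Longrightarrow> r \<le> s \<Longrightarrow> \<bar>X r \<omega>\<bar> \<le> c"
  shows "\<bar>m s \<omega>\<bar> \<le> c"
  unfolding m_def using running_min_attained[OF X_cont[OF assms(1)] assms(2)] assms(3) by metis

text \<open>For a process that stays bounded up to the stopping time, the error of the discrete
  sums is at most a multiple of the oscillation of the path over one step.\<close>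

lemma azema_yor_bounded:
  assumes T: "stopping T" and ab: "a \<le> b" and A: "A \<in> sets (F a)"
    and aT: "\<And>\<omega>. \<omega> \<in> A \<Longrightarrow> ereal a \<le> T \<omega>"
    and c: "\<And>\<omega> s. \<omega> \<in> A \<Longrightarrow> 0 \<le> s \<Longrightarrow> s \<le> b \<Longrightarrow> ereal s \<le> T \<omega> \<Longrightarrow> \<bar>X s \<omega>\<bar> \<le> c"
    and c0: "0 \<le> c"
  shows "integrable M (\<lambda>\<omega>. indicator A \<omega> * (m a \<omega> - m (clamp a b T \<omega>) \<omega>))" (is ?int1)
    and "integrable M (\<lambda>\<omega>. indicator A \<omega> * (exp (\<theta> * y (clamp a b T \<omega>) \<omega>) - exp (\<theta> * y a \<omega>)))" (is ?int2)
    and "\<theta> * (\<integral>\<omega>. indicator A \<omega> * (m a \<omega> - m (clamp a b T \<omega>) \<omega>) \<partial>M) =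
      (\<integral>\<omega>. indicator A \<omega> * (exp (\<theta> * y (clamp a b T \<omega>) \<omega>) - exp (\<theta> * y a \<omega>)) \<partial>M)" (is ?eq)
proof -
  define \<tau> where "\<tau> = clamp a b T"
  define p where "p n i = a + (b - a) * real i / real (Suc n)" for n i
  define D where "D n \<omega> = (\<Sum>i<Suc n. exp (\<theta> * (X (clamp a (p n (Suc i)) T \<omega>) \<omega> - m (clamp a (p n i) T \<omega>) \<omega>))
                - exp (\<theta> * (X (clamp a (p n i) T \<omega>) \<omega> - m (clamp a (p n i) T \<omega>) \<omega>)))" for n \<omega>
  define L where "L \<omega> = exp (\<theta> * y (\<tau> \<omega>) \<omega>) - exp (\<theta> * y a \<omega>) - \<theta> * (m a \<omega> - m (\<tau> \<omega>) \<omega>)" for \<omega>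
  have D: "integrable M (\<lambda>\<omega>. indicator A \<omega> * D n \<omega>)" "(\<integral>\<omega>. indicator A \<omega> * D n \<omega> \<partial>M) = 0" for n
    using azema_yor_sums[OF T ab A aT c, of n] unfolding D_def p_def by auto
  have AM: "A \<subseteq> space M" using sets.sets_into_space[OF A] a_nonneg by simp
  have [measurable]: "A \<in> sets M" using sets_F_M[OF a_nonneg A] .
  have [measurable]: "(\<lambda>\<omega>. m (\<tau> \<omega>) \<omega>) \<in> borel_measurable M" "(\<lambda>\<omega>. y (\<tau> \<omega>) \<omega>) \<in> borel_measurable M"
    unfolding \<tau>_def
    by (rule measurable_clamp_value[OF T a_nonneg ab]; simp add: m_measurable m_cont y_measurable y_cont)+
  have [measurable]: "m a \<in> borel_measurable M" "y a \<in> borel_measurable M"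
    using m_measurable[OF a_nonneg] y_measurable[OF a_nonneg] .
  have \<tau>_bounds: "a \<le> \<tau> \<omega>" "\<tau> \<omega> \<le> b" for \<omega>
    using clamp_bounds[OF ab] by (auto simp: \<tau>_def)
  have \<tau>_T: "ereal (\<tau> \<omega>) \<le> T \<omega>" if "\<omega> \<in> A" for \<omega>
    using aT[OF that] unfolding \<tau>_def ereal_clamp by (auto simp: max_def)
  have X_bd: "\<bar>X s \<omega>\<bar> \<le> c" if "\<omega> \<in> A" "0 \<le> s" "s \<le> \<tau> \<omega>" for s \<omega>
    using c[OF that(1,2)] that(3) \<tau>_T[OF that(1)] \<tau>_bounds(2)[of \<omega>]
    by (meson ereal_less_eq(3) order_trans)
  have m_bd: "\<bar>m s \<omega>\<bar> \<le> c" if "\<omega> \<in> A" "0 \<le> s" "s \<le> \<tau> \<omega>" for s \<omega>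
    using that AM X_bd[OF that(1)] by (intro m_bound) auto
  have y_bd: "\<bar>y s \<omega>\<bar> \<le> 2 * c" if "\<omega> \<in> A" "0 \<le> s" "s \<le> \<tau> \<omega>" for s \<omega>
    using X_bd[OF that] m_bd[OF that] by (auto simp: y_def)
  have exp_bd: "exp (\<theta> * y s \<omega>) \<le> exp (\<bar>\<theta>\<bar> * (2 * c))" if "\<omega> \<in> A" "0 \<le> s" "s \<le> \<tau> \<omega>" for s \<omega>
  proof -
    have "\<theta> * y s \<omega> \<le> \<bar>\<theta>\<bar> * \<bar>y s \<omega>\<bar>" by (metis abs_ge_self abs_mult)
    also have "\<dots> \<le> \<bar>\<theta>\<bar> * (2 * c)" using y_bd[OF that] by (intro mult_left_mono) auto
    finally show ?thesis by simp
  qed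
  have \<tau>0: "0 \<le> \<tau> \<omega>" for \<omega> using \<tau>_bounds(1)[of \<omega>] a_nonneg by simp
  have m_diff: "\<bar>m a \<omega> - m (\<tau> \<omega>) \<omega>\<bar> \<le> 2 * c" if "\<omega> \<in> A" for \<omega>
    using m_bd[OF that a_nonneg \<tau>_bounds(1)] m_bd[OF that \<tau>0 order_refl] by auto
  have exp_diff: "\<bar>exp (\<theta> * y (\<tau> \<omega>) \<omega>) - exp (\<theta> * y a \<omega>)\<bar> \<le> 2 * exp (\<bar>\<theta>\<bar> * (2 * c))" if "\<omega> \<in> A" for \<omega>
    using exp_bd[OF that \<tau>0 order_refl] exp_bd[OF that a_nonneg \<tau>_bounds(1)]
      exp_gt_zero[of "\<theta> * y (\<tau> \<omega>) \<omega>"] exp_gt_zero[of "\<theta> * y a \<omega>"] by linarith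
  have int1: "integrable M (\<lambda>\<omega>. indicator A \<omega> * (m a \<omega> - m (\<tau> \<omega>) \<omega>))"
    by (rule integrable_const_bound[where B = "2 * c"])
      (use m_diff c0 in \<open>auto simp: indicator_def\<close>)
  have int2: "integrable M (\<lambda>\<omega>. indicator A \<omega> * (exp (\<theta> * y (\<tau> \<omega>) \<omega>) - exp (\<theta> * y a \<omega>)))"
    by (rule integrable_const_bound[where B = "2 * exp (\<bar>\<theta>\<bar> * (2 * c))"])
      (use exp_diff in \<open>auto simp: indicator_def\<close>)
  show ?int1 ?int2 using int1 int2 by (simp_all add: \<tau>_def)
  have clamp_p: "a \<le> p n i" "p n i \<le> p n (Suc i)" "p n (Suc i) - p n i = (b - a) / real (Suc n)" for n i
  proof -
    show "a \<le> p n i" using ab by (simp add: p_def)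
    show diff: "p n (Suc i) - p n i = (b - a) / real (Suc n)"
      by (simp add: p_def diff_divide_distrib[symmetric] algebra_simps del: of_nat_Suc) (simp add: algebra_simps)
    have "0 \<le> (b - a) / real (Suc n)" using ab by simp
    with diff show "p n i \<le> p n (Suc i)" by linarith
  qed
  have p_le: "clamp a (p n i) T \<omega> \<le> \<tau> \<omega>" if "i \<le> Suc n" for n i \<omega>
  proof -
    have "(b - a) * real i / real (Suc n) \<le> (b - a) * real (Suc n) / real (Suc n)"
      using ab that by (intro divide_right_mono mult_left_mono) auto
    then have "p n i \<le> b" by (simp add: p_def del: of_nat_Suc)
    then show ?thesis unfolding \<tau>_def by (intro clamp_increment clamp_p)
  qed
  have error: "\<bar>D n \<omega> - L \<omega>\<bar> \<le> \<bar>\<theta>\<bar> * (2 * c) * (exp (\<bar>\<theta>\<bar> * w) - 1)"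
    if \<omega>: "\<omega> \<in> A" and w: "0 \<le> w"
      and osc: "\<And>r s. 0 \<le> r \<Longrightarrow> r \<le> s \<Longrightarrow> s \<le> \<tau> \<omega> \<Longrightarrow> s - r \<le> (b - a) / real (Suc n) \<Longrightarrow> \<bar>X r \<omega> - X s \<omega>\<bar> \<le> w"
    for n \<omega> w
  proof -
    have \<omega>M: "\<omega> \<in> space M" using \<omega> AM by auto
    define q where "q i = clamp a (p n i) T \<omega>" for i
    have q0: "q 0 = a" using clamp_bounds[OF order_refl[of a], of T \<omega>] by (simp add: q_def p_def)
    have qn: "q (Suc n) = \<tau> \<omega>" by (simp add: q_def \<tau>_def p_def)
    have "\<bar>(\<Sum>i<Suc n. exp (\<theta> * (X (q (Suc i)) \<omega> - running_min (\<lambda>t. X t \<omega>) (q i)))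
          - exp (\<theta> * (X (q i) \<omega> - running_min (\<lambda>t. X t \<omega>) (q i))))
        - (exp (\<theta> * (X (q (Suc n)) \<omega> - running_min (\<lambda>t. X t \<omega>) (q (Suc n))))
          - exp (\<theta> * (X (q 0) \<omega> - running_min (\<lambda>t. X t \<omega>) (q 0)))
          - \<theta> * (running_min (\<lambda>t. X t \<omega>) (q 0) - running_min (\<lambda>t. X t \<omega>) (q (Suc n))))\<bar>
      \<le> \<bar>\<theta>\<bar> * (running_min (\<lambda>t. X t \<omega>) (q 0) - running_min (\<lambda>t. X t \<omega>) (q (Suc n))) *
        (exp (\<bar>\<theta>\<bar> * w) - 1)"
    proof (rule azema_yor_path)
      show "continuous_on {0..} (\<lambda>t. X t \<omega>)" using X_cont[OF \<omega>M] .
      show "0 \<le> q 0" using q0 a_nonneg by simp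
      show "q i \<le> q (Suc i)" for i unfolding q_def by (intro clamp_increment clamp_p)
      show "\<bar>X r \<omega> - X (q (Suc i)) \<omega>\<bar> \<le> w" if "i < Suc n" "q i \<le> r" "r \<le> q (Suc i)" for i r
      proof (rule osc)
        have "a \<le> q i" unfolding q_def using clamp_bounds[OF clamp_p(1)] by auto
        then show "0 \<le> r" using that a_nonneg by linarith
        show "q (Suc i) \<le> \<tau> \<omega>" unfolding q_def using that by (intro p_le) auto
        have "q (Suc i) - q i \<le> (b - a) / real (Suc n)"
          unfolding q_def using clamp_increment(2)[OF clamp_p(1,2)] clamp_p(3) by metis
        then show "q (Suc i) - r \<le> (b - a) / real (Suc n)" using that by linarith
      qed fact
    qed
    then have "\<bar>D n \<omega> - L \<omega>\<bar> \<le> \<bar>\<theta>\<bar> * (m a \<omega> - m (\<tau> \<omega>) \<omega>) * (exp (\<bar>\<theta>\<bar> * w) - 1)"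
      unfolding q0 qn unfolding D_def L_def y_def m_def q_def .
    also have "\<dots> \<le> \<bar>\<theta>\<bar> * (2 * c) * (exp (\<bar>\<theta>\<bar> * w) - 1)"
      using m_diff[OF \<omega>] w by (intro mult_right_mono mult_left_mono) auto
    finally show ?thesis .
  qed
  have D_lim: "(\<lambda>n. D n \<omega>) \<longlonglongrightarrow> L \<omega>" if \<omega>: "\<omega> \<in> A" for \<omega>
  proof (rule LIMSEQ_I)
    fix e :: real assume e: "0 < e"
    have \<omega>M: "\<omega> \<in> space M" using \<omega> AM by auto
    have "((\<lambda>w. \<bar>\<theta>\<bar> * (2 * c) * (exp (\<bar>\<theta>\<bar> * w) - 1)) \<longlongrightarrow> \<bar>\<theta>\<bar> * (2 * c) * (exp (\<bar>\<theta>\<bar> * 0) - 1)) (at_right 0)"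
      by (intro tendsto_intros)
    then have "\<forall>\<^sub>F w in at_right 0. \<bar>\<theta>\<bar> * (2 * c) * (exp (\<bar>\<theta>\<bar> * w) - 1) < e"
      using e by (intro order_tendstoD(2)) auto
    then obtain w where w: "0 < w" "\<bar>\<theta>\<bar> * (2 * c) * (exp (\<bar>\<theta>\<bar> * w) - 1) < e"
      unfolding eventually_at_right_field using field_lbound_gt_zero by (metis dense)
    have "uniformly_continuous_on {0..b} (\<lambda>t. X t \<omega>)"
      using X_cont[OF \<omega>M] by (intro compact_uniformly_continuous) (auto intro: continuous_on_subset)
    then obtain d where d: "0 < d" "\<And>r s. r \<in> {0..b} \<Longrightarrow> s \<in> {0..b} \<Longrightarrow> dist r s < d \<Longrightarrow> dist (X r \<omega>) (X s \<omega>) < w"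
      unfolding uniformly_continuous_on_def using w(1) by metis
    have "(\<lambda>n. (b - a) * (1 / real (Suc n))) \<longlonglongrightarrow> (b - a) * 0"
      by (intro tendsto_intros LIMSEQ_Suc[OF lim_1_over_n])
    then have "\<forall>\<^sub>F n in sequentially. (b - a) / real (Suc n) < d"
      using d(1) order_tendstoD(2)[of "\<lambda>n. (b - a) * (1 / real (Suc n))" 0 sequentially d] by auto
    then obtain n0 where n0: "\<And>n. n0 \<le> n \<Longrightarrow> (b - a) / real (Suc n) < d"
      unfolding eventually_sequentially by blast
    have "norm (D n \<omega> - L \<omega>) < e" if "n0 \<le> n" for n
    proof -
      have "\<bar>D n \<omega> - L \<omega>\<bar> \<le> \<bar>\<theta>\<bar> * (2 * c) * (exp (\<bar>\<theta>\<bar> * w) - 1)"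
      proof (rule error[OF \<omega>])
        fix r s :: real assume rs: "0 \<le> r" "r \<le> s" "s \<le> \<tau> \<omega>" "s - r \<le> (b - a) / real (Suc n)"
        then have "dist r s < d" using n0[OF that] by (auto simp: dist_real_def)
        then show "\<bar>X r \<omega> - X s \<omega>\<bar> \<le> w"
          using d(2)[of r s] rs \<tau>_bounds(2)[of \<omega>] by (auto simp: dist_real_def)
      qed (use w in auto)
      with w(2) show ?thesis by auto
    qed
    then show "\<exists>n0. \<forall>n\<ge>n0. norm (D n \<omega> - L \<omega>) < e" by blast
  qed
  define C where "C = 2 * exp (\<bar>\<theta>\<bar> * (2 * c)) + \<bar>\<theta>\<bar> * (2 * c) + \<bar>\<theta>\<bar> * (2 * c) * (exp (\<bar>\<theta>\<bar> * (2 * c)) - 1)"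
  have C0: "0 \<le> C" using c0 by (auto simp: C_def)
  have D_bd: "\<bar>D n \<omega>\<bar> \<le> C" if \<omega>: "\<omega> \<in> A" for n \<omega>
  proof -
    have "\<bar>\<theta> * (m a \<omega> - m (\<tau> \<omega>) \<omega>)\<bar> \<le> \<bar>\<theta>\<bar> * (2 * c)"
      unfolding abs_mult using m_diff[OF \<omega>] by (intro mult_left_mono) auto
    then have "\<bar>L \<omega>\<bar> \<le> 2 * exp (\<bar>\<theta>\<bar> * (2 * c)) + \<bar>\<theta>\<bar> * (2 * c)"
      using exp_diff[OF \<omega>] unfolding L_def by linarith
    moreover have "\<bar>D n \<omega> - L \<omega>\<bar> \<le> \<bar>\<theta>\<bar> * (2 * c) * (exp (\<bar>\<theta>\<bar> * (2 * c)) - 1)"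
    proof (rule error[OF \<omega>])
      fix r s :: real assume rs: "0 \<le> r" "r \<le> s" "s \<le> \<tau> \<omega>"
      show "\<bar>X r \<omega> - X s \<omega>\<bar> \<le> 2 * c"
        using X_bd[OF \<omega>, of r] X_bd[OF \<omega>, of s] rs by auto
    qed (use c0 in auto)
    ultimately show ?thesis unfolding C_def by linarith
  qed
  have "(\<lambda>n. \<integral>\<omega>. indicator A \<omega> * D n \<omega> \<partial>M) \<longlonglongrightarrow> (\<integral>\<omega>. indicator A \<omega> * L \<omega> \<partial>M)"
  proof (rule integral_dominated_convergence[where w = "\<lambda>_. C"])
    show "(\<lambda>\<omega>. indicator A \<omega> * L \<omega>) \<in> borel_measurable M" unfolding L_def by measurable
    show "(\<lambda>\<omega>. indicator A \<omega> * D n \<omega>) \<in> borel_measurable M" for n using D(1) by auto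
    show "AE \<omega> in M. (\<lambda>n. indicator A \<omega> * D n \<omega>) \<longlonglongrightarrow> indicator A \<omega> * L \<omega>"
      using D_lim by (intro AE_I2) (auto simp: indicator_def)
    show "AE \<omega> in M. norm (indicator A \<omega> * D n \<omega>) \<le> C" for n
      using D_bd C0 by (intro AE_I2) (auto simp: indicator_def)
  qed simp
  then have "(\<integral>\<omega>. indicator A \<omega> * L \<omega> \<partial>M) = 0"
    using D(2) by (simp add: LIMSEQ_const_iff)
  moreover have "(\<integral>\<omega>. indicator A \<omega> * L \<omega> \<partial>M) =
    (\<integral>\<omega>. indicator A \<omega> * (exp (\<theta> * y (\<tau> \<omega>) \<omega>) - exp (\<theta> * y a \<omega>)) - \<theta> * (indicator A \<omega> * (m a \<omega> - m (\<tau> \<omega>) \<omega>)) \<partial>M)"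
    by (intro Bochner_Integration.integral_cong) (auto simp: L_def algebra_simps)
  ultimately show ?eq
    using int1 int2 by (simp add: \<tau>_def)
qed

end

lemma (in prob_space) prob_le_of_eventually:
  assumes [measurable]: "B \<in> events" "\<And>k. G k \<in> events"
    and ev: "AE \<omega> in M. \<omega> \<in> B \<longrightarrow> (\<forall>\<^sub>F k::nat in sequentially. \<omega> \<in> G k)"
    and le: "\<And>k. prob (B \<inter> G k) \<le> c"
  shows "prob B \<le> c"
proof -
  have "(\<lambda>k. (\<integral>\<omega>. indicator (B \<inter> G k) \<omega> \<partial>M :: real)) \<longlonglongrightarrow> (\<integral>\<omega>. indicator B \<omega> \<partial>M :: real)"
  proof (rule integral_dominated_convergence[where w = "\<lambda>_. 1"])
    show "AE \<omega> in M. (\<lambda>k. indicator (B \<inter> G k) \<omega> :: real) \<longlonglongrightarrow> indicator B \<omega>"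
      using ev
    proof eventually_elim
      case (elim \<omega>)
      show ?case
      proof (cases "\<omega> \<in> B")
        case True
        with elim have "\<forall>\<^sub>F k in sequentially. (indicator (B \<inter> G k) \<omega> :: real) = indicator B \<omega>"
          by (auto elim!: eventually_mono simp: indicator_def)
        then show ?thesis by (rule tendsto_eventually)
      qed simp
    qed
  qed (auto simp: indicator_def)
  moreover have "(\<integral>\<omega>. indicator (B \<inter> G k) \<omega> \<partial>M :: real) = prob (B \<inter> G k)" for k by simp
  moreover have "(\<integral>\<omega>. indicator B \<omega> \<partial>M :: real) = prob B" by simp
  ultimately have "(\<lambda>k. prob (B \<inter> G k)) \<longlonglongrightarrow> prob B" by simp
  then show ?thesis using le by (intro tendsto_upperbound) auto
qed

lemma abs_diff_le_exp:
  fixes u v c :: real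
  assumes "\<bar>u\<bar> \<le> c" "\<bar>v\<bar> \<le> c"
  shows "\<bar>u - v\<bar> \<le> exp c * \<bar>exp u - exp v\<bar>"
proof -
  have *: "t - s \<le> exp c * (exp t - exp s)" if "s \<le> t" "\<bar>s\<bar> \<le> c" for s t :: real
  proof -
    have "t - s \<le> exp (t - s) - 1" using exp_ge_add_one_self[of "t - s"] by linarith
    also have "\<dots> = exp (- s) * (exp t - exp s)"
      by (simp add: right_diff_distrib exp_add[symmetric])
    also have "\<dots> \<le> exp c * (exp t - exp s)"
      using that by (intro mult_right_mono) auto
    finally show ?thesis .
  qed
  show ?thesis using *[of u v] *[of v u] assms by (cases "u \<le> v") auto
qed

context exp_martingale
begin

section \<open>The process leaves every bounded interval\<close>

abbreviation exit_time :: "real \<Rightarrow> 'a \<Rightarrow> ereal" where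
  "exit_time c \<omega> \<equiv> hit (\<lambda>s. \<bar>X s \<omega>\<bar>) c"

lemma abs_X_cont: "\<omega> \<in> space M \<Longrightarrow> continuous_on {0..} (\<lambda>s. \<bar>X s \<omega>\<bar>)"
  by (intro continuous_intros X_cont)

lemma abs_X_adapted: "0 \<le> t \<Longrightarrow> (\<lambda>\<omega>. \<bar>X t \<omega>\<bar>) \<in> borel_measurable (F t)"
  using X_adapted[of t] by measurable

lemma stopping_exit: "stopping (exit_time c)"
  by (rule stopping_hit[OF abs_X_adapted abs_X_cont])

lemma exit_le_in: "0 \<le> t \<Longrightarrow> {\<omega> \<in> space M. exit_time c \<omega> \<le> ereal t} \<in> sets (F t)"
  by (rule hit_le_in[OF abs_X_adapted abs_X_cont])

lemma until_exit:
  "\<omega> \<in> space M \<Longrightarrow> \<bar>X 0 \<omega>\<bar> < c \<Longrightarrow> 0 \<le> t \<Longrightarrow> ereal t \<le> exit_time c \<omega> \<Longrightarrow> \<bar>X t \<omega>\<bar> \<le> c"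
  by (rule until_hit[OF abs_X_cont])

lemma exit_borel: "exit_time c \<in> borel_measurable M"
  by (rule stopping_borel[OF stopping_exit hit_nonneg])

text \<open>Increments of a martingale are orthogonal, so that the expected squares of those of
  \<open>exp (\<theta> X)\<close>, stopped when \<open>X\<close> leaves \<open>(- c, c)\<close>, telescope. Up to that time they dominate the
  squared increments of \<open>X\<close> up to a constant factor. The resulting bound is the same for all partitions.\<close>

lemma stopped_square_variation:
  fixes n :: nat
  assumes a0: "a = 0" and X0: "\<And>\<omega>. \<omega> \<in> space M \<Longrightarrow> X 0 \<omega> = 0" and c: "0 < c" and t: "0 \<le> t"
  defines "p \<equiv> \<lambda>i. t * real i / real (Suc n)"
  defines "\<tau> \<equiv> \<lambda>i. clamp 0 (p i) (exit_time c)"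
  defines "dX \<equiv> \<lambda>i \<omega>. X (\<tau> (Suc i) \<omega>) \<omega> - X (\<tau> i \<omega>) \<omega>"
  shows "integrable M (\<lambda>\<omega>. \<Sum>i<Suc n. (dX i \<omega>)\<^sup>2)"
    and "\<theta>\<^sup>2 * (\<integral>\<omega>. (\<Sum>i<Suc n. (dX i \<omega>)\<^sup>2) \<partial>M) \<le> exp (4 * (\<bar>\<theta>\<bar> * c))"
proof -
  have p0: "0 \<le> p i" for i using t by (simp add: p_def)
  have p_mono: "p i \<le> p (Suc i)" for i
    unfolding p_def using t by (intro divide_right_mono mult_left_mono) auto
  have \<tau>0: "0 \<le> \<tau> i \<omega>" for i \<omega> using clamp_bounds[OF p0] by (auto simp: \<tau>_def)
  have \<tau>_exit: "ereal (\<tau> i \<omega>) \<le> exit_time c \<omega>" for i \<omega>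
    unfolding \<tau>_def ereal_clamp using hit_nonneg[of "\<lambda>s. \<bar>X s \<omega>\<bar>" c] by (simp add: zero_ereal_def)
  have X_bd: "\<bar>X (\<tau> i \<omega>) \<omega>\<bar> \<le> c" if "\<omega> \<in> space M" for i \<omega>
    using until_exit[OF that _ \<tau>0 \<tau>_exit] X0[OF that] c by simp
  have \<theta>X: "\<bar>\<theta> * X (\<tau> i \<omega>) \<omega>\<bar> \<le> \<bar>\<theta>\<bar> * c" if "\<omega> \<in> space M" for i \<omega>
    unfolding abs_mult using X_bd[OF that] by (intro mult_left_mono) auto
  define V where "V i \<omega> = exp (\<theta> * X (\<tau> i \<omega>) \<omega>)" for i \<omega>
  have V_bd: "\<bar>V i \<omega>\<bar> \<le> exp (\<bar>\<theta>\<bar> * c)" if "\<omega> \<in> space M" for i \<omega>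
    using \<theta>X[OF that, of i] by (simp add: V_def)
  have X\<tau>[measurable]: "(\<lambda>\<omega>. X (\<tau> i \<omega>) \<omega>) \<in> borel_measurable M" for i
    unfolding \<tau>_def by (rule measurable_clamp_value[OF stopping_exit order_refl p0 X_measurable X_cont])
  have [measurable]: "V i \<in> borel_measurable M" "dX i \<in> borel_measurable M" for i
    unfolding V_def dX_def by measurable
  have VV: "integrable M (\<lambda>\<omega>. V i \<omega> * V j \<omega>)" for i j
  proof (rule integrable_const_bound[where B = "exp (\<bar>\<theta>\<bar> * c) * exp (\<bar>\<theta>\<bar> * c)"])
    show "AE \<omega> in M. norm (V i \<omega> * V j \<omega>) \<le> exp (\<bar>\<theta>\<bar> * c) * exp (\<bar>\<theta>\<bar> * c)"
      unfolding norm_mult unfolding real_norm_def abs_mult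
      by (intro AE_I2 mult_mono V_bd) auto
  qed measurable
  have cross: "(\<integral>\<omega>. V i \<omega> * V (Suc i) \<omega> \<partial>M) = (\<integral>\<omega>. V i \<omega> * V i \<omega> \<partial>M)" for i
  proof -
    define B where "B = {\<omega> \<in> space M. ereal (p i) \<le> exit_time c \<omega>}"
    define Z where "Z \<omega> = indicator B \<omega> * exp (\<theta> * X (p i) \<omega>)" for \<omega>
    define \<sigma> where "\<sigma> = clamp (p i) (p (Suc i)) (exit_time c)"
    have B_in: "B \<in> sets (F (p i))" unfolding B_def by (rule stopping_le_in[OF stopping_exit p0])
    have X_p: "\<bar>X (p i) \<omega>\<bar> \<le> c" if "\<omega> \<in> B" for \<omega>
      using until_exit[of \<omega> c "p i"] X0[of \<omega>] p0 that c by (auto simp: B_def)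
    have Z_meas: "Z \<in> borel_measurable (F (p i))"
      unfolding Z_def using B_in X_adapted[OF p0] by measurable
    have Z_bd: "\<bar>Z \<omega>\<bar> \<le> exp (\<bar>\<theta>\<bar> * c)" for \<omega>
    proof (cases "\<omega> \<in> B")
      case True
      have "\<theta> * X (p i) \<omega> \<le> \<bar>\<theta>\<bar> * \<bar>X (p i) \<omega>\<bar>" by (metis abs_ge_self abs_mult)
      also have "\<dots> \<le> \<bar>\<theta>\<bar> * c" using X_p[OF True] by (intro mult_left_mono) auto
      finally show ?thesis using True by (simp add: Z_def)
    qed (simp add: Z_def)
    have \<sigma>_bounds: "p i \<le> \<sigma> \<omega> \<and> \<sigma> \<omega> \<le> p (Suc i)" for \<omega>
      unfolding \<sigma>_def by (rule clamp_bounds[OF p_mono])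
    have \<sigma>_X: "\<bar>X (\<sigma> \<omega>) \<omega> - X a \<omega>\<bar> \<le> c" if "\<omega> \<in> space M" "Z \<omega> \<noteq> 0" for \<omega>
    proof -
      have "\<omega> \<in> B" using that by (auto simp: Z_def indicator_def split: if_splits)
      then have "ereal (\<sigma> \<omega>) \<le> exit_time c \<omega>"
        unfolding \<sigma>_def ereal_clamp by (auto simp: B_def)
      then have "\<bar>X (\<sigma> \<omega>) \<omega>\<bar> \<le> c"
        using until_exit[OF that(1)] \<sigma>_bounds[of \<omega>] p0[of i] c X0[OF that(1)] by auto
      then show ?thesis using X0[OF that(1)] a0 by simp
    qed
    have st: "stopping (\<lambda>\<omega>. ereal (\<sigma> \<omega>))" "\<sigma> \<in> borel_measurable M"
      unfolding \<sigma>_def by (rule stopping_clamp[OF stopping_exit p0 p_mono] measurable_clamp[OF stopping_exit p0 p_mono])+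
    have ap: "a \<le> p i" using p0 a0 by simp
    note os = optional_stopping[OF ap p_mono Z_meas Z_bd st \<sigma>_bounds \<sigma>_X]
    have Zi: "integrable M (\<lambda>\<omega>. Z \<omega> * expX (p i) \<omega>)"
      by (rule weighted_martingale(1)[OF ap order_refl Z_meas Z_bd])
    have key: "V i \<omega> * V (Suc i) \<omega> - V i \<omega> * V i \<omega> = Z \<omega> * expX (\<sigma> \<omega>) \<omega> - Z \<omega> * expX (p i) \<omega>"
      if "\<omega> \<in> space M" for \<omega>
    proof (cases "\<omega> \<in> B")
      case True
      then have le: "ereal (p i) \<le> exit_time c \<omega>" by (simp add: B_def)
      have "ereal (\<tau> i \<omega>) = ereal (p i)"
        unfolding \<tau>_def ereal_clamp using le p0[of i] by (simp add: min_absorb1 max_absorb2)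
      moreover have "ereal (\<tau> (Suc i) \<omega>) = ereal (\<sigma> \<omega>)"
        unfolding \<tau>_def \<sigma>_def ereal_clamp
        using le p0[of i] p0[of "Suc i"] p_mono[of i] hit_nonneg[of "\<lambda>s. \<bar>X s \<omega>\<bar>" c]
        by (simp add: max_absorb2 zero_ereal_def)
      moreover have "expX r \<omega> = exp (\<theta> * X r \<omega>)" for r
        using X0[OF that] unfolding expX_def unfolding a0 by simp
      ultimately show ?thesis
        using True by (simp add: Z_def V_def right_diff_distrib)
    next
      case False
      then have lt: "exit_time c \<omega> < ereal (p i)" using that by (auto simp: B_def)
      have "min (ereal (p (Suc i))) (exit_time c \<omega>) = exit_time c \<omega>"
        "min (ereal (p i)) (exit_time c \<omega>) = exit_time c \<omega>"
        using lt p_mono[of i] by (cases "exit_time c \<omega>"; force simp: min_def)+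
      then have "\<tau> (Suc i) \<omega> = \<tau> i \<omega>"
        unfolding \<tau>_def clamp_def by simp
      then show ?thesis using False by (simp add: V_def Z_def)
    qed
    have "(\<integral>\<omega>. V i \<omega> * V (Suc i) \<omega> - V i \<omega> * V i \<omega> \<partial>M) = (\<integral>\<omega>. Z \<omega> * expX (\<sigma> \<omega>) \<omega> - Z \<omega> * expX (p i) \<omega> \<partial>M)"
      using key by (intro Bochner_Integration.integral_cong) auto
    also have "\<dots> = 0" using os Zi by simp
    finally show ?thesis using VV by simp
  qed
  have sq: "integrable M (\<lambda>\<omega>. (dX i \<omega>)\<^sup>2)" for i
  proof (rule integrable_const_bound[where B = "(2 * c)\<^sup>2"])
    show "AE \<omega> in M. norm ((dX i \<omega>)\<^sup>2) \<le> (2 * c)\<^sup>2"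
    proof (intro AE_I2)
      fix \<omega> assume "\<omega> \<in> space M"
      then have "\<bar>dX i \<omega>\<bar> \<le> 2 * c"
        using X_bd[of \<omega> i] X_bd[of \<omega> "Suc i"] by (auto simp: dX_def)
      then have "\<bar>dX i \<omega>\<bar>\<^sup>2 \<le> (2 * c)\<^sup>2" by (intro power_mono) auto
      then show "norm ((dX i \<omega>)\<^sup>2) \<le> (2 * c)\<^sup>2" by simp
    qed
  qed measurable
  then show "integrable M (\<lambda>\<omega>. \<Sum>i<Suc n. (dX i \<omega>)\<^sup>2)"
    by (intro Bochner_Integration.integrable_sum)
  have step: "\<theta>\<^sup>2 * (\<integral>\<omega>. (dX i \<omega>)\<^sup>2 \<partial>M) \<le>
      exp (2 * (\<bar>\<theta>\<bar> * c)) * ((\<integral>\<omega>. V (Suc i) \<omega> * V (Suc i) \<omega> \<partial>M) - (\<integral>\<omega>. V i \<omega> * V i \<omega> \<partial>M))" for i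
  proof -
    have sqV: "integrable M (\<lambda>\<omega>. (V (Suc i) \<omega> - V i \<omega>)\<^sup>2)"
      using VV by (simp add: power2_eq_square algebra_simps)
    have "\<theta>\<^sup>2 * (\<integral>\<omega>. (dX i \<omega>)\<^sup>2 \<partial>M) =
        (\<integral>\<omega>. \<theta>\<^sup>2 * (dX i \<omega>)\<^sup>2 \<partial>M)" by simp
    also have "\<dots> \<le> (\<integral>\<omega>. exp (2 * (\<bar>\<theta>\<bar> * c)) * (V (Suc i) \<omega> - V i \<omega>)\<^sup>2 \<partial>M)"
    proof (rule integral_mono)
      fix \<omega> assume \<omega>: "\<omega> \<in> space M"
      have "\<bar>\<theta> * X (\<tau> (Suc i) \<omega>) \<omega> - \<theta> * X (\<tau> i \<omega>) \<omega>\<bar> \<le> exp (\<bar>\<theta>\<bar> * c) * \<bar>V (Suc i) \<omega> - V i \<omega>\<bar>"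
        unfolding V_def by (rule abs_diff_le_exp[OF \<theta>X[OF \<omega>] \<theta>X[OF \<omega>]])
      then have "\<bar>\<theta> * X (\<tau> (Suc i) \<omega>) \<omega> - \<theta> * X (\<tau> i \<omega>) \<omega>\<bar>\<^sup>2 \<le> (exp (\<bar>\<theta>\<bar> * c) * \<bar>V (Suc i) \<omega> - V i \<omega>\<bar>)\<^sup>2"
        by (intro power_mono) auto
      then show "\<theta>\<^sup>2 * (dX i \<omega>)\<^sup>2 \<le> exp (2 * (\<bar>\<theta>\<bar> * c)) * (V (Suc i) \<omega> - V i \<omega>)\<^sup>2"
        by (simp add: dX_def power_mult_distrib right_diff_distrib[symmetric] exp_double[symmetric])
    qed (use sq sqV in auto)
    also have "\<dots> = exp (2 * (\<bar>\<theta>\<bar> * c)) * (\<integral>\<omega>. (V (Suc i) \<omega> - V i \<omega>)\<^sup>2 \<partial>M)" by simp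
    also have "(\<integral>\<omega>. (V (Suc i) \<omega> - V i \<omega>)\<^sup>2 \<partial>M) =
        (\<integral>\<omega>. (V (Suc i) \<omega> * V (Suc i) \<omega> - V i \<omega> * V i \<omega>) - 2 * (V i \<omega> * V (Suc i) \<omega> - V i \<omega> * V i \<omega>) \<partial>M)"
      by (intro Bochner_Integration.integral_cong) (auto simp: power2_eq_square algebra_simps)
    also have "\<dots> = (\<integral>\<omega>. V (Suc i) \<omega> * V (Suc i) \<omega> \<partial>M) - (\<integral>\<omega>. V i \<omega> * V i \<omega> \<partial>M)"
      using VV cross by simp
    finally show ?thesis .
  qed
  have "\<theta>\<^sup>2 * (\<integral>\<omega>. (\<Sum>i<Suc n. (dX i \<omega>)\<^sup>2) \<partial>M) =
      (\<Sum>i<Suc n. \<theta>\<^sup>2 * (\<integral>\<omega>. (dX i \<omega>)\<^sup>2 \<partial>M))"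
    unfolding sum_distrib_left[symmetric]
    by (simp only: Bochner_Integration.integral_sum[OF sq])
  also have "\<dots> \<le> (\<Sum>i<Suc n. exp (2 * (\<bar>\<theta>\<bar> * c)) * ((\<integral>\<omega>. V (Suc i) \<omega> * V (Suc i) \<omega> \<partial>M) - (\<integral>\<omega>. V i \<omega> * V i \<omega> \<partial>M)))"
    by (intro sum_mono step)
  also have "\<dots> = exp (2 * (\<bar>\<theta>\<bar> * c)) * ((\<integral>\<omega>. V (Suc n) \<omega> * V (Suc n) \<omega> \<partial>M) - (\<integral>\<omega>. V 0 \<omega> * V 0 \<omega> \<partial>M))"
    unfolding sum_distrib_left[symmetric] 
    by (simp only: sum_lessThan_telescope[of "\<lambda>i. \<integral>\<omega>. V i \<omega> * V i \<omega> \<partial>M"])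
  also have "\<dots> \<le> exp (2 * (\<bar>\<theta>\<bar> * c)) * exp (2 * (\<bar>\<theta>\<bar> * c))"
  proof (rule mult_left_mono)
    have "(\<integral>\<omega>. V (Suc n) \<omega> * V (Suc n) \<omega> \<partial>M) \<le> (\<integral>\<omega>. exp (2 * (\<bar>\<theta>\<bar> * c)) \<partial>M)"
    proof (rule integral_mono[OF VV])
      fix \<omega> assume "\<omega> \<in> space M"
      then have "\<bar>V (Suc n) \<omega>\<bar> * \<bar>V (Suc n) \<omega>\<bar> \<le> exp (\<bar>\<theta>\<bar> * c) * exp (\<bar>\<theta>\<bar> * c)"
        by (intro mult_mono V_bd) auto
      then show "V (Suc n) \<omega> * V (Suc n) \<omega> \<le> exp (2 * (\<bar>\<theta>\<bar> * c))"
        by (simp add: exp_add[symmetric] mult.commute)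
    qed simp
    moreover have "0 \<le> (\<integral>\<omega>. V 0 \<omega> * V 0 \<omega> \<partial>M)" by (intro integral_nonneg_AE) auto
    ultimately show "(\<integral>\<omega>. V (Suc n) \<omega> * V (Suc n) \<omega> \<partial>M) - (\<integral>\<omega>. V 0 \<omega> * V 0 \<omega> \<partial>M) \<le> exp (2 * (\<bar>\<theta>\<bar> * c))"
      by (simp only: lebesgue_integral_const prob_space scaleR_one)
  qed simp
  also have "\<dots> = exp (4 * (\<bar>\<theta>\<bar> * c))" by (simp add: exp_add[symmetric])
  finally show "\<theta>\<^sup>2 * (\<integral>\<omega>. (\<Sum>i<Suc n. (dX i \<omega>)\<^sup>2) \<partial>M) \<le> exp (4 * (\<bar>\<theta>\<bar> * c))" .
qed

text \<open>On paths that stay in \<open>(- c, c)\<close> forever, sums of squared increments approximate the divergent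
  quadratic variation, although their expectations are bounded.\<close>

lemma exit_finite:
  assumes a0: "a = 0" and X0: "\<And>\<omega>. \<omega> \<in> space M \<Longrightarrow> X 0 \<omega> = 0" and c: "0 < c" and \<theta>: "\<theta> \<noteq> 0"
    and qv: "is_quadratic_variation M F X q" and div: "AE \<omega> in M. filterlim (\<lambda>t. q t \<omega>) at_top at_top"
  shows "AE \<omega> in M. exit_time c \<omega> < \<infinity>"
proof -
  note [measurable] = exit_borel[of c]
  define B where "B = {\<omega> \<in> space M. exit_time c \<omega> = \<infinity>}"
  have [measurable]: "B \<in> events" unfolding B_def by measurable
  define C where "C = exp (4 * (\<bar>\<theta>\<bar> * c)) / \<theta>\<^sup>2"
  have C0: "0 \<le> C" by (simp add: C_def)
  have q_meas: "q t \<in> borel_measurable M" if "0 \<le> t" for t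
    using qv that measurable_F_M by (auto simp: is_quadratic_variation_def)
  have small: "prob (B \<inter> {\<omega> \<in> space M. r + 1 < q t \<omega>}) \<le> C / r" if t: "0 \<le> t" and r: "0 < r" for t r :: real
  proof (rule field_le_epsilon)
    fix e :: real assume e: "0 < e"
    obtain d where d: "0 < d" "\<And>(n::nat) p. p 0 = 0 \<and> p n = t \<and> (\<forall>i<n. p i \<le> p (Suc i) \<and> p (Suc i) - p i < d) \<Longrightarrow>
        prob {\<omega> \<in> space M. 1 < \<bar>(\<Sum>i<n. (X (p (Suc i)) \<omega> - X (p i) \<omega>)\<^sup>2) - q t \<omega>\<bar>} < e"
      using qv[unfolded is_quadratic_variation_def, THEN conjunct2, THEN conjunct2, rule_format, OF t zero_less_one e]
      by blast
    obtain n :: nat where n: "t / d < real n" using reals_Archimedean2 by blast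
    define p where "p i = t * real i / real (Suc n)" for i
    have p_diff: "p (Suc i) - p i = t / real (Suc n)" for i
      by (simp add: p_def diff_divide_distrib[symmetric] algebra_simps del: of_nat_Suc) (simp add: algebra_simps)
    have p_0: "p 0 = 0" and p_n: "p (Suc n) = t" by (auto simp: p_def)
    have "t < d * real (Suc n)" using n d(1) by (simp add: field_simps)
    then have "t / real (Suc n) < d" by (simp add: divide_less_eq del: of_nat_Suc)
    moreover have "0 \<le> t / real (Suc n)" using t by simp
    ultimately have p_ok: "p 0 = 0 \<and> p (Suc n) = t \<and> (\<forall>i<Suc n. p i \<le> p (Suc i) \<and> p (Suc i) - p i < d)"
      using p_diff by (metis diff_ge_0_iff_ge p_0 p_n)
    define S where "S \<omega> = (\<Sum>i<Suc n. (X (clamp 0 (p (Suc i)) (exit_time c) \<omega>) \<omega> - X (clamp 0 (p i) (exit_time c) \<omega>) \<omega>)\<^sup>2)" for \<omega>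
    have S: "integrable M S" "\<theta>\<^sup>2 * (\<integral>\<omega>. S \<omega> \<partial>M) \<le> exp (4 * (\<bar>\<theta>\<bar> * c))"
      using stopped_square_variation[OF a0 X0 c t, of n] unfolding S_def p_def by auto
    have S_B: "S \<omega> = (\<Sum>i<Suc n. (X (p (Suc i)) \<omega> - X (p i) \<omega>)\<^sup>2)" if "\<omega> \<in> B" for \<omega>
    proof -
      have "clamp 0 (p i) (exit_time c) \<omega> = p i" for i
        using that t by (simp add: clamp_def B_def p_def max_def)
      then show ?thesis by (simp add: S_def)
    qed
    have [measurable]: "S \<in> borel_measurable M" "q t \<in> borel_measurable M" using S q_meas[OF t] by auto
    have Xp[measurable]: "X (p i) \<in> borel_measurable M" for i
      using X_measurable t by (simp add: p_def)
    have "prob (B \<inter> {\<omega> \<in> space M. r + 1 < q t \<omega>}) \<le>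
        prob ({\<omega> \<in> space M. r \<le> S \<omega>} \<union> {\<omega> \<in> space M. 1 < \<bar>(\<Sum>i<Suc n. (X (p (Suc i)) \<omega> - X (p i) \<omega>)\<^sup>2) - q t \<omega>\<bar>})"
      using S_B by (intro finite_measure_mono) auto
    also have "\<dots> \<le> prob {\<omega> \<in> space M. r \<le> S \<omega>} +
        prob {\<omega> \<in> space M. 1 < \<bar>(\<Sum>i<Suc n. (X (p (Suc i)) \<omega> - X (p i) \<omega>)\<^sup>2) - q t \<omega>\<bar>}"
      by (intro measure_Un_le) auto
    also have "prob {\<omega> \<in> space M. r \<le> S \<omega>} \<le> (\<integral>\<omega>. S \<omega> \<partial>M) / r"
    proof (rule integral_Markov_inequality_measure[where A = "{}"])
      show "AE \<omega> in M. 0 \<le> S \<omega>" unfolding S_def by (intro AE_I2 sum_nonneg) auto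
    qed (use S(1) r in auto)
    also have "(\<integral>\<omega>. S \<omega> \<partial>M) / r \<le> C / r"
      using S(2) r \<theta> by (intro divide_right_mono) (auto simp: C_def field_simps)
    also have "prob {\<omega> \<in> space M. 1 < \<bar>(\<Sum>i<Suc n. (X (p (Suc i)) \<omega> - X (p i) \<omega>)\<^sup>2) - q t \<omega>\<bar>} \<le> e"
      using d(2)[OF p_ok] by simp
    finally show "prob (B \<inter> {\<omega> \<in> space M. r + 1 < q t \<omega>}) \<le> C / r + e" by simp
  qed
  \<comment> \<open>Divergence of \<open>q\<close> exhausts \<open>B\<close> as the time tends to infinity.\<close>
  have B_le: "prob B \<le> C / r" if r: "0 < r" for r
  proof (rule prob_le_of_eventually[where G = "\<lambda>k. {\<omega> \<in> space M. r + 1 < q (real k) \<omega>}"])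
    show "{\<omega> \<in> space M. r + 1 < q (real k) \<omega>} \<in> events" for k using q_meas[of "real k"] by measurable
    show "AE \<omega> in M. \<omega> \<in> B \<longrightarrow> (\<forall>\<^sub>F k in sequentially. \<omega> \<in> {\<omega> \<in> space M. r + 1 < q (real k) \<omega>})"
      using div
    proof eventually_elim
      case (elim \<omega>)
      then have "filterlim (\<lambda>k. q (real k) \<omega>) at_top sequentially"
        by (rule filterlim_compose[OF _ filterlim_real_sequentially])
      then have "\<forall>\<^sub>F k in sequentially. r + 1 < q (real k) \<omega>" by (simp add: filterlim_at_top_dense)
      then show ?case by (auto simp: B_def)
    qed
    show "prob (B \<inter> {\<omega> \<in> space M. r + 1 < q (real k) \<omega>}) \<le> C / r" for k
      using small[of "real k" r] r by simp
  qed measurable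
  have "prob B \<le> 0"
  proof (rule field_le_epsilon)
    fix e :: real assume e: "0 < e"
    have "prob B \<le> C / ((C + 1) / e)" using e C0 by (intro B_le) auto
    also have "\<dots> \<le> e" using e C0 by (simp add: field_simps)
    finally show "prob B \<le> 0 + e" by simp
  qed
  then have "prob B = 0" by (simp add: measure_le_0_iff)
  then have "AE \<omega> in M. \<omega> \<notin> B" by (subst prob_eq_0[symmetric]) auto
  then show ?thesis using AE_space by eventually_elim (auto simp: B_def)
qed

end

section \<open>The identity without bounds on the process\<close>

context exp_martingale
begin

lemma exit_eventually_after:
  assumes "\<omega> \<in> space M" "0 \<le> t"
  shows "\<forall>\<^sub>F n in sequentially. ereal t < exit_time (real n) \<omega>"
proof -
  have "compact ((\<lambda>s. X s \<omega>) ` {0..t})"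
    using X_cont[OF assms(1)] by (intro compact_continuous_image) (auto intro: continuous_on_subset)
  then obtain C where C: "\<And>s. 0 \<le> s \<Longrightarrow> s \<le> t \<Longrightarrow> \<bar>X s \<omega>\<bar> \<le> C"
    using compact_imp_bounded[of "(\<lambda>s. X s \<omega>) ` {0..t}"] by (fastforce simp: bounded_iff)
  obtain k :: nat where k: "C < real k" using reals_Archimedean2 by blast
  show ?thesis
  proof (rule eventually_sequentiallyI[of k])
    fix n assume "k \<le> n"
    then have "C < real n" using k by auto
    then have "\<not> exit_time (real n) \<omega> \<le> ereal t"
      unfolding hit_le_iff[OF abs_X_cont[OF assms(1)] assms(2)] using C by (meson leD order_trans)
    then show "ereal t < exit_time (real n) \<omega>" by simp
  qed
qed

lemma exit_time_mono: "c \<le> d \<Longrightarrow> exit_time c \<omega> \<le> exit_time d \<omega>"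
  unfolding hit_def by (intro Inf_superset_mono image_mono) auto

text \<open>As long as \<open>T\<close> has not stopped, \<open>X\<close> is bounded above by \<open>\<eta>\<close>. If \<open>T\<close> never stops, \<open>X\<close> therefore
  leaves \<open>(- c, c)\<close> at the lower end for every large \<open>c\<close>, where \<open>- m \<ge> c\<close>. But the identity bounds
  the expectation of \<open>- m\<close> by \<open>exp \<eta>\<close>.\<close>

lemma stopping_finite:
  assumes a0: "a = 0" and X0: "\<And>\<omega>. \<omega> \<in> space M \<Longrightarrow> X 0 \<omega> = 0" and \<theta>: "\<theta> = 1"
    and exits: "\<And>c. 0 < c \<Longrightarrow> AE \<omega> in M. exit_time c \<omega> < \<infinity>"
    and T: "stopping T" and T0: "\<And>\<omega>. \<omega> \<in> space M \<Longrightarrow> 0 \<le> T \<omega>"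
    and \<eta>: "\<And>\<omega> s. \<omega> \<in> space M \<Longrightarrow> 0 \<le> s \<Longrightarrow> ereal s \<le> T \<omega> \<Longrightarrow> y s \<omega> \<le> \<eta>"
  shows "AE \<omega> in M. T \<omega> < \<infinity>"
proof -
  note [measurable] = stopping_borel[OF T T0]
  define B where "B = {\<omega> \<in> space M. T \<omega> = \<infinity>}"
  have [measurable]: "B \<in> events" unfolding B_def by measurable
  have prob_B: "prob B \<le> exp \<eta> / c" if c: "0 < c" "\<eta> < c" for c
  proof (rule prob_le_of_eventually[where G = "\<lambda>k. {\<omega> \<in> space M. exit_time c \<omega> \<le> ereal (real k)}"])
    show G: "{\<omega> \<in> space M. exit_time c \<omega> \<le> ereal (real k)} \<in> events" for k
      using exit_borel[of c] by measurable
    show "AE \<omega> in M. \<omega> \<in> B \<longrightarrow> (\<forall>\<^sub>F k in sequentially. \<omega> \<in> {\<omega> \<in> space M. exit_time c \<omega> \<le> ereal (real k)})"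
      using exits[OF c(1)]
    proof eventually_elim
      case (elim \<omega>)
      then obtain k0 :: nat where "exit_time c \<omega> < ereal (real k0)" using less_PInf_Ex_of_nat by auto
      then have "\<forall>\<^sub>F k in sequentially. exit_time c \<omega> \<le> ereal (real k)"
        by (intro eventually_sequentiallyI[of k0]) (meson ereal_less_eq(3) less_imp_le less_le_trans of_nat_le_iff)
      then show ?case by (auto simp: B_def)
    qed
    fix k
    define S where "S \<omega> = min (T \<omega>) (exit_time c \<omega>)" for \<omega>
    define \<tau> where "\<tau> = clamp a (real k) S"
    have S: "stopping S" unfolding S_def by (rule stopping_min[OF T stopping_exit])
    have S0: "0 \<le> S \<omega>" if "\<omega> \<in> space M" for \<omega> using T0[OF that] hit_nonneg by (auto simp: S_def)
    have X_bd: "\<bar>X s \<omega>\<bar> \<le> c" if "\<omega> \<in> space M" "0 \<le> s" "ereal s \<le> S \<omega>" for s \<omega>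
      using until_exit[OF that(1) _ that(2)] X0[OF that(1)] c(1) that(3) by (auto simp: S_def)
    have ak: "a \<le> real k" using a0 by simp
    have sp: "space M \<in> sets (F a)" using sets.top[of "F a"] a_nonneg by simp
    note ay = azema_yor_bounded[OF S ak sp _ X_bd]
    have ay: "integrable M (\<lambda>\<omega>. indicator (space M) \<omega> * (m a \<omega> - m (\<tau> \<omega>) \<omega>))"
      "integrable M (\<lambda>\<omega>. indicator (space M) \<omega> * (exp (\<theta> * y (\<tau> \<omega>) \<omega>) - exp (\<theta> * y a \<omega>)))"
      "\<theta> * (\<integral>\<omega>. indicator (space M) \<omega> * (m a \<omega> - m (\<tau> \<omega>) \<omega>) \<partial>M) =
      (\<integral>\<omega>. indicator (space M) \<omega> * (exp (\<theta> * y (\<tau> \<omega>) \<omega>) - exp (\<theta> * y a \<omega>)) \<partial>M)"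
      unfolding \<tau>_def by (rule ay; use S0 a0 c in \<open>simp add: zero_ereal_def[symmetric]\<close>)+
    have \<tau>_bounds: "0 \<le> \<tau> \<omega>" "a \<le> \<tau> \<omega>" for \<omega> using clamp_bounds[OF ak, of S \<omega>] a0 by (auto simp: \<tau>_def)
    have \<tau>_S: "ereal (\<tau> \<omega>) \<le> S \<omega>" if "\<omega> \<in> space M" for \<omega>
      unfolding \<tau>_def ereal_clamp using S0[OF that] a0 by (auto simp: zero_ereal_def[symmetric])
    have "(\<integral>\<omega>. indicator (space M) \<omega> * (exp (\<theta> * y (\<tau> \<omega>) \<omega>) - exp (\<theta> * y a \<omega>)) \<partial>M) \<le> (\<integral>\<omega>. exp \<eta> \<partial>M)"
    proof (rule integral_mono[OF ay(2)])
      fix \<omega> assume \<omega>: "\<omega> \<in> space M"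
      have "y (\<tau> \<omega>) \<omega> \<le> \<eta>" using \<eta>[OF \<omega> \<tau>_bounds(1)] \<tau>_S[OF \<omega>] by (simp add: S_def)
      then have "exp (\<theta> * y (\<tau> \<omega>) \<omega>) \<le> exp \<eta>" by (simp add: \<theta>)
      then show "indicator (space M) \<omega> * (exp (\<theta> * y (\<tau> \<omega>) \<omega>) - exp (\<theta> * y a \<omega>)) \<le> exp \<eta>"
        using \<omega> exp_gt_zero[of "\<theta> * y a \<omega>"] by (simp only: indicator_simps mult_1)
    qed simp
    then have upper: "(\<integral>\<omega>. indicator (space M) \<omega> * (m a \<omega> - m (\<tau> \<omega>) \<omega>) \<partial>M) \<le> exp \<eta>"
      using ay(3) by (simp add: \<theta> prob_space)
    let ?G = "B \<inter> {\<omega> \<in> space M. exit_time c \<omega> \<le> ereal (real k)}"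
    have G_ev: "?G \<in> events" using G by measurable
    have "c * prob ?G = (\<integral>\<omega>. c * indicator ?G \<omega> \<partial>M)" using G_ev by simp
    also have "\<dots> \<le> (\<integral>\<omega>. indicator (space M) \<omega> * (m a \<omega> - m (\<tau> \<omega>) \<omega>) \<partial>M)"
    proof (rule integral_mono[OF _ ay(1)])
      show "integrable M (\<lambda>\<omega>. c * indicator ?G \<omega>)"
        using G_ev by (intro integrable_mult_right integrable_real_indicator) (auto simp: emeasure_eq_measure)
      fix \<omega> assume \<omega>: "\<omega> \<in> space M"
      have m0: "m a \<omega> = 0" using X0[OF \<omega>] a0 by (simp add: m_def running_min_def)
      show "c * indicator ?G \<omega> \<le> indicator (space M) \<omega> * (m a \<omega> - m (\<tau> \<omega>) \<omega>)"
      proof (cases "\<omega> \<in> ?G")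
        case True
        obtain h where h: "exit_time c \<omega> = ereal h" "0 \<le> h" "h \<le> real k"
          using True hit_nonneg[of "\<lambda>s. \<bar>X s \<omega>\<bar>" c] by (cases "exit_time c \<omega>") auto
        have "ereal (\<tau> \<omega>) = ereal h"
          unfolding \<tau>_def ereal_clamp using True h a0 by (simp add: S_def B_def min_absorb2 max_absorb2)
        then have \<tau>h: "\<tau> \<omega> = h" by simp
        have "c \<le> \<bar>X h \<omega>\<bar>" by (rule at_hit[OF abs_X_cont[OF \<omega>] h(1,2)])
        moreover have "y h \<omega> \<le> \<eta>" using \<eta>[OF \<omega> h(2)] True by (simp add: B_def)
        moreover have "m h \<omega> \<le> 0" using m_antimono[OF \<omega> a_nonneg, of h] m0 h(2) a0 by simp
        moreover have "m h \<omega> \<le> X h \<omega>" using y_nonneg[OF \<omega> h(2)] by (simp add: y_def)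
        ultimately have "c \<le> - m h \<omega>" using c(2) by (auto simp: y_def)
        then show ?thesis using True \<omega> m0 \<tau>h by simp
      next
        case False
        then show ?thesis using \<omega> m_antimono[OF \<omega> a_nonneg \<tau>_bounds(2)] by simp
      qed
    qed
    also note upper
    finally show "prob ?G \<le> exp \<eta> / c" using c(1) by (simp add: field_simps)
  qed measurable
  have "prob B \<le> 0"
  proof (rule field_le_epsilon)
    fix e :: real assume e: "0 < e"
    define c where "c = max (max 1 (\<eta> + 1)) (exp \<eta> / e)"
    have "prob B \<le> exp \<eta> / c" by (rule prob_B) (auto simp: c_def)
    also have "\<dots> \<le> e"
    proof -
      have "exp \<eta> / e \<le> c" "0 < c" by (auto simp: c_def)
      then show ?thesis using e by (simp add: field_simps)
    qed
    finally show "prob B \<le> 0 + e" by simp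
  qed
  then have "prob B = 0" by (simp add: measure_le_0_iff)
  then have "AE \<omega> in M. \<omega> \<notin> B" by (subst prob_eq_0[symmetric]) auto
  then show ?thesis using AE_space by eventually_elim (auto simp: B_def)
qed

text \<open>The bounded identity is applied up to the exit from \<open>(- n, n)\<close> and the time \<open>a + n\<close>. As
  \<open>n\<close> grows, \<open>m a - m\<close> increases, while \<open>0 \<le> y \<le> \<eta>\<close> keeps the other side dominated.\<close>

lemma azema_yor:
  assumes \<theta>: "\<theta> \<noteq> 0" and T: "stopping T" and T0: "\<And>\<omega>. \<omega> \<in> space M \<Longrightarrow> 0 \<le> T \<omega>"
    and A: "A \<in> sets (F a)" and aT: "\<And>\<omega>. \<omega> \<in> A \<Longrightarrow> ereal a \<le> T \<omega>"
    and \<eta>: "\<And>\<omega> s. \<omega> \<in> space M \<Longrightarrow> 0 \<le> s \<Longrightarrow> ereal s \<le> T \<omega> \<Longrightarrow> y s \<omega> \<le> \<eta>"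
    and fin: "AE \<omega> in M. T \<omega> < \<infinity>"
  defines "\<tau> \<equiv> \<lambda>\<omega>. real_of_ereal (T \<omega>)"
  shows "integrable M (\<lambda>\<omega>. indicator A \<omega> * (m a \<omega> - m (\<tau> \<omega>) \<omega>))"
    and "integrable M (\<lambda>\<omega>. indicator A \<omega> * (exp (\<theta> * y (\<tau> \<omega>) \<omega>) - exp (\<theta> * y a \<omega>)))"
    and "\<theta> * (\<integral>\<omega>. indicator A \<omega> * (m a \<omega> - m (\<tau> \<omega>) \<omega>) \<partial>M) =
      (\<integral>\<omega>. indicator A \<omega> * (exp (\<theta> * y (\<tau> \<omega>) \<omega>) - exp (\<theta> * y a \<omega>)) \<partial>M)"
proof -
  have AM: "A \<subseteq> space M" using sets.sets_into_space[OF A] a_nonneg by simp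
  have [measurable]: "A \<in> sets M" using sets_F_M[OF a_nonneg A] .
  have \<tau>0: "0 \<le> \<tau> \<omega>" if "\<omega> \<in> space M" for \<omega>
    using T0[OF that] by (simp add: \<tau>_def real_of_ereal_pos)
  have \<tau>_meas: "\<tau> \<in> borel_measurable M"
    unfolding \<tau>_def using stopping_borel[OF T T0] by (rule borel_measurable_real_of_ereal)
  have \<tau>_le: "ereal (\<tau> \<omega>) \<le> T \<omega>" if "\<omega> \<in> space M" for \<omega>
    using T0[OF that] by (cases "T \<omega>") (auto simp: \<tau>_def)
  have [measurable]: "(\<lambda>\<omega>. m (\<tau> \<omega>) \<omega>) \<in> borel_measurable M"
    by (rule measurable_at_unbounded_random_time[OF m_measurable m_cont \<tau>_meas \<tau>0])
  have [measurable]: "(\<lambda>\<omega>. y (\<tau> \<omega>) \<omega>) \<in> borel_measurable M"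
    by (rule measurable_at_unbounded_random_time[OF y_measurable y_cont \<tau>_meas \<tau>0])
  note [measurable] = m_measurable[OF a_nonneg] y_measurable[OF a_nonneg]
  define S where "S n \<omega> = min (T \<omega>) (exit_time (real n) \<omega>)" for n \<omega>
  define A' where "A' n = A - {\<omega> \<in> space M. exit_time (real n) \<omega> \<le> ereal a}" for n :: nat
  define t where "t n = clamp a (a + real n) (S n)" for n
  have A'_in: "A' n \<in> sets (F a)" for n
    unfolding A'_def using A exit_le_in[OF a_nonneg] by auto
  have A': "\<omega> \<in> A" "\<omega> \<in> space M" "ereal a < exit_time (real n) \<omega>" if "\<omega> \<in> A' n" for \<omega> n
    using that AM by (auto simp: A'_def)
  have S: "stopping (S n)" for n unfolding S_def by (rule stopping_min[OF T stopping_exit])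
  have S_a: "ereal a \<le> S n \<omega>" if "\<omega> \<in> A' n" for \<omega> n
    using A'[OF that] aT by (auto simp: S_def)
  have X_bd: "\<bar>X s \<omega>\<bar> \<le> real n" if "\<omega> \<in> A' n" "0 \<le> s" "ereal s \<le> S n \<omega>" for \<omega> n s
  proof -
    have "ereal 0 < exit_time (real n) \<omega>"
      using A'(3)[OF that(1)] a_nonneg by (meson ereal_less_eq(3) le_less_trans)
    then have "\<bar>X 0 \<omega>\<bar> < real n" using before_hit[of 0] by auto
    then show ?thesis using until_exit[OF A'(2)[OF that(1)]] that(2,3) by (auto simp: S_def)
  qed
  have an: "a \<le> a + real n" for n by simp
  have ay: "integrable M (\<lambda>\<omega>. indicator (A' n) \<omega> * (m a \<omega> - m (t n \<omega>) \<omega>))"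
    "integrable M (\<lambda>\<omega>. indicator (A' n) \<omega> * (exp (\<theta> * y (t n \<omega>) \<omega>) - exp (\<theta> * y a \<omega>)))"
    "\<theta> * (\<integral>\<omega>. indicator (A' n) \<omega> * (m a \<omega> - m (t n \<omega>) \<omega>) \<partial>M) =
      (\<integral>\<omega>. indicator (A' n) \<omega> * (exp (\<theta> * y (t n \<omega>) \<omega>) - exp (\<theta> * y a \<omega>)) \<partial>M)" for n
    unfolding t_def
    by (rule azema_yor_bounded[OF S an A'_in S_a X_bd]; simp)+
  have t_bounds: "a \<le> t n \<omega>" "0 \<le> t n \<omega>" for n \<omega>
    using clamp_bounds[OF an[of n], of "S n" \<omega>] a_nonneg by (auto simp: t_def)
  have t_T: "ereal (t n \<omega>) \<le> T \<omega>" if "\<omega> \<in> A" for n \<omega>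
    using aT[OF that] unfolding t_def ereal_clamp S_def by (auto simp: min_le_iff_disj)
  have t_mono: "t n \<omega> \<le> t k \<omega>" if "n \<le> k" for n k \<omega>
  proof -
    have "ereal (t n \<omega>) \<le> ereal (t k \<omega>)"
      unfolding t_def ereal_clamp S_def using that exit_time_mono[of "real n" "real k" \<omega>]
      by (intro max.mono min.mono) auto
    then show ?thesis by simp
  qed
  have A'_mono: "A' n \<subseteq> A' k" if "n \<le> k" for n k
    using exit_time_mono[of "real n" "real k"] that by (auto simp: A'_def intro: order_trans)
  have ev: "\<forall>\<^sub>F n in sequentially. \<omega> \<in> A' n \<and> t n \<omega> = \<tau> \<omega>" if \<omega>: "\<omega> \<in> A" "T \<omega> < \<infinity>" for \<omega>
  proof -
    have \<omega>M: "\<omega> \<in> space M" using \<omega> AM by auto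
    obtain h where h: "T \<omega> = ereal h" using \<omega>(2) T0[OF \<omega>M] by (cases "T \<omega>") auto
    have ah: "a \<le> h" "0 \<le> h" using aT[OF \<omega>(1)] h a_nonneg by auto
    obtain k :: nat where k: "h - a < real k" using reals_Archimedean2 by blast
    from exit_eventually_after[OF \<omega>M ah(2)] eventually_ge_at_top[of k]
    show ?thesis
    proof eventually_elim
      case (elim n)
      have "ereal (t n \<omega>) = ereal h"
        unfolding t_def ereal_clamp S_def using h elim k ah by (simp add: min_absorb1 min_absorb2 max_absorb2)
      moreover have "\<not> exit_time (real n) \<omega> \<le> ereal a"
        using elim(1) ah(1) by (meson ereal_less_eq(3) leD order_trans)
      ultimately show ?case using \<omega> h by (simp add: A'_def \<tau>_def)
    qed
  qed
  have exp_bd: "0 < exp (\<theta> * y s \<omega>) \<and> exp (\<theta> * y s \<omega>) \<le> exp (\<bar>\<theta>\<bar> * \<eta>)"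
    if "\<omega> \<in> space M" "0 \<le> s" "ereal s \<le> T \<omega>" for s \<omega>
  proof -
    have "\<theta> * y s \<omega> \<le> \<bar>\<theta>\<bar> * y s \<omega>" using y_nonneg[OF that(1,2)] by (intro mult_right_mono) auto
    also have "\<dots> \<le> \<bar>\<theta>\<bar> * \<eta>" using \<eta>[OF that] by (intro mult_left_mono) auto
    finally show ?thesis by simp
  qed
  have diff_bd: "\<bar>exp (\<theta> * y s \<omega>) - exp (\<theta> * y a \<omega>)\<bar> \<le> exp (\<bar>\<theta>\<bar> * \<eta>)"
    if "\<omega> \<in> A" "0 \<le> s" "ereal s \<le> T \<omega>" for s \<omega>
    using exp_bd[of \<omega> s] exp_bd[of \<omega> a] that AM aT[OF that(1)] a_nonneg by (smt (verit) subsetD)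
  show int2: "integrable M (\<lambda>\<omega>. indicator A \<omega> * (exp (\<theta> * y (\<tau> \<omega>) \<omega>) - exp (\<theta> * y a \<omega>)))"
    by (rule integrable_const_bound[where B = "exp (\<bar>\<theta>\<bar> * \<eta>)"])
      (use diff_bd \<tau>0 \<tau>_le AM in \<open>auto simp: indicator_def\<close>)
  have "(\<lambda>n. \<integral>\<omega>. indicator (A' n) \<omega> * (exp (\<theta> * y (t n \<omega>) \<omega>) - exp (\<theta> * y a \<omega>)) \<partial>M)
     \<longlonglongrightarrow> (\<integral>\<omega>. indicator A \<omega> * (exp (\<theta> * y (\<tau> \<omega>) \<omega>) - exp (\<theta> * y a \<omega>)) \<partial>M)"
  proof (rule integral_dominated_convergence[where w = "\<lambda>_. exp (\<bar>\<theta>\<bar> * \<eta>)"])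
    show "AE \<omega> in M. (\<lambda>n. indicator (A' n) \<omega> * (exp (\<theta> * y (t n \<omega>) \<omega>) - exp (\<theta> * y a \<omega>)))
        \<longlonglongrightarrow> indicator A \<omega> * (exp (\<theta> * y (\<tau> \<omega>) \<omega>) - exp (\<theta> * y a \<omega>))"
      using fin
    proof eventually_elim
      case (elim \<omega>)
      show ?case
      proof (cases "\<omega> \<in> A")
        case True
        show ?thesis
          by (rule tendsto_eventually) (use ev[OF True elim] True in \<open>auto elim!: eventually_mono\<close>)
      qed (auto simp: A'_def)
    qed
    show "AE \<omega> in M. norm (indicator (A' n) \<omega> * (exp (\<theta> * y (t n \<omega>) \<omega>) - exp (\<theta> * y a \<omega>))) \<le> exp (\<bar>\<theta>\<bar> * \<eta>)" for n
      using diff_bd t_bounds t_T by (intro AE_I2) (auto simp: indicator_def A'_def)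
  qed (use ay(2) int2 in auto)
  then have "(\<lambda>n. (1 / \<theta>) * (\<theta> * (\<integral>\<omega>. indicator (A' n) \<omega> * (m a \<omega> - m (t n \<omega>) \<omega>) \<partial>M)))
     \<longlonglongrightarrow> (1 / \<theta>) * (\<integral>\<omega>. indicator A \<omega> * (exp (\<theta> * y (\<tau> \<omega>) \<omega>) - exp (\<theta> * y a \<omega>)) \<partial>M)"
    unfolding ay(3) by (rule tendsto_mult_left)
  then have lim: "(\<lambda>n. \<integral>\<omega>. indicator (A' n) \<omega> * (m a \<omega> - m (t n \<omega>) \<omega>) \<partial>M)
     \<longlonglongrightarrow> (1 / \<theta>) * (\<integral>\<omega>. indicator A \<omega> * (exp (\<theta> * y (\<tau> \<omega>) \<omega>) - exp (\<theta> * y a \<omega>)) \<partial>M)"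
    using \<theta> by simp
  have mono: "AE \<omega> in M. mono (\<lambda>n. indicator (A' n) \<omega> * (m a \<omega> - m (t n \<omega>) \<omega>))"
  proof (intro AE_I2 monoI)
    fix \<omega> and n k :: nat assume \<omega>: "\<omega> \<in> space M" and nk: "n \<le> k"
    have "m (t k \<omega>) \<omega> \<le> m (t n \<omega>) \<omega>" by (rule m_antimono[OF \<omega> t_bounds(2) t_mono[OF nk]])
    moreover have "m (t k \<omega>) \<omega> \<le> m a \<omega>" by (rule m_antimono[OF \<omega> a_nonneg t_bounds(1)])
    ultimately show "indicator (A' n) \<omega> * (m a \<omega> - m (t n \<omega>) \<omega>) \<le> indicator (A' k) \<omega> * (m a \<omega> - m (t k \<omega>) \<omega>)"
      using A'_mono[OF nk] by (auto simp: indicator_def)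
  qed
  have conv: "AE \<omega> in M. (\<lambda>n. indicator (A' n) \<omega> * (m a \<omega> - m (t n \<omega>) \<omega>)) \<longlonglongrightarrow> indicator A \<omega> * (m a \<omega> - m (\<tau> \<omega>) \<omega>)"
    using fin
  proof eventually_elim
    case (elim \<omega>)
    show ?case
    proof (cases "\<omega> \<in> A")
      case True
      show ?thesis
        by (rule tendsto_eventually) (use ev[OF True elim] True in \<open>auto elim!: eventually_mono\<close>)
    qed (auto simp: A'_def)
  qed
  have meas: "(\<lambda>\<omega>. indicator A \<omega> * (m a \<omega> - m (\<tau> \<omega>) \<omega>)) \<in> borel_measurable M" by measurable
  show "integrable M (\<lambda>\<omega>. indicator A \<omega> * (m a \<omega> - m (\<tau> \<omega>) \<omega>))"
    by (rule integrable_monotone_convergence[OF ay(1) mono conv lim meas])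
  have "(\<integral>\<omega>. indicator A \<omega> * (m a \<omega> - m (\<tau> \<omega>) \<omega>) \<partial>M) =
      (1 / \<theta>) * (\<integral>\<omega>. indicator A \<omega> * (exp (\<theta> * y (\<tau> \<omega>) \<omega>) - exp (\<theta> * y a \<omega>)) \<partial>M)"
    by (rule integral_monotone_convergence[OF ay(1) mono conv lim meas])
  then show "\<theta> * (\<integral>\<omega>. indicator A \<omega> * (m a \<omega> - m (\<tau> \<omega>) \<omega>) \<partial>M) =
      (\<integral>\<omega>. indicator A \<omega> * (exp (\<theta> * y (\<tau> \<omega>) \<omega>) - exp (\<theta> * y a \<omega>)) \<partial>M)"
    using \<theta> by (simp add: field_simps)
qed

end

section \<open>Communication times\<close>

locale sensor_path =
  fixes lo up :: real and x :: "real \<Rightarrow> real"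
  assumes lo_pos: "0 < lo" and up_pos: "0 < up"
    and x_cont: "continuous_on {0..} x"
begin

abbreviation ct :: "nat \<Rightarrow> ereal" where
  "ct \<equiv> comm_time lo up x"

lemma ct_nonneg: "0 \<le> ct n"
proof (induction n)
  case (Suc n)
  show ?case
    unfolding comm_time.simps
  proof (rule Inf_greatest)
    fix z assume "z \<in> ereal ` {t. ct n < ereal t \<and> x t - x (real_of_ereal (ct n)) \<notin> {- lo<..<up}}"
    then obtain t where "ct n < ereal t" "z = ereal t" by auto
    then have "ct n \<le> z" by (simp add: less_imp_le)
    with Suc show "0 \<le> z" by (rule order_trans)
  qed
qed simp

text \<open>After a shift of time by \<open>s\<close>, the next communication is the time at which the continuous process
  \<open>z\<close> reaches \<open>0\<close>. Time \<open>s\<close> itself may be included, since the displacement is \<open>0\<close> there.\<close>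

lemma ct_Suc_le_iff:
  assumes t: "ct n = ereal s"
  shows "ct (Suc n) \<le> ereal t \<longleftrightarrow> (\<exists>r\<ge>s. r \<le> t \<and> (x r - x s \<le> - lo \<or> up \<le> x r - x s))"
proof -
  have s0: "0 \<le> s" using ct_nonneg[of n] t by simp
  define z where "z r = max (x (s + r) - x s - up) (- lo - (x (s + r) - x s))" for r
  have z_cont: "continuous_on {0..} z"
    unfolding z_def using s0
    by (intro continuous_intros continuous_on_compose2[OF x_cont]) auto
  have out: "r > s \<and> x r - x s \<notin> {- lo<..<up} \<longleftrightarrow> r \<ge> s \<and> 0 \<le> z (r - s)" for r
    using lo_pos up_pos by (cases "r = s") (auto simp: z_def)
  have eq: "{r. ct n < ereal r \<and> x r - x (real_of_ereal (ct n)) \<notin> {- lo<..<up}} = (+) s ` {r. 0 \<le> r \<and> 0 \<le> z r}"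
  proof (intro set_eqI iffI)
    fix r assume "r \<in> {r. ct n < ereal r \<and> x r - x (real_of_ereal (ct n)) \<notin> {- lo<..<up}}"
    then have "r \<ge> s \<and> 0 \<le> z (r - s)" unfolding t out[symmetric] by simp
    then show "r \<in> (+) s ` {r. 0 \<le> r \<and> 0 \<le> z r}" by (intro image_eqI[of _ _ "r - s"]) auto
  next
    fix r assume "r \<in> (+) s ` {r. 0 \<le> r \<and> 0 \<le> z r}"
    then have "r \<ge> s \<and> 0 \<le> z (r - s)" by auto
    then show "r \<in> {r. ct n < ereal r \<and> x r - x (real_of_ereal (ct n)) \<notin> {- lo<..<up}}"
      unfolding t out[symmetric] by simp
  qed
  have iff: "ct (Suc n) \<le> ereal t \<longleftrightarrow> hit z 0 \<le> ereal (t - s)"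
  proof -
    have ctS: "ct (Suc n) = Inf (ereal ` (+) s ` {r. 0 \<le> r \<and> 0 \<le> z r})"
      by (simp only: comm_time.simps eq)
    have "ct (Suc n) = ereal s + hit z 0"
    proof (cases "{r. 0 \<le> r \<and> 0 \<le> z r} = {}")
      case True
      show ?thesis unfolding ctS hit_def True by (simp add: top_ereal_def)
    next
      case False
      then obtain h0 where "0 \<le> h0" "0 \<le> z h0" by auto
      then have "hit z 0 \<le> ereal h0" unfolding hit_def by (intro Inf_lower) auto
      then obtain h where h: "hit z 0 = ereal h" "0 \<le> h"
        using hit_nonneg[of z 0] by (cases "hit z 0") auto
      have zh: "0 \<le> z h" by (rule at_hit[OF z_cont h])
      have "Inf (ereal ` (+) s ` {r. 0 \<le> r \<and> 0 \<le> z r}) = ereal (s + h)"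
      proof (rule Inf_eqI)
        fix i assume "i \<in> ereal ` (+) s ` {r. 0 \<le> r \<and> 0 \<le> z r}"
        then obtain r where r: "0 \<le> r" "0 \<le> z r" "i = ereal (s + r)" by auto
        have "hit z 0 \<le> ereal r" unfolding hit_def using r by (intro Inf_lower) auto
        then show "ereal (s + h) \<le> i" using h r by simp
      next
        fix l assume "\<And>i. i \<in> ereal ` (+) s ` {r. 0 \<le> r \<and> 0 \<le> z r} \<Longrightarrow> l \<le> i"
        then show "l \<le> ereal (s + h)" using zh h by auto
      qed
      then show ?thesis unfolding ctS h by simp
    qed
    moreover have "ereal s + hit z 0 \<le> ereal t \<longleftrightarrow> hit z 0 \<le> ereal (t - s)"
      by (cases "hit z 0") auto
    ultimately show ?thesis by simp
  qed
  show ?thesis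
  proof (cases "s \<le> t")
    case True
    have "hit z 0 \<le> ereal (t - s) \<longleftrightarrow> (\<exists>h. 0 \<le> h \<and> h \<le> t - s \<and> 0 \<le> z h)"
      using True by (intro hit_le_iff[OF z_cont]) auto
    also have "\<dots> \<longleftrightarrow> (\<exists>r\<ge>s. r \<le> t \<and> 0 \<le> z (r - s))"
      by (metis add.commute add_diff_cancel_left' diff_ge_0_iff_ge diff_right_mono le_diff_eq)
    also have "\<dots> \<longleftrightarrow> (\<exists>r\<ge>s. r \<le> t \<and> (x r - x s \<le> - lo \<or> up \<le> x r - x s))"
      by (auto simp: z_def le_max_iff_disj)
    finally show ?thesis using iff by simp
  next
    case False
    then have "\<not> hit z 0 \<le> ereal (t - s)"
      using hit_nonneg[of z 0] by (metis diff_ge_0_iff_ge ereal_less_eq(5) order_trans)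
    then show ?thesis using iff False by auto
  qed
qed

lemma ct_Suc_finite:
  assumes "ct (Suc n) = ereal t"
  obtains s where "ct n = ereal s" "s < t" "min lo up \<le> \<bar>x t - x s\<bar>"
proof -
  have "ct n \<noteq> \<infinity>"
  proof
    assume "ct n = \<infinity>"
    then have "ct (Suc n) = \<infinity>" by (simp add: top_ereal_def)
    with assms show False by simp
  qed
  then obtain s where s: "ct n = ereal s" using ct_nonneg[of n] by (cases "ct n") auto
  obtain r where r: "s \<le> r" "r \<le> t" "x r - x s \<le> - lo \<or> up \<le> x r - x s"
    using ct_Suc_le_iff[OF s, of t] assms by auto
  have "ct (Suc n) \<le> ereal r" using ct_Suc_le_iff[OF s, of r] r by auto
  then have "r = t" using assms r by auto
  moreover have "s \<noteq> t" using r \<open>r = t\<close> lo_pos up_pos by auto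
  ultimately show thesis using that[OF s] r by auto
qed

lemma ct_mono_Suc: "ct n \<le> ct (Suc n)"
proof (cases "ct (Suc n)")
  case (real t)
  then show ?thesis using ct_Suc_finite[OF real] by fastforce
qed (use ct_nonneg[of "Suc n"] in auto)

lemma ct_mono: "n \<le> k \<Longrightarrow> ct n \<le> ct k"
  by (rule lift_Suc_mono_le[of ct]) (rule ct_mono_Suc)

text \<open>Consecutive communications are separated by a fixed displacement of a uniformly
  continuous path.\<close>

lemma finitely_many_ct: "\<exists>n. ereal t < ct n"
proof (rule ccontr)
  assume "\<not> ?thesis"
  then have le: "ct n \<le> ereal t" for n by (simp add: not_less)
  define f where "f n = real_of_ereal (ct n)" for n
  have f: "ct n = ereal (f n)" for n
    using le[of n] ct_nonneg[of n] by (cases "ct n") (auto simp: f_def)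
  have f_bounds: "0 \<le> f n" "f n \<le> t" for n using le[of n] ct_nonneg[of n] by (auto simp: f)
  have f_step: "f n < f (Suc n)" "min lo up \<le> \<bar>x (f (Suc n)) - x (f n)\<bar>" for n
    using ct_Suc_finite[OF f[of "Suc n"]] f[of n] by (metis ereal.inject)+
  have "incseq f" by (rule incseq_SucI) (simp add: f_step less_imp_le)
  then obtain L where L: "f \<longlonglongrightarrow> L" using incseq_convergent[of f t] f_bounds by metis
  have "0 \<le> L" by (rule tendsto_lowerbound[OF L]) (use f_bounds in auto)
  then have "(\<lambda>n. x (f n)) \<longlonglongrightarrow> x L"
    using f_bounds by (intro continuous_on_tendsto_compose[OF x_cont L]) auto
  then have "(\<lambda>n. \<bar>x (f (Suc n)) - x (f n)\<bar>) \<longlonglongrightarrow> \<bar>x L - x L\<bar>"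
    by (intro tendsto_intros LIMSEQ_Suc)
  then have "min lo up \<le> \<bar>x L - x L\<bar>"
    using f_step(2) by (intro tendsto_lowerbound[of "\<lambda>n. \<bar>x (f (Suc n)) - x (f n)\<bar>"]) auto
  then show False using lo_pos up_pos by simp
qed

lemma comm_count_iff:
  assumes "0 \<le> t"
  shows "comm_count lo up x t = n \<longleftrightarrow> ct n \<le> ereal t \<and> ereal t < ct (Suc n)"
proof -
  obtain N where N: "ereal t < ct N" using finitely_many_ct by blast
  have fin: "finite {n. ct n \<le> ereal t}"
  proof (rule finite_subset[of _ "{..<N}"], intro subsetI)
    fix n assume "n \<in> {n. ct n \<le> ereal t}"
    then have "ct n < ct N" using N by (simp add: le_less_trans)
    then show "n \<in> {..<N}" using ct_mono[of N n] by (metis leD lessThan_iff not_le_imp_less)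
  qed simp
  have ne: "0 \<in> {n. ct n \<le> ereal t}" using assms by simp
  have ge: "ct (comm_count lo up x t) \<le> ereal t"
    using Max_in[OF fin] ne unfolding comm_count_def by blast
  moreover have "ereal t < ct (Suc (comm_count lo up x t))"
  proof (rule ccontr)
    assume "\<not> ?thesis"
    then have "Suc (comm_count lo up x t) \<le> comm_count lo up x t"
      unfolding comm_count_def by (intro Max_ge fin) (simp add: not_less)
    then show False by simp
  qed
  moreover have "n = k" if "ct n \<le> ereal t" "ereal t < ct (Suc n)" "ct k \<le> ereal t" "ereal t < ct (Suc k)" for n k
  proof (rule antisym)
    show "n \<le> k" using ct_mono[of "Suc k" n] that by (metis leD not_less_eq_eq order_trans)
    show "k \<le> n" using ct_mono[of "Suc n" k] that by (metis leD not_less_eq_eq order_trans)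
  qed
  ultimately show ?thesis by blast
qed

lemma last_comm:
  assumes "0 \<le> t"
  shows "0 \<le> last_comm lo up x t" "last_comm lo up x t \<le> t"
    and "ct (comm_count lo up x t) = ereal (last_comm lo up x t)"
    and "\<bar>x (last_comm lo up x t) - x t\<bar> \<le> max up lo"
proof -
  define n where "n = comm_count lo up x t"
  have n: "ct n \<le> ereal t" "ereal t < ct (Suc n)"
    using comm_count_iff[OF assms, of n] by (auto simp: n_def)
  obtain s where s: "ct n = ereal s" using n(1) ct_nonneg[of n] by (cases "ct n") auto
  have eq: "last_comm lo up x t = s" by (simp add: last_comm_def n_def[symmetric] s)
  have s0: "0 \<le> s" "s \<le> t" using s n(1) ct_nonneg[of n] by auto
  then show "0 \<le> last_comm lo up x t" "last_comm lo up x t \<le> t"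
    "ct (comm_count lo up x t) = ereal (last_comm lo up x t)"
    using eq s n_def by auto
  have "\<not> (x t - x s \<le> - lo \<or> up \<le> x t - x s)"
    using ct_Suc_le_iff[OF s, of t] n(2) s0(2) by auto
  then show "\<bar>x (last_comm lo up x t) - x t\<bar> \<le> max up lo" unfolding eq by auto
qed

lemma last_comm_locally_constant:
  assumes t: "0 \<le> t"
  obtains e where "0 < e" "\<And>s. t \<le> s \<Longrightarrow> s < t + e \<Longrightarrow> last_comm lo up x s = last_comm lo up x t"
proof -
  define n where "n = comm_count lo up x t"
  have n: "ct n \<le> ereal t" "ereal t < ct (Suc n)"
    using comm_count_iff[OF t, of n] by (auto simp: n_def)
  obtain r where r: "t < r" "ereal r \<le> ct (Suc n)"
    using n(2) by (metis ereal_dense2 less_ereal.simps(1) less_imp_le)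
  show thesis
  proof (rule that[of "r - t"])
    fix s assume s: "t \<le> s" "s < t + (r - t)"
    have "ct n \<le> ereal s" using n(1) s(1) by (meson ereal_less_eq(3) order_trans)
    moreover have "ereal s < ct (Suc n)" using s(2) r(2) by (intro less_le_trans[OF _ r(2)]) simp
    ultimately have "comm_count lo up x s = n" using comm_count_iff[of s n] s t by auto
    then show "last_comm lo up x s = last_comm lo up x t" by (simp add: last_comm_def n_def)
  qed (use r in auto)
qed

end

context filtered_measure
begin

text \<open>Whether the next communication takes place by time \<open>t\<close> depends on the extreme displacements of the
  path after the previous one, which by induction is a random time known at \<open>t\<close>.\<close>

lemma sampled_adapted:
  fixes x :: "real \<Rightarrow> 'a \<Rightarrow> real"
  assumes x: "\<And>s. 0 \<le> s \<Longrightarrow> x s \<in> borel_measurable (F s)"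
    and cont: "\<And>\<omega>. \<omega> \<in> space M \<Longrightarrow> continuous_on {0..} (\<lambda>s. x s \<omega>)"
    and pos: "0 < lo" "0 < up"
    and t: "0 \<le> t"
  shows "(\<lambda>\<omega>. x (last_comm lo up (\<lambda>s. x s \<omega>) t) \<omega>) \<in> borel_measurable (F t)"
proof -
  have sp: "sensor_path lo up (\<lambda>s. x s \<omega>)" if "\<omega> \<in> space M" for \<omega>
    using pos cont[OF that] by unfold_locales
  let ?ct = "\<lambda>\<omega>. comm_time lo up (\<lambda>s. x s \<omega>)"
  have xF: "x s \<in> borel_measurable (F t)" if "0 \<le> s" "s \<le> t" for s t
    using x[OF that(1)] measurable_F_mono[OF that] by blast
  define \<rho> where "\<rho> t n \<omega> = real_of_ereal (min (ereal t) (?ct \<omega> n))" for t n \<omega>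
  have \<rho>_eq: "ereal (\<rho> t n \<omega>) = min (ereal t) (?ct \<omega> n)" if "\<omega> \<in> space M" for t n \<omega>
    using sensor_path.ct_nonneg[OF sp[OF that], of n] unfolding \<rho>_def
    by (cases "?ct \<omega> n") (auto simp: min_def)
  have \<rho>_bounds: "0 \<le> \<rho> t n \<omega>" "\<rho> t n \<omega> \<le> t" if "\<omega> \<in> space M" "0 \<le> t" for t n \<omega>
  proof -
    have "ereal (\<rho> t n \<omega>) \<le> ereal t" using \<rho>_eq[OF that(1), of t n] by simp
    then show "\<rho> t n \<omega> \<le> t" by simp
    have "0 \<le> ereal (\<rho> t n \<omega>)"
      using \<rho>_eq[OF that(1), of t n] sensor_path.ct_nonneg[OF sp[OF that(1)], of n] that(2) by simp
    then show "0 \<le> \<rho> t n \<omega>" by simp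
  qed
  have \<rho>_meas: "\<rho> t n \<in> borel_measurable (F t)"
    if "0 \<le> t" and le: "\<And>t. 0 \<le> t \<Longrightarrow> {\<omega> \<in> space M. ?ct \<omega> n \<le> ereal t} \<in> sets (F t)" for t n
  proof (rule borel_measurableI_le)
    fix r
    consider "r < 0" | "0 \<le> r" "r < t" | "t \<le> r" by linarith
    then show "{\<omega> \<in> space (F t). \<rho> t n \<omega> \<le> r} \<in> sets (F t)"
    proof cases
      case 1
      then have no: "\<not> \<rho> t n \<omega> \<le> r" if "\<omega> \<in> space M" for \<omega>
        using \<rho>_bounds(1)[OF that \<open>0 \<le> t\<close>, of n] by linarith
      have "{\<omega> \<in> space (F t). \<rho> t n \<omega> \<le> r} = {}" using no that(1) by auto
      then show ?thesis by (simp only: sets.empty_sets)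
    next
      case 2
      have "\<rho> t n \<omega> \<le> r \<longleftrightarrow> ?ct \<omega> n \<le> ereal r" if "\<omega> \<in> space M" for \<omega>
      proof -
        have "\<rho> t n \<omega> \<le> r \<longleftrightarrow> ereal (\<rho> t n \<omega>) \<le> ereal r" by simp
        also have "\<dots> \<longleftrightarrow> ?ct \<omega> n \<le> ereal r"
          unfolding \<rho>_eq[OF that] using 2 by (simp add: min_le_iff_disj)
        finally show ?thesis .
      qed
      then have "{\<omega> \<in> space (F t). \<rho> t n \<omega> \<le> r} = {\<omega> \<in> space M. ?ct \<omega> n \<le> ereal r}"
        using that(1) by auto
      then show ?thesis using le[OF 2(1)] F_mono[of r t] 2 by auto
    next
      case 3
      then have yes: "\<rho> t n \<omega> \<le> r" if "\<omega> \<in> space M" for \<omega>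
        using \<rho>_bounds(2)[OF that \<open>0 \<le> t\<close>, of n] by linarith
      have "{\<omega> \<in> space (F t). \<rho> t n \<omega> \<le> r} = space (F t)" using yes that(1) by auto
      then show ?thesis by (simp only: sets.top)
    qed
  qed
  have le: "{\<omega> \<in> space M. ?ct \<omega> n \<le> ereal t} \<in> sets (F t)" if "0 \<le> t" for n t
    using that
  proof (induction n arbitrary: t)
    case 0
    then have "{\<omega> \<in> space M. ?ct \<omega> 0 \<le> ereal t} = space (F t)" by simp
    then show ?case by (simp only: sets.top)
  next
    case (Suc n)
    note t = Suc.prems
    \<comment> \<open>\<open>w\<close> is the path from the \<open>n\<close>-th communication on, and \<open>z \<le> 0\<close> means that its displacement
      has left the interval of the thresholds.\<close>
    define w where "w s \<omega> = x (max (\<rho> t n \<omega>) (min s t)) \<omega>" for s \<omega>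
    define v where "v \<omega> = x (\<rho> t n \<omega>) \<omega>" for \<omega>
    have \<rho>m: "\<rho> t n \<in> borel_measurable (F t)" by (rule \<rho>_meas[OF t Suc.IH])
    have v_meas: "v \<in> borel_measurable (F t)"
      unfolding v_def
      by (intro measurable_at_random_time[where t = t and x = x and \<rho> = "\<rho> t n"] xF \<rho>m)
        (use cont \<rho>_bounds t in simp_all)
    have w_meas: "w s \<in> borel_measurable (F t)" if "0 \<le> s" for s
    proof -
      have "(\<lambda>\<omega>. max (\<rho> t n \<omega>) (min s t)) \<in> borel_measurable (F t)" using \<rho>m by measurable
      then show ?thesis
        unfolding w_def
        by (intro measurable_at_random_time[where t = t and x = x and \<rho> = "\<lambda>\<omega>. max (\<rho> t n \<omega>) (min s t)"] xF)
          (use cont \<rho>_bounds t that in \<open>simp_all add: le_max_iff_disj\<close>)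
    qed
    have w_cont: "continuous_on {0..} (\<lambda>s. w s \<omega>)" if "\<omega> \<in> space M" for \<omega>
      unfolding w_def using \<rho>_bounds[OF that t, of n]
      by (intro continuous_on_compose2[OF cont[OF that]] continuous_intros) (auto simp: le_max_iff_disj)
    define z where "z s \<omega> = min (w s \<omega> - v \<omega> + lo) (up - (w s \<omega> - v \<omega>))" for s \<omega>
    have z_meas: "z s \<in> borel_measurable (F t)" if "0 \<le> s" for s
      unfolding z_def using w_meas[OF that] v_meas by measurable
    have z_cont: "continuous_on {0..} (\<lambda>s. z s \<omega>)" if "\<omega> \<in> space M" for \<omega>
      unfolding z_def by (intro continuous_intros w_cont[OF that])
    have "(\<lambda>\<omega>. running_min (\<lambda>s. z s \<omega>) t) \<in> borel_measurable (F t)"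
      using z_meas z_cont t by (intro measurable_running_min) auto
    then have ev: "{\<omega> \<in> space (F t). running_min (\<lambda>s. z s \<omega>) t \<le> 0} \<in> sets (F t)" by measurable
    have "?ct \<omega> (Suc n) \<le> ereal t \<longleftrightarrow> ?ct \<omega> n \<le> ereal t \<and> running_min (\<lambda>s. z s \<omega>) t \<le> 0"
      if \<omega>: "\<omega> \<in> space M" for \<omega>
    proof (cases "?ct \<omega> n \<le> ereal t")
      case False
      then show ?thesis using sensor_path.ct_mono_Suc[OF sp[OF \<omega>], of n] by (meson order_trans)
    next
      case True
      then obtain s where s: "?ct \<omega> n = ereal s"
        using sensor_path.ct_nonneg[OF sp[OF \<omega>], of n] by (cases "?ct \<omega> n") auto
      have st: "0 \<le> s" "s \<le> t" using True s sensor_path.ct_nonneg[OF sp[OF \<omega>], of n] by auto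
      have \<rho>s: "\<rho> t n \<omega> = s" using st by (simp add: \<rho>_def s min_def)
      have "?ct \<omega> (Suc n) \<le> ereal t \<longleftrightarrow>
          (\<exists>r\<ge>s. r \<le> t \<and> (x r \<omega> - x s \<omega> \<le> - lo \<or> up \<le> x r \<omega> - x s \<omega>))"
        by (rule sensor_path.ct_Suc_le_iff[OF sp[OF \<omega>] s])
      also have "\<dots> \<longleftrightarrow> (\<exists>r. 0 \<le> r \<and> r \<le> t \<and> z r \<omega> \<le> 0)"
      proof
        assume "\<exists>r\<ge>s. r \<le> t \<and> (x r \<omega> - x s \<omega> \<le> - lo \<or> up \<le> x r \<omega> - x s \<omega>)"
        then obtain r where r: "s \<le> r" "r \<le> t" "x r \<omega> - x s \<omega> \<le> - lo \<or> up \<le> x r \<omega> - x s \<omega>" by auto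
        then have "z r \<omega> \<le> 0" by (auto simp: z_def w_def v_def \<rho>s max_def)
        with r st show "\<exists>r. 0 \<le> r \<and> r \<le> t \<and> z r \<omega> \<le> 0" by (intro exI[of _ r]) auto
      next
        assume "\<exists>r. 0 \<le> r \<and> r \<le> t \<and> z r \<omega> \<le> 0"
        then obtain r where r: "0 \<le> r" "r \<le> t" "z r \<omega> \<le> 0" by auto
        then have "x (max s r) \<omega> - x s \<omega> \<le> - lo \<or> up \<le> x (max s r) \<omega> - x s \<omega>"
          by (auto simp: z_def w_def v_def \<rho>s min_absorb1 min_le_iff_disj)
        then show "\<exists>r\<ge>s. r \<le> t \<and> (x r \<omega> - x s \<omega> \<le> - lo \<or> up \<le> x r \<omega> - x s \<omega>)"
          using r st by (intro exI[of _ "max s r"]) auto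
      qed
      also have "\<dots> \<longleftrightarrow> running_min (\<lambda>s. z s \<omega>) t \<le> 0"
      proof
        assume "\<exists>r. 0 \<le> r \<and> r \<le> t \<and> z r \<omega> \<le> 0"
        then show "running_min (\<lambda>s. z s \<omega>) t \<le> 0"
          using running_min_le[OF z_cont[OF \<omega>], of _ t] by (meson order_trans)
      next
        assume "running_min (\<lambda>s. z s \<omega>) t \<le> 0"
        then show "\<exists>r. 0 \<le> r \<and> r \<le> t \<and> z r \<omega> \<le> 0"
          using running_min_attained[OF z_cont[OF \<omega>] t] by metis
      qed
      finally show ?thesis using True by simp
    qed
    then have "{\<omega> \<in> space M. ?ct \<omega> (Suc n) \<le> ereal t} =
        {\<omega> \<in> space M. ?ct \<omega> n \<le> ereal t} \<inter> {\<omega> \<in> space (F t). running_min (\<lambda>s. z s \<omega>) t \<le> 0}"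
      using t by (auto simp del: comm_time.simps)
    then show ?case using Suc.IH[OF t] ev by (simp only: sets.Int)
  qed
  show ?thesis
  proof -
    let ?c = "\<lambda>\<omega>. comm_count lo up (\<lambda>s. x s \<omega>) t"
    have c_meas: "?c \<in> measurable (F t) (count_space UNIV)"
    proof -
      have "?c -` {n} \<inter> space (F t) \<in> sets (F t)" for n
      proof -
        have "?c -` {n} \<inter> space (F t) =
            {\<omega> \<in> space M. ?ct \<omega> n \<le> ereal t} - {\<omega> \<in> space M. ?ct \<omega> (Suc n) \<le> ereal t}"
        proof (intro set_eqI)
          fix \<omega>
          show "\<omega> \<in> ?c -` {n} \<inter> space (F t) \<longleftrightarrow>
              \<omega> \<in> {\<omega> \<in> space M. ?ct \<omega> n \<le> ereal t} - {\<omega> \<in> space M. ?ct \<omega> (Suc n) \<le> ereal t}"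
          proof (cases "\<omega> \<in> space M")
            case True
            then show ?thesis
              using sensor_path.comm_count_iff[OF sp[OF True] t, of n] t
              by (simp add: not_le del: comm_time.simps)
          qed (use t in simp)
        qed
        then show ?thesis using le[OF t] by (simp only: sets.Diff)
      qed
      then show ?thesis by (simp add: measurable_count_space_eq2_countable)
    qed
    have "(\<lambda>\<omega>. \<rho> t (?c \<omega>) \<omega>) \<in> borel_measurable (F t)"
      by (rule measurable_compose_countable[OF \<rho>_meas[OF t le] c_meas])
    also have "?this \<longleftrightarrow> (\<lambda>\<omega>. last_comm lo up (\<lambda>s. x s \<omega>) t) \<in> borel_measurable (F t)"
    proof (rule measurable_cong)
      fix \<omega> assume "\<omega> \<in> space (F t)"
      then have \<omega>: "\<omega> \<in> space M" using t by simp
      show "\<rho> t (?c \<omega>) \<omega> = last_comm lo up (\<lambda>s. x s \<omega>) t"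
        using sensor_path.last_comm(2,3)[OF sp[OF \<omega>] t] by (simp add: \<rho>_def min_def)
    qed
    finally have "(\<lambda>\<omega>. last_comm lo up (\<lambda>s. x s \<omega>) t) \<in> borel_measurable (F t)" .
    then show ?thesis
      by (intro measurable_at_random_time[where t = t and x = x and \<rho> = "\<lambda>\<omega>. last_comm lo up (\<lambda>s. x s \<omega>) t"] xF)
        (use cont t sensor_path.last_comm(1,2)[OF sp t] in simp_all)
  qed
qed

end

section \<open>Extended expectations\<close>

lemma ext_expectation_real:
  assumes ae: "AE \<omega> in M. X \<omega> = ereal (r \<omega>)" and r: "integrable M r"
  shows "ext_expectation M X = ereal (\<integral>\<omega>. r \<omega> \<partial>M)"
proof -
  have 1: "(\<integral>\<^sup>+\<omega>. e2ennreal (X \<omega>) \<partial>M) = (\<integral>\<^sup>+\<omega>. ennreal (r \<omega>) \<partial>M)"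
    using ae by (intro nn_integral_cong_AE) (auto elim!: eventually_mono)
  have 2: "(\<integral>\<^sup>+\<omega>. e2ennreal (- X \<omega>) \<partial>M) = (\<integral>\<^sup>+\<omega>. ennreal (- r \<omega>) \<partial>M)"
    using ae by (intro nn_integral_cong_AE) (auto elim!: eventually_mono)
  obtain p q where pq: "(\<integral>\<^sup>+\<omega>. ennreal (r \<omega>) \<partial>M) = ennreal p" "0 \<le> p"
    "(\<integral>\<^sup>+\<omega>. ennreal (- r \<omega>) \<partial>M) = ennreal q" "0 \<le> q" "(\<integral>\<omega>. r \<omega> \<partial>M) = p - q"
    using real_lebesgue_integral_def[OF r] real_integrable_def[of M r] r
    by (metis enn2real_nonneg ennreal_enn2real_if infinity_ennreal_def)
  show ?thesis
    unfolding ext_expectation_def 1 2 using pq by (simp add: enn2ereal_ennreal)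
qed

text \<open>Both parts have finite integrals, so that the difference \<open>\<infinity> - \<infinity>\<close> does not occur.\<close>

lemma (in finite_measure_subalgebra) ext_cond_exp_real:
  assumes X[measurable]: "X \<in> borel_measurable M"
    and ae: "AE \<omega> in M. X \<omega> = ereal (r \<omega>)" and r: "integrable M r"
  shows "AE \<omega> in M. ext_cond_exp M F X \<omega> = ereal (real_cond_exp M F r \<omega>)"
    and "ext_cond_exp M F X \<in> borel_measurable M"
proof -
  have [measurable]: "r \<in> borel_measurable M" using r by auto
  have fin: "AE \<omega> in M. nn_cond_exp M F (\<lambda>\<omega>. ennreal (f \<omega>)) \<omega> \<noteq> \<infinity>"
    if f: "integrable M f" for f :: "'a \<Rightarrow> real"
  proof (rule nn_integral_noteq_infinite)
    have "(\<integral>\<^sup>+\<omega>. nn_cond_exp M F (\<lambda>\<omega>. ennreal (f \<omega>)) \<omega> \<partial>M) = (\<integral>\<^sup>+\<omega>. ennreal (f \<omega>) \<partial>M)"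
      using nn_cond_exp_intg[of "\<lambda>_. 1" "\<lambda>\<omega>. ennreal (f \<omega>)"] f by simp
    then show "(\<integral>\<^sup>+\<omega>. nn_cond_exp M F (\<lambda>\<omega>. ennreal (f \<omega>)) \<omega> \<partial>M) \<noteq> \<infinity>"
      using f by (simp add: real_integrable_def)
  qed simp
  have cong1: "AE \<omega> in M. nn_cond_exp M F (\<lambda>\<omega>. e2ennreal (X \<omega>)) \<omega> = nn_cond_exp M F (\<lambda>\<omega>. ennreal (r \<omega>)) \<omega>"
    by (rule nn_cond_exp_cong) (use ae in \<open>auto elim!: eventually_mono\<close>)
  have cong2: "AE \<omega> in M. nn_cond_exp M F (\<lambda>\<omega>. e2ennreal (- X \<omega>)) \<omega> = nn_cond_exp M F (\<lambda>\<omega>. ennreal (- r \<omega>)) \<omega>"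
    by (rule nn_cond_exp_cong) (use ae in \<open>auto elim!: eventually_mono\<close>)
  have r': "integrable M (\<lambda>\<omega>. - r \<omega>)" using r by simp
  show "AE \<omega> in M. ext_cond_exp M F X \<omega> = ereal (real_cond_exp M F r \<omega>)"
    using cong1 cong2 fin[OF r] fin[OF r']
  proof eventually_elim
    case (elim \<omega>)
    then show ?case
      unfolding ext_cond_exp_def real_cond_exp_def
      by (cases "nn_cond_exp M F (\<lambda>\<omega>. ennreal (r \<omega>)) \<omega>"; cases "nn_cond_exp M F (\<lambda>\<omega>. ennreal (- r \<omega>)) \<omega>")
        (auto simp: enn2ereal_ennreal)
  qed
  show "ext_cond_exp M F X \<in> borel_measurable M"
    unfolding ext_cond_exp_def by measurable
qed

lemma (in finite_measure_subalgebra) real_cond_exp_le_if_integrals: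
  assumes r: "integrable M r" and le: "\<And>A. A \<in> sets F \<Longrightarrow> (\<integral>\<omega>. indicator A \<omega> * r \<omega> \<partial>M) \<le> c * measure M A"
  shows "AE \<omega> in M. real_cond_exp M F r \<omega> \<le> c"
proof -
  have [measurable]: "r \<in> borel_measurable M" using r by auto
  define A where "A = {\<omega> \<in> space F. c < real_cond_exp M F r \<omega>}"
  have A_F: "A \<in> sets F" unfolding A_def by measurable
  then have A_M[measurable]: "A \<in> sets M" using subalg by (auto simp: subalgebra_def)
  have [measurable]: "indicator A \<in> borel_measurable F" using A_F by measurable
  have iA: "integrable M (\<lambda>\<omega>. indicator A \<omega> * r \<omega>)"
    using integrable_mult_indicator[OF A_M r] by simp
  have iE: "integrable M (\<lambda>\<omega>. indicator A \<omega> * real_cond_exp M F r \<omega>)"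
    by (rule real_cond_exp_intg(1)[OF iA]) measurable
  have ic: "integrable M (\<lambda>\<omega>. indicator A \<omega> * c)"
    using A_M by (intro integrable_mult_left integrable_real_indicator) (auto simp: emeasure_eq_measure)
  have "(\<integral>\<omega>. indicator A \<omega> * real_cond_exp M F r \<omega> - indicator A \<omega> * c \<partial>M) =
      (\<integral>\<omega>. indicator A \<omega> * r \<omega> \<partial>M) - c * measure M A"
    using iE ic real_cond_exp_intg(2)[OF iA] A_M by simp
  also have "\<dots> \<le> 0" using le[OF A_F] by simp
  finally have int_le: "(\<integral>\<omega>. indicator A \<omega> * real_cond_exp M F r \<omega> - indicator A \<omega> * c \<partial>M) \<le> 0" .
  have nn: "AE \<omega> in M. 0 \<le> indicator A \<omega> * real_cond_exp M F r \<omega> - indicator A \<omega> * c"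
    by (auto simp: indicator_def A_def)
  have "(\<integral>\<omega>. indicator A \<omega> * real_cond_exp M F r \<omega> - indicator A \<omega> * c \<partial>M) = 0"
    using int_le integral_nonneg_AE[OF nn] by simp
  then have "AE \<omega> in M. indicator A \<omega> * real_cond_exp M F r \<omega> - indicator A \<omega> * c = 0"
    using integral_nonneg_eq_0_iff_AE[OF _ nn] iE ic by simp
  then show ?thesis
    using AE_space
  proof eventually_elim
    case (elim \<omega>)
    have "space F = space M" using subalg by (simp add: subalgebra_def)
    with elim show ?case by (auto simp: indicator_def A_def split: if_splits)
  qed
qed

text \<open>The value of the process at infinity matters with probability \<open>0\<close> only. Conditional
  expectations of functions that are not measurable have a default value, however, so that it must
  be measurable.\<close>

lemma measurable_Limsup_at_top:
  fixes X :: "real \<Rightarrow> 'a \<Rightarrow> real"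
  assumes X: "\<And>t. 0 \<le> t \<Longrightarrow> X t \<in> borel_measurable M"
    and cont: "\<And>\<omega>. \<omega> \<in> space M \<Longrightarrow> continuous_on {0..} (\<lambda>t. X t \<omega>)"
  shows "(\<lambda>\<omega>. Limsup at_top (\<lambda>t. ereal (X t \<omega>))) \<in> borel_measurable M"
proof -
  have "(\<lambda>\<omega>. INF n. SUP q\<in>\<rat> \<inter> {real n..}. ereal (X q \<omega>)) \<in> borel_measurable M"
  proof (rule borel_measurable_INF)
    fix n :: nat
    have "countable (\<rat> \<inter> {real n..})" by (rule countable_subset[OF _ countable_rat]) auto
    then show "(\<lambda>\<omega>. SUP q\<in>\<rat> \<inter> {real n..}. ereal (X q \<omega>)) \<in> borel_measurable M"
    proof (rule borel_measurable_SUP)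
      fix q assume "q \<in> \<rat> \<inter> {real n..}"
      then have "0 \<le> q" by (auto intro: order_trans[OF of_nat_0_le_iff])
      then show "(\<lambda>\<omega>. ereal (X q \<omega>)) \<in> borel_measurable M" using X by simp
    qed
  qed simp
  also have "?this \<longleftrightarrow> ?thesis"
  proof (intro measurable_cong antisym)
    fix \<omega> assume \<omega>: "\<omega> \<in> space M"
    show "Limsup at_top (\<lambda>t. ereal (X t \<omega>)) \<le> (INF n. SUP q\<in>\<rat> \<inter> {real n..}. ereal (X q \<omega>))"
    proof (intro INF_greatest Limsup_bounded)
      fix n :: nat
      let ?S = "SUP q\<in>\<rat> \<inter> {real n..}. ereal (X q \<omega>)"
      have "ereal (X t \<omega>) \<le> ?S" if t: "real n \<le> t" for t
      proof (rule ccontr)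
        assume "\<not> ereal (X t \<omega>) \<le> ?S"
        then obtain c where c: "?S < ereal c" "ereal c < ereal (X t \<omega>)"
          using ereal_dense2 by (metis not_le)
        have t0: "0 \<le> t" using t by (auto intro: order_trans[OF of_nat_0_le_iff])
        obtain d where d: "0 < d" "\<And>s. 0 \<le> s \<Longrightarrow> dist s t < d \<Longrightarrow> dist (X s \<omega>) (X t \<omega>) < X t \<omega> - c"
          using cont[OF \<omega>, unfolded continuous_on_iff, rule_format, of t "X t \<omega> - c"] c(2) t0 by auto
        obtain q where q: "q \<in> \<rat>" "t < q" "q < t + d" using Rats_dense_in_real[of t "t + d"] d(1) by auto
        have "c < X q \<omega>" using d(2)[of q] q t0 by (auto simp: dist_real_def)
        moreover have "ereal (X q \<omega>) \<le> ?S" using q t by (intro SUP_upper) auto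
        ultimately show False using c(1) by (metis ereal_less_eq(3) less_imp_le leD order_trans)
      qed
      then show "\<forall>\<^sub>F t in at_top. ereal (X t \<omega>) \<le> ?S"
        by (auto simp: eventually_at_top_linorder)
    qed
    show "(INF n. SUP q\<in>\<rat> \<inter> {real n..}. ereal (X q \<omega>)) \<le> Limsup at_top (\<lambda>t. ereal (X t \<omega>))"
      unfolding Limsup_def
    proof (rule INF_greatest)
      fix P assume "P \<in> {P. eventually P (at_top :: real filter)}"
      then obtain N where N: "\<And>t. N \<le> t \<Longrightarrow> P t" by (auto simp: eventually_at_top_linorder)
      obtain n :: nat where "N \<le> real n" using real_arch_simple by blast
      then have "\<rat> \<inter> {real n..} \<subseteq> {x. P x}" using N by auto
      then show "(INF n. SUP q\<in>\<rat> \<inter> {real n..}. ereal (X q \<omega>)) \<le> (SUP x\<in>{x. P x}. ereal (X x \<omega>))"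
        by (intro INF_lower2[of n] SUP_subset_mono) auto
    qed
  qed
  finally show ?thesis .
qed

section \<open>The observation model\<close>

lemma obs_gens_subset:
  "(\<Union>k\<in>I. \<Union>s\<in>T. {\<xi> k s -` B \<inter> \<Omega> | B. B \<in> sets borel}) \<subseteq> Pow \<Omega>"
  by auto

lemma sets_obs_sigma:
  "sets (obs_sigma \<Omega> \<xi> I T) = sigma_sets \<Omega> (\<Union>k\<in>I. \<Union>s\<in>T. {\<xi> k s -` B \<inter> \<Omega> | B. B \<in> sets borel})"
  unfolding obs_sigma_def by (rule sets_measure_of[OF obs_gens_subset])

lemma space_obs_sigma: "space (obs_sigma \<Omega> \<xi> I T) = \<Omega>"
  unfolding obs_sigma_def by (rule space_measure_of[OF obs_gens_subset])

lemma obs_sigma_mono: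
  assumes "I \<subseteq> J" "S \<subseteq> T"
  shows "sets (obs_sigma \<Omega> \<xi> I S) \<subseteq> sets (obs_sigma \<Omega> \<xi> J T)"
  unfolding sets_obs_sigma by (rule sigma_sets_mono') (use assms in blast)

lemma history_gens_subset: "(\<Inter>s\<in>{t<..}. sets (obs_sigma \<Omega> \<xi> I {0..s})) \<subseteq> Pow \<Omega>"
proof -
  have "(\<Inter>s\<in>{t<..}. sets (obs_sigma \<Omega> \<xi> I {0..s})) \<subseteq> sets (obs_sigma \<Omega> \<xi> I {0..t + 1})"
    by (rule INT_lower) simp
  also have "\<dots> \<subseteq> Pow \<Omega>" using sets.space_closed[of "obs_sigma \<Omega> \<xi> I {0..t + 1}"] by (simp add: space_obs_sigma)
  finally show ?thesis .
qed

lemma sets_history: "sets (history \<Omega> \<xi> I t) = sigma_sets \<Omega> (\<Inter>s\<in>{t<..}. sets (obs_sigma \<Omega> \<xi> I {0..s}))"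
  unfolding history_def by (rule sets_measure_of[OF history_gens_subset])

lemma space_history: "space (history \<Omega> \<xi> I t) = \<Omega>"
  unfolding history_def by (rule space_measure_of[OF history_gens_subset])

lemma history_mono:
  assumes "I \<subseteq> J" "s \<le> t"
  shows "sets (history \<Omega> \<xi> I s) \<subseteq> sets (history \<Omega> \<xi> J t)"
  unfolding sets_history
proof (rule sigma_sets_mono', rule INT_greatest)
  fix r assume "r \<in> {t<..}"
  then have "(\<Inter>s\<in>{s<..}. sets (obs_sigma \<Omega> \<xi> I {0..s})) \<subseteq> sets (obs_sigma \<Omega> \<xi> I {0..r})"
    using assms(2) by (intro INT_lower) auto
  also have "\<dots> \<subseteq> sets (obs_sigma \<Omega> \<xi> J {0..r})" by (rule obs_sigma_mono[OF assms(1) order_refl])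
  finally show "(\<Inter>s\<in>{s<..}. sets (obs_sigma \<Omega> \<xi> I {0..s})) \<subseteq> sets (obs_sigma \<Omega> \<xi> J {0..r})" .
qed

lemma history_subset: "sets (history \<Omega> \<xi> I t) \<subseteq> sets (obs_sigma \<Omega> \<xi> I {0..})"
proof -
  have "(\<Inter>s\<in>{t<..}. sets (obs_sigma \<Omega> \<xi> I {0..s})) \<subseteq> sets (obs_sigma \<Omega> \<xi> I {0..t + 1})"
    by (rule INT_lower) simp
  also have "\<dots> \<subseteq> sets (obs_sigma \<Omega> \<xi> I {0..})" by (rule obs_sigma_mono) auto
  finally have "sigma_sets (space (obs_sigma \<Omega> \<xi> I {0..})) (\<Inter>s\<in>{t<..}. sets (obs_sigma \<Omega> \<xi> I {0..s}))
      \<subseteq> sets (obs_sigma \<Omega> \<xi> I {0..})"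
    by (rule sets.sigma_sets_subset)
  then show ?thesis by (simp add: sets_history space_obs_sigma)
qed

lemma set_integral_eq_nn_integral:
  fixes f :: "'a \<Rightarrow> real"
  assumes "A \<in> sets M" "f \<in> borel_measurable M" "\<And>x. 0 \<le> f x"
  shows "(\<integral>x\<in>A. f x \<partial>M) = enn2real (\<integral>\<^sup>+x. ennreal (f x) * indicator A x \<partial>M)"
proof -
  have "(\<integral>x\<in>A. f x \<partial>M) = (\<integral>x. indicator A x * f x \<partial>M)"
    by (simp add: set_lebesgue_integral_def)
  also have "\<dots> = enn2real (\<integral>\<^sup>+x. ennreal (indicator A x * f x) \<partial>M)"
    using assms by (intro integral_eq_nn_integral) auto
  also have "(\<integral>\<^sup>+x. ennreal (indicator A x * f x) \<partial>M) = (\<integral>\<^sup>+x. ennreal (f x) * indicator A x \<partial>M)"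
    by (intro nn_integral_cong) (auto simp: indicator_def)
  finally show ?thesis .
qed

context change_model
begin

abbreviation U :: "real \<Rightarrow> 'a \<Rightarrow> real" where
  "U \<equiv> total_llr K u"

abbreviation F :: "real \<Rightarrow> 'a measure" where
  "F \<equiv> history \<Omega> \<xi> {1..K}"

lemma filtered:
  assumes "space N = \<Omega>" "sets N = sets (obs_sigma \<Omega> \<xi> {1..K} {0..})"
  shows "filtered_measure N F"
proof
  show "subalgebra N (F t)" for t
    using assms history_subset[of \<Omega> \<xi> "{1..K}" t] by (simp add: subalgebra_def space_history)
  show "sets (F s) \<subseteq> sets (F t)" if "s \<le> t" for s t
    by (rule history_mono[OF order_refl that])
qed

lemmas filtered_Pinf = filtered[OF space_Pinf sets_Pinf]
lemmas filtered_P = filtered[OF space_P sets_P]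

lemma sensor_adapted:
  assumes "k \<in> {1..K}" "0 \<le> t"
  shows "u k t \<in> borel_measurable (F t)"
proof -
  have "sets (history \<Omega> \<xi> {k} t) \<subseteq> sets (F t)" using assms(1) by (intro history_mono) auto
  then show ?thesis
    using u_adapted[OF assms] by (auto simp: measurable_def space_history)
qed

lemma U_adapted: "0 \<le> t \<Longrightarrow> U t \<in> borel_measurable (F t)"
  unfolding total_llr_def[abs_def] by (intro borel_measurable_sum sensor_adapted)

lemma U_cont: "\<omega> \<in> \<Omega> \<Longrightarrow> continuous_on {0..} (\<lambda>t. U t \<omega>)"
  unfolding total_llr_def by (intro continuous_on_sum u_continuous)

lemma nn_integral_P:
  assumes "0 \<le> \<tau>" "\<tau> \<le> t" and f: "f \<in> borel_measurable (F t)"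
  shows "(\<integral>\<^sup>+\<omega>. f \<omega> \<partial>P \<tau>) = (\<integral>\<^sup>+\<omega>. ennreal (exp (U t \<omega> - U \<tau> \<omega>)) * f \<omega> \<partial>Pinf)"
proof -
  interpret Pt: filtered_measure "P \<tau>" F by (rule filtered_P[OF assms(1) assms(1)])
  interpret Pi: filtered_measure Pinf F by (rule filtered_Pinf)
  have t: "0 \<le> t" using assms by auto
  have [measurable]: "U t \<in> borel_measurable (F t)" "U \<tau> \<in> borel_measurable (F t)"
    using U_adapted[OF t] Pi.measurable_F_mono[OF assms(1,2) U_adapted[OF assms(1)]] by auto
  have g: "(\<lambda>\<omega>. ennreal (exp (U t \<omega> - U \<tau> \<omega>))) \<in> borel_measurable (F t)" by measurable
  have "(\<integral>\<^sup>+\<omega>. f \<omega> \<partial>P \<tau>) = (\<integral>\<^sup>+\<omega>. f \<omega> \<partial>restr_to_subalg (P \<tau>) (F t))"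
    by (rule nn_integral_subalgebra2[OF Pt.subalg[OF t] f, symmetric])
  also have "\<dots> = (\<integral>\<^sup>+\<omega>. ennreal (exp (U t \<omega> - U \<tau> \<omega>)) * f \<omega> \<partial>restr_to_subalg Pinf (F t))"
    unfolding P_after_change[OF assms(1,2)]
    by (intro nn_integral_density measurable_in_subalg Pi.subalg t f g)
  also have "\<dots> = (\<integral>\<^sup>+\<omega>. ennreal (exp (U t \<omega> - U \<tau> \<omega>)) * f \<omega> \<partial>Pinf)"
    by (rule nn_integral_subalgebra2[OF Pi.subalg[OF t]]) (use f in measurable)
  finally show ?thesis .
qed

text \<open>If the exponential is, on each \<open>F t\<close>, the density of one and the same law \<open>Q\<close>, then its integral
  over an event does not change with time.\<close>

lemma exp_martingaleI:
  assumes N: "prob_space N" "space N = \<Omega>" "sets N = sets (obs_sigma \<Omega> \<xi> {1..K} {0..})"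
    and Q: "prob_space Q" and a: "0 \<le> a"
    and int: "\<And>t A. a \<le> t \<Longrightarrow> A \<in> sets (F t) \<Longrightarrow>
      (\<integral>\<^sup>+\<omega>. ennreal (exp (\<theta> * (U t \<omega> - U a \<omega>))) * indicator A \<omega> \<partial>N) = emeasure Q A"
  shows "exp_martingale N F U \<theta> a"
proof -
  interpret filtered_measure N F by (rule filtered[OF N(2,3)])
  interpret prob_space N by (rule N(1))
  have meas: "(\<lambda>\<omega>. exp (\<theta> * (U t \<omega> - U a \<omega>))) \<in> borel_measurable N" if "a \<le> t" for t
  proof -
    have t: "0 \<le> t" using that a by simp
    note [measurable] = measurable_F_M[OF t U_adapted[OF t]] measurable_F_M[OF a U_adapted[OF a]]
    show ?thesis by measurable
  qed
  show ?thesis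
  proof
    show "0 \<le> a" by (rule a)
    show "U t \<in> borel_measurable (F t)" if "0 \<le> t" for t by (rule U_adapted[OF that])
    show "continuous_on {0..} (\<lambda>t. U t \<omega>)" if "\<omega> \<in> space N" for \<omega>
      using U_cont that N(2) by simp
    show "integrable N (\<lambda>\<omega>. exp (\<theta> * (U t \<omega> - U a \<omega>)))" if t: "a \<le> t" for t
    proof (rule integrableI_nonneg[OF meas[OF t]])
      have "(\<integral>\<^sup>+\<omega>. ennreal (exp (\<theta> * (U t \<omega> - U a \<omega>))) \<partial>N) =
          (\<integral>\<^sup>+\<omega>. ennreal (exp (\<theta> * (U t \<omega> - U a \<omega>))) * indicator (space (F t)) \<omega> \<partial>N)"
        by (intro nn_integral_cong) (simp add: space_history N(2))
      also have "\<dots> = emeasure Q (space (F t))" by (rule int[OF t sets.top])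
      also have "\<dots> < \<infinity>"
        using prob_space.emeasure_le_1[OF Q] by (rule le_less_trans) simp
      finally show "(\<integral>\<^sup>+\<omega>. ennreal (exp (\<theta> * (U t \<omega> - U a \<omega>))) \<partial>N) < \<infinity>" .
    qed simp
    show "(\<integral>\<omega>\<in>A. exp (\<theta> * (U t \<omega> - U a \<omega>)) \<partial>N) = (\<integral>\<omega>\<in>A. exp (\<theta> * (U s \<omega> - U a \<omega>)) \<partial>N)"
      if "a \<le> s" "s \<le> t" "A \<in> sets (F s)" for s t A
    proof -
      have s: "0 \<le> s" and t: "a \<le> t" using that a by auto
      have At: "A \<in> sets (F t)" using that F_mono[OF s that(2)] by auto
      have AM: "A \<in> sets N" using sets_F_M[OF s that(3)] .
      show ?thesis
        using set_integral_eq_nn_integral[OF AM meas[OF t]] set_integral_eq_nn_integral[OF AM meas[OF that(1)]]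
          int[OF t At] int[OF that(1,3)] by simp
    qed
  qed
qed

text \<open>\<open>exp U\<close> is the density of \<open>P 0\<close>.\<close>

lemma exp_martingale_Pinf: "exp_martingale Pinf F U 1 0"
proof (rule exp_martingaleI[OF prob_Pinf space_Pinf sets_Pinf prob_P[OF order_refl] order_refl])
  fix t :: real and A assume tA: "0 \<le> t" "A \<in> sets (F t)"
  have "A \<in> sets (P 0)" using filtered_measure.sets_F_M[OF filtered_P tA] by simp
  then show "(\<integral>\<^sup>+\<omega>. ennreal (exp (1 * (U t \<omega> - U 0 \<omega>))) * indicator A \<omega> \<partial>Pinf) = emeasure (P 0) A"
    using nn_integral_P[of 0 t "indicator A"] tA by simp
qed

text \<open>The reciprocal likelihood ratio turns \<open>P \<tau>\<close> back into \<open>Pinf\<close>.\<close>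

lemma exp_martingale_P:
  assumes \<tau>: "0 \<le> \<tau>"
  shows "exp_martingale (P \<tau>) F U (- 1) \<tau>"
proof (rule exp_martingaleI[OF prob_P space_P sets_P prob_Pinf])
  interpret Pi: filtered_measure Pinf F by (rule filtered_Pinf)
  fix t :: real and A assume t: "\<tau> \<le> t" and A: "A \<in> sets (F t)"
  have t0: "0 \<le> t" using \<tau> t by simp
  have [measurable]: "U t \<in> borel_measurable (F t)" "U \<tau> \<in> borel_measurable (F t)"
    using U_adapted[OF t0] Pi.measurable_F_mono[OF \<tau> t U_adapted[OF \<tau>]] by auto
  note [measurable] = A
  have "(\<integral>\<^sup>+\<omega>. ennreal (exp (- 1 * (U t \<omega> - U \<tau> \<omega>))) * indicator A \<omega> \<partial>P \<tau>) =
      (\<integral>\<^sup>+\<omega>. ennreal (exp (U t \<omega> - U \<tau> \<omega>)) * (ennreal (exp (- 1 * (U t \<omega> - U \<tau> \<omega>))) * indicator A \<omega>) \<partial>Pinf)"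
    by (rule nn_integral_P[OF \<tau> t]) measurable
  also have "\<dots> = (\<integral>\<^sup>+\<omega>. indicator A \<omega> \<partial>Pinf)"
    by (intro nn_integral_cong)
      (simp add: mult.assoc[symmetric] ennreal_mult'[symmetric] exp_add[symmetric])
  also have "\<dots> = emeasure Pinf A" using Pi.sets_F_M[OF t0 A] by simp
  finally show "(\<integral>\<^sup>+\<omega>. ennreal (exp (- 1 * (U t \<omega> - U \<tau> \<omega>))) * indicator A \<omega> \<partial>P \<tau>) = emeasure Pinf A" .
qed (rule \<tau>)+

end

section \<open>Rules that keep the CUSUM statistic bounded\<close>

text \<open>The information \<open>- U\<close> without change, and \<open>U\<close> with a change at \<open>0\<close>, that a CUSUM rule with
  threshold \<open>v\<close> accumulates on average until its alarm.\<close>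

definition pre_info :: "real \<Rightarrow> real" where
  "pre_info v = exp v - v - 1"

definition post_info :: "real \<Rightarrow> real" where
  "post_info v = v + exp (- v) - 1"

lemma pre_info_strict_mono:
  assumes "0 \<le> a" "a < b"
  shows "pre_info a < pre_info b"
proof -
  have "((\<lambda>v. exp v - v) has_real_derivative exp v - 1) (at v)" for v :: real
    by (auto intro!: derivative_eq_intros)
  then obtain z where "a < z" "z < b" "(exp b - b) - (exp a - a) = (b - a) * (exp z - 1)"
    using MVT2[OF assms(2), of "\<lambda>v. exp v - v" "\<lambda>v. exp v - 1"] by metis
  moreover have "0 < (b - a) * (exp z - 1)" using assms \<open>a < z\<close> by (intro mult_pos_pos) auto
  ultimately show ?thesis unfolding pre_info_def by linarith
qed

lemma post_info_mono:
  assumes "0 \<le> a" "a \<le> b"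
  shows "post_info a \<le> post_info b"
proof -
  have "exp (- a) - exp (- b) = exp (- a) * (1 - exp (- (b - a)))"
    by (simp add: right_diff_distrib exp_add[symmetric])
  also have "\<dots> \<le> 1 * (1 - exp (- (b - a)))" using assms by (intro mult_right_mono) auto
  also have "\<dots> \<le> b - a" using exp_ge_add_one_self[of "- (b - a)"] by (simp add: algebra_simps)
  finally show ?thesis by (simp add: post_info_def)
qed

lemma post_info_0: "post_info 0 = 0"
  by (simp add: post_info_def)

lemma post_info_nonneg: "0 \<le> v \<Longrightarrow> 0 \<le> post_info v"
  using post_info_mono[of 0 v] post_info_0 by simp

context change_model
begin

definition Y :: "real \<Rightarrow> 'a \<Rightarrow> real" where
  "Y t \<omega> = U t \<omega> - running_min (\<lambda>s. U s \<omega>) t"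

end

text \<open>The centralized rule is an instance with its threshold as \<open>\<eta>\<close>. For the decentralized one, \<open>\<eta>\<close>
  exceeds the threshold by the largest possible difference of the two statistics.\<close>

locale bounded_rule = change_model +
  fixes T :: "'a \<Rightarrow> ereal" and \<eta> :: real
  assumes T_stopping: "\<And>r. 0 \<le> r \<Longrightarrow> {\<omega> \<in> \<Omega>. T \<omega> < ereal r} \<in> sets (history \<Omega> \<xi> {1..K} r)"
    and T_nonneg: "\<And>\<omega>. \<omega> \<in> \<Omega> \<Longrightarrow> 0 \<le> T \<omega>"
    and Y_le: "\<And>\<omega> s. \<omega> \<in> \<Omega> \<Longrightarrow> 0 \<le> s \<Longrightarrow> ereal s \<le> T \<omega> \<Longrightarrow> Y s \<omega> \<le> \<eta>"
begin

definition T\<^sub>r :: "'a \<Rightarrow> real" where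
  "T\<^sub>r \<omega> = real_of_ereal (T \<omega>)"

definition Y_stop :: "'a \<Rightarrow> real" where
  "Y_stop \<omega> = Y (T\<^sub>r \<omega>) \<omega>"

lemma T\<^sub>r_nonneg: "\<omega> \<in> \<Omega> \<Longrightarrow> 0 \<le> T\<^sub>r \<omega>"
  using T_nonneg by (simp add: T\<^sub>r_def real_of_ereal_pos)

lemma T\<^sub>r_le: "\<omega> \<in> \<Omega> \<Longrightarrow> ereal (T\<^sub>r \<omega>) \<le> T \<omega>"
  using T_nonneg[of \<omega>] by (cases "T \<omega>") (auto simp: T\<^sub>r_def)

lemma Y_stop_le: "\<omega> \<in> \<Omega> \<Longrightarrow> Y_stop \<omega> \<le> \<eta>"
  unfolding Y_stop_def by (rule Y_le[OF _ T\<^sub>r_nonneg T\<^sub>r_le])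

lemma Y_nonneg: "\<omega> \<in> \<Omega> \<Longrightarrow> 0 \<le> t \<Longrightarrow> 0 \<le> Y t \<omega>"
  unfolding Y_def using running_min_le[OF U_cont, of \<omega> t t] by simp

lemma Y_stop_nonneg: "\<omega> \<in> \<Omega> \<Longrightarrow> 0 \<le> Y_stop \<omega>"
  unfolding Y_stop_def by (intro Y_nonneg T\<^sub>r_nonneg)

lemma stopping_Pinf: "filtered_measure.stopping Pinf F T"
  unfolding filtered_measure.stopping_def[OF filtered_Pinf] space_Pinf using T_stopping by blast

lemma stopping_P: "0 \<le> \<tau> \<Longrightarrow> filtered_measure.stopping (P \<tau>) F T"
  unfolding filtered_measure.stopping_def[OF filtered_P] space_P using T_stopping by blast

lemma Pinf_finite: "AE \<omega> in Pinf. T \<omega> < \<infinity>"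
proof -
  interpret exp_martingale Pinf F U 1 0 by (rule exp_martingale_Pinf)
  have U0: "U 0 \<omega> = 0" if "\<omega> \<in> space Pinf" for \<omega> using u_0 that space_Pinf by simp
  show ?thesis
  proof (rule stopping_finite[OF refl U0 refl _ stopping_Pinf])
    show "AE \<omega> in Pinf. exit_time c \<omega> < \<infinity>" if "0 < c" for c
      using exit_finite[OF refl U0 that _ qv_Pinf qv_diverges_Pinf] by simp
    show "y s \<omega> \<le> \<eta>" if "\<omega> \<in> space Pinf" "0 \<le> s" "ereal s \<le> T \<omega>" for s \<omega>
      using Y_le[of \<omega> s] that by (simp add: space_Pinf y_def m_def Y_def)
  qed (simp_all add: space_Pinf T_nonneg)
qed

lemma U_increment_le:
  assumes \<omega>: "\<omega> \<in> \<Omega>" and st: "0 \<le> s" "s \<le> t" and T: "ereal t \<le> T \<omega>"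
  shows "U t \<omega> - U s \<omega> \<le> \<eta>"
proof -
  have "running_min (\<lambda>s. U s \<omega>) t \<le> U s \<omega>" by (rule running_min_le[OF U_cont[OF \<omega>] st])
  moreover have "Y t \<omega> \<le> \<eta>" using Y_le[OF \<omega> _ T] st by simp
  ultimately show ?thesis by (simp add: Y_def)
qed

text \<open>On \<open>t \<le> T\<close> the likelihood ratio since the change is at most \<open>exp \<eta>\<close>, so that the probability of
  this event is at most \<open>exp \<eta>\<close> times the one without change.\<close>

lemma P_finite:
  assumes \<tau>: "0 \<le> \<tau>"
  shows "AE \<omega> in P \<tau>. T \<omega> < \<infinity>"
proof -
  interpret Pt: filtered_measure "P \<tau>" F by (rule filtered_P[OF \<tau> \<tau>])
  interpret Pi: filtered_measure Pinf F by (rule filtered_Pinf)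
  interpret PT: prob_space "P \<tau>" by (rule prob_P[OF \<tau>])
  interpret PI: prob_space Pinf by (rule prob_Pinf)
  have TI: "T \<in> borel_measurable Pinf"
    by (rule Pi.stopping_borel[OF stopping_Pinf]) (simp add: space_Pinf T_nonneg)
  have TT[measurable]: "T \<in> borel_measurable (P \<tau>)"
    by (rule Pt.stopping_borel[OF stopping_P[OF \<tau>]]) (simp add: space_P[OF \<tau>] T_nonneg)
  note [measurable] = TI
  define B where "B = {\<omega> \<in> \<Omega>. T \<omega> = \<infinity>}"
  have BI: "B \<in> sets Pinf" unfolding B_def space_Pinf[symmetric] by measurable
  then have BT: "B \<in> sets (P \<tau>)" by (simp add: sets_P[OF \<tau>] sets_Pinf)
  define G where "G n = {\<omega> \<in> \<Omega>. ereal (\<tau> + real n) \<le> T \<omega>}" for n :: nat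
  have G_F: "G n \<in> sets (F (\<tau> + real n))" for n
    using Pi.stopping_le_in[OF stopping_Pinf, of "\<tau> + real n"] \<tau> by (simp add: G_def space_Pinf)
  have GI: "G n \<in> sets Pinf" for n using Pi.sets_F_M[OF _ G_F] \<tau> by simp
  have le: "emeasure (P \<tau>) B \<le> ennreal (exp \<eta>) * emeasure Pinf (G n)" for n
  proof -
    have GT: "G n \<in> sets (P \<tau>)" using Pt.sets_F_M[OF _ G_F] \<tau> by simp
    have "emeasure (P \<tau>) B \<le> emeasure (P \<tau>) (G n)"
      by (rule emeasure_mono[OF _ GT]) (auto simp: B_def G_def)
    also have "\<dots> = (\<integral>\<^sup>+\<omega>. indicator (G n) \<omega> \<partial>P \<tau>)" using GT by simp
    also have "\<dots> = (\<integral>\<^sup>+\<omega>. ennreal (exp (U (\<tau> + real n) \<omega> - U \<tau> \<omega>)) * indicator (G n) \<omega> \<partial>Pinf)"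
      using G_F by (intro nn_integral_P[OF \<tau>]) auto
    also have "\<dots> \<le> (\<integral>\<^sup>+\<omega>. ennreal (exp \<eta>) * indicator (G n) \<omega> \<partial>Pinf)"
    proof (rule nn_integral_mono)
      fix \<omega> assume "\<omega> \<in> space Pinf"
      then have "U (\<tau> + real n) \<omega> - U \<tau> \<omega> \<le> \<eta>" if "\<omega> \<in> G n"
        using that \<tau> by (intro U_increment_le) (auto simp: G_def)
      then show "ennreal (exp (U (\<tau> + real n) \<omega> - U \<tau> \<omega>)) * indicator (G n) \<omega> \<le> ennreal (exp \<eta>) * indicator (G n) \<omega>"
        by (auto simp: indicator_def intro: ennreal_leI)
    qed
    also have "\<dots> = ennreal (exp \<eta>) * emeasure Pinf (G n)" using GI by (simp add: nn_integral_cmult_indicator)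
    finally show ?thesis .
  qed
  have "(\<lambda>n. measure Pinf (G n)) \<longlonglongrightarrow> measure Pinf (\<Inter>n. G n)"
    using GI by (intro PI.finite_Lim_measure_decseq) (auto simp: decseq_def G_def intro: order_trans[rotated])
  moreover have "(\<Inter>n. G n) = B"
  proof (intro set_eqI iffI)
    fix \<omega> assume *: "\<omega> \<in> (\<Inter>n. G n)"
    have "T \<omega> = \<infinity>"
    proof (rule ereal_top)
      fix r
      obtain n :: nat where "r \<le> real n" using real_arch_simple by blast
      then have "ereal r \<le> ereal (\<tau> + real n)" using \<tau> by simp
      also have "\<dots> \<le> T \<omega>" using * by (auto simp: G_def)
      finally show "ereal r \<le> T \<omega>" .
    qed
    with * show "\<omega> \<in> B" by (auto simp: B_def G_def)
  qed (auto simp: B_def G_def)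
  moreover have "measure Pinf B = 0"
  proof -
    have "AE \<omega> in Pinf. \<omega> \<notin> B" using Pinf_finite by eventually_elim (simp add: B_def)
    then show ?thesis using PI.prob_eq_0[OF BI] by simp
  qed
  ultimately have lim: "(\<lambda>n. exp \<eta> * measure Pinf (G n)) \<longlonglongrightarrow> exp \<eta> * 0"
    by (intro tendsto_intros) simp
  have "measure (P \<tau>) B \<le> exp \<eta> * measure Pinf (G n)" for n
    using le[of n] by (simp add: PT.emeasure_eq_measure PI.emeasure_eq_measure ennreal_mult'[symmetric])
  then have "measure (P \<tau>) B \<le> exp \<eta> * 0" by (intro tendsto_lowerbound[OF lim]) auto
  then have "measure (P \<tau>) B = 0" by (simp add: measure_le_0_iff)
  then have "AE \<omega> in P \<tau>. \<omega> \<notin> B" using PT.prob_eq_0[OF BT] by simp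
  then show ?thesis using AE_space by eventually_elim (auto simp: B_def space_P[OF \<tau>])
qed

lemma U_at_T\<^sub>r: "\<omega> \<in> \<Omega> \<Longrightarrow> T \<omega> < \<infinity> \<Longrightarrow> stopped_at U T \<omega> = ereal (U (T\<^sub>r \<omega>) \<omega>)"
  by (auto simp: stopped_at_def T\<^sub>r_def)

text \<open>The identity with \<open>\<theta> = 1\<close>, combined with \<open>- U = - m - y\<close>.\<close>

lemma expected_neg_information:
  shows "integrable Pinf (\<lambda>\<omega>. pre_info (Y_stop \<omega>))"
    and "ext_expectation Pinf (\<lambda>\<omega>. - stopped_at U T \<omega>) =
      ereal (\<integral>\<omega>. pre_info (Y_stop \<omega>) \<partial>Pinf)"
proof -
  interpret exp_martingale Pinf F U 1 0 by (rule exp_martingale_Pinf)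
  have y_Y: "y t \<omega> = Y t \<omega>" for t \<omega> by (simp add: y_def m_def Y_def)
  have sp: "space Pinf \<in> sets (F 0)" using sets.top[of "F 0"] by (simp add: space_history space_Pinf)
  have ay: "integrable Pinf (\<lambda>\<omega>. indicator (space Pinf) \<omega> * (m 0 \<omega> - m (T\<^sub>r \<omega>) \<omega>))"
    "integrable Pinf (\<lambda>\<omega>. indicator (space Pinf) \<omega> * (exp (1 * Y_stop \<omega>) - exp (1 * Y 0 \<omega>)))"
    "1 * (\<integral>\<omega>. indicator (space Pinf) \<omega> * (m 0 \<omega> - m (T\<^sub>r \<omega>) \<omega>) \<partial>Pinf) =
      (\<integral>\<omega>. indicator (space Pinf) \<omega> * (exp (1 * Y_stop \<omega>) - exp (1 * Y 0 \<omega>)) \<partial>Pinf)"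
    using azema_yor[of T "space Pinf" \<eta>, OF _ stopping_Pinf _ sp _ _ Pinf_finite]
      T_nonneg Y_le unfolding y_Y T\<^sub>r_def[symmetric] Y_stop_def space_Pinf by (auto simp: zero_ereal_def[symmetric])
  have U0: "U 0 \<omega> = 0" "m 0 \<omega> = 0" "Y 0 \<omega> = 0" if "\<omega> \<in> space Pinf" for \<omega>
    using u_0 that space_Pinf by (simp_all add: m_def Y_def running_min_def)
  have Tr_meas: "T\<^sub>r \<in> borel_measurable Pinf"
    unfolding T\<^sub>r_def using T_nonneg by (intro borel_measurable_real_of_ereal stopping_borel[OF stopping_Pinf]) (simp add: space_Pinf)
  have [measurable]: "(\<lambda>\<omega>. y (T\<^sub>r \<omega>) \<omega>) \<in> borel_measurable Pinf"
    by (rule measurable_at_unbounded_random_time[where x = y, OF y_measurable y_cont Tr_meas]) (simp_all add: space_Pinf T\<^sub>r_nonneg)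
  have Y_int: "integrable Pinf (\<lambda>\<omega>. Y_stop \<omega>)"
  proof (rule integrable_const_bound[where B = \<eta>])
    show "AE \<omega> in Pinf. norm (Y_stop \<omega>) \<le> \<eta>"
      using Y_stop_le Y_stop_nonneg by (intro AE_I2) (simp add: space_Pinf)
  qed (simp add: Y_stop_def y_Y[symmetric])
  have m_int: "integrable Pinf (\<lambda>\<omega>. - m (T\<^sub>r \<omega>) \<omega>)"
    by (rule Bochner_Integration.integrable_cong[THEN iffD1, OF refl _ ay(1)]) (simp add: U0)
  have e_int: "integrable Pinf (\<lambda>\<omega>. exp (Y_stop \<omega>) - 1)"
    by (rule Bochner_Integration.integrable_cong[THEN iffD1, OF refl _ ay(2)]) (simp add: U0)
  have eq: "(\<integral>\<omega>. - m (T\<^sub>r \<omega>) \<omega> \<partial>Pinf) = (\<integral>\<omega>. exp (Y_stop \<omega>) - 1 \<partial>Pinf)"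
  proof -
    have "(\<integral>\<omega>. - m (T\<^sub>r \<omega>) \<omega> \<partial>Pinf) = (\<integral>\<omega>. indicator (space Pinf) \<omega> * (m 0 \<omega> - m (T\<^sub>r \<omega>) \<omega>) \<partial>Pinf)"
      by (intro Bochner_Integration.integral_cong) (simp_all add: U0)
    also have "\<dots> = (\<integral>\<omega>. indicator (space Pinf) \<omega> * (exp (1 * Y_stop \<omega>) - exp (1 * Y 0 \<omega>)) \<partial>Pinf)"
      using ay(3) by simp
    also have "\<dots> = (\<integral>\<omega>. exp (Y_stop \<omega>) - 1 \<partial>Pinf)"
      by (intro Bochner_Integration.integral_cong) (simp_all add: U0)
    finally show ?thesis .
  qed
  have "integrable Pinf (\<lambda>\<omega>. (exp (Y_stop \<omega>) - 1) - Y_stop \<omega>)"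
    by (intro Bochner_Integration.integrable_diff e_int Y_int)
  then show "integrable Pinf (\<lambda>\<omega>. pre_info (Y_stop \<omega>))"
    by (simp add: pre_info_def algebra_simps)
  have "ext_expectation Pinf (\<lambda>\<omega>. - stopped_at U T \<omega>) = ereal (\<integral>\<omega>. - m (T\<^sub>r \<omega>) \<omega> - Y_stop \<omega> \<partial>Pinf)"
  proof (rule ext_expectation_real)
    show "AE \<omega> in Pinf. - stopped_at U T \<omega> = ereal (- m (T\<^sub>r \<omega>) \<omega> - Y_stop \<omega>)"
      using Pinf_finite AE_space
      by eventually_elim (simp add: U_at_T\<^sub>r space_Pinf Y_stop_def y_Y[symmetric] y_def)
  qed (intro Bochner_Integration.integrable_diff m_int Y_int)
  also have "(\<integral>\<omega>. - m (T\<^sub>r \<omega>) \<omega> - Y_stop \<omega> \<partial>Pinf) = (\<integral>\<omega>. (exp (Y_stop \<omega>) - 1) - Y_stop \<omega> \<partial>Pinf)"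
    unfolding Bochner_Integration.integral_diff[OF m_int Y_int] Bochner_Integration.integral_diff[OF e_int Y_int] eq ..
  also have "\<dots> = (\<integral>\<omega>. pre_info (Y_stop \<omega>) \<partial>Pinf)"
    by (intro Bochner_Integration.integral_cong) (auto simp: pre_info_def)
  finally show "ext_expectation Pinf (\<lambda>\<omega>. - stopped_at U T \<omega>) =
      ereal (\<integral>\<omega>. pre_info (Y_stop \<omega>) \<partial>Pinf)" .
qed

text \<open>The event \<open>\<tau> \<le> T\<close> belongs to \<open>F \<tau>\<close> directly from the definition of a stopping time, and it may
  replace \<open>\<tau> < T\<close> because the increment vanishes on \<open>T = \<tau>\<close>.\<close>

definition info :: "real \<Rightarrow> 'a \<Rightarrow> real" where
  "info \<tau> \<omega> = indicator {\<omega> \<in> \<Omega>. ereal \<tau> \<le> T \<omega>} \<omega> * (U (T\<^sub>r \<omega>) \<omega> - U \<tau> \<omega>)"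

text \<open>The identity with \<open>\<theta> = - 1\<close>, combined with \<open>U = m + y\<close>.\<close>

lemma info_after_change:
  assumes \<tau>: "0 \<le> \<tau>"
  shows "integrable (P \<tau>) (info \<tau>)"
    and "\<And>A. A \<in> sets (F \<tau>) \<Longrightarrow>
      integrable (P \<tau>) (\<lambda>\<omega>. indicator (A \<inter> {\<omega> \<in> \<Omega>. ereal \<tau> \<le> T \<omega>}) \<omega> *
          (post_info (Y_stop \<omega>) - post_info (Y \<tau> \<omega>))) \<and>
      (\<integral>\<omega>. indicator A \<omega> * info \<tau> \<omega> \<partial>P \<tau>) =
      (\<integral>\<omega>. indicator (A \<inter> {\<omega> \<in> \<Omega>. ereal \<tau> \<le> T \<omega>}) \<omega> *
          (post_info (Y_stop \<omega>) - post_info (Y \<tau> \<omega>)) \<partial>P \<tau>)"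
proof -
  interpret exp_martingale "P \<tau>" F U "- 1" \<tau> by (rule exp_martingale_P[OF \<tau>])
  have sp: "space (P \<tau>) = \<Omega>" by (rule space_P[OF \<tau>])
  have y_Y: "y t \<omega> = Y t \<omega>" for t \<omega> by (simp add: y_def m_def Y_def)
  define C where "C = {\<omega> \<in> \<Omega>. ereal \<tau> \<le> T \<omega>}"
  have C_F: "C \<in> sets (F \<tau>)" unfolding C_def using stopping_le_in[OF stopping_P[OF \<tau>] \<tau>] by (simp add: sp)
  have Tr_meas: "T\<^sub>r \<in> borel_measurable (P \<tau>)"
    unfolding T\<^sub>r_def using T_nonneg by (intro borel_measurable_real_of_ereal stopping_borel[OF stopping_P[OF \<tau>]]) (simp add: sp)
  have y_meas: "(\<lambda>\<omega>. y (T\<^sub>r \<omega>) \<omega>) \<in> borel_measurable (P \<tau>)"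
    by (rule measurable_at_unbounded_random_time[where x = y, OF y_measurable y_cont Tr_meas]) (simp_all add: sp T\<^sub>r_nonneg)
  have main: "integrable (P \<tau>) (\<lambda>\<omega>. indicator A \<omega> * (U (T\<^sub>r \<omega>) \<omega> - U \<tau> \<omega>)) \<and>
      integrable (P \<tau>) (\<lambda>\<omega>. indicator A \<omega> * (post_info (Y_stop \<omega>) - post_info (Y \<tau> \<omega>))) \<and>
      (\<integral>\<omega>. indicator A \<omega> * (U (T\<^sub>r \<omega>) \<omega> - U \<tau> \<omega>) \<partial>P \<tau>) =
      (\<integral>\<omega>. indicator A \<omega> * (post_info (Y_stop \<omega>) - post_info (Y \<tau> \<omega>)) \<partial>P \<tau>)"
    if A: "A \<in> sets (F \<tau>)" "A \<subseteq> C" for A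
  proof -
    have AT: "ereal \<tau> \<le> T \<omega>" if "\<omega> \<in> A" for \<omega> using that A(2) by (auto simp: C_def)
    have ay: "integrable (P \<tau>) (\<lambda>\<omega>. indicator A \<omega> * (m \<tau> \<omega> - m (T\<^sub>r \<omega>) \<omega>))"
      "integrable (P \<tau>) (\<lambda>\<omega>. indicator A \<omega> * (exp (- 1 * Y_stop \<omega>) - exp (- 1 * Y \<tau> \<omega>)))"
      "- 1 * (\<integral>\<omega>. indicator A \<omega> * (m \<tau> \<omega> - m (T\<^sub>r \<omega>) \<omega>) \<partial>P \<tau>) =
      (\<integral>\<omega>. indicator A \<omega> * (exp (- 1 * Y_stop \<omega>) - exp (- 1 * Y \<tau> \<omega>)) \<partial>P \<tau>)"
      using azema_yor[of T A \<eta>, OF _ stopping_P[OF \<tau>] _ A(1) AT _ P_finite[OF \<tau>]]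
        T_nonneg Y_le unfolding y_Y T\<^sub>r_def[symmetric] Y_stop_def sp by simp_all
    have AM: "A \<in> sets (P \<tau>)" by (rule sets_F_M[OF \<tau> A(1)])
    have y_int: "integrable (P \<tau>) (\<lambda>\<omega>. indicator A \<omega> * (Y_stop \<omega> - Y \<tau> \<omega>))"
    proof (rule integrable_const_bound[where B = \<eta>])
      show "(\<lambda>\<omega>. indicator A \<omega> * (Y_stop \<omega> - Y \<tau> \<omega>)) \<in> borel_measurable (P \<tau>)"
        using AM y_meas y_measurable[OF \<tau>] unfolding Y_stop_def y_Y[symmetric] by measurable
      show "AE \<omega> in P \<tau>. norm (indicator A \<omega> * (Y_stop \<omega> - Y \<tau> \<omega>)) \<le> \<eta>"
      proof (intro AE_I2)
        fix \<omega> assume "\<omega> \<in> space (P \<tau>)"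
        then have \<omega>: "\<omega> \<in> \<Omega>" by (simp add: sp)
        show "norm (indicator A \<omega> * (Y_stop \<omega> - Y \<tau> \<omega>)) \<le> \<eta>"
          using Y_stop_le[OF \<omega>] Y_stop_nonneg[OF \<omega>] Y_nonneg[OF \<omega> \<tau>] Y_le[OF \<omega> \<tau>] AT
          by (cases "\<omega> \<in> A") auto
      qed
    qed
    have dec1: "indicator A \<omega> * (U (T\<^sub>r \<omega>) \<omega> - U \<tau> \<omega>) =
        indicator A \<omega> * (Y_stop \<omega> - Y \<tau> \<omega>) - indicator A \<omega> * (m \<tau> \<omega> - m (T\<^sub>r \<omega>) \<omega>)" for \<omega>
      by (simp add: Y_stop_def y_Y[symmetric] y_def algebra_simps)
    have dec2: "indicator A \<omega> * (post_info (Y_stop \<omega>) - post_info (Y \<tau> \<omega>)) =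
        indicator A \<omega> * (Y_stop \<omega> - Y \<tau> \<omega>) + indicator A \<omega> * (exp (- 1 * Y_stop \<omega>) - exp (- 1 * Y \<tau> \<omega>))" for \<omega>
      by (simp add: post_info_def algebra_simps)
    show ?thesis
      unfolding dec1 dec2 Bochner_Integration.integral_diff[OF y_int ay(1)] Bochner_Integration.integral_add[OF y_int ay(2)]
      using ay(3) Bochner_Integration.integrable_diff[OF y_int ay(1)] Bochner_Integration.integrable_add[OF y_int ay(2)]
      by simp
  qed
  show "integrable (P \<tau>) (info \<tau>)"
    using main[OF C_F order_refl] by (simp add: info_def[abs_def] C_def)
  show "integrable (P \<tau>) (\<lambda>\<omega>. indicator (A \<inter> {\<omega> \<in> \<Omega>. ereal \<tau> \<le> T \<omega>}) \<omega> *
          (post_info (Y_stop \<omega>) - post_info (Y \<tau> \<omega>))) \<and>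
      (\<integral>\<omega>. indicator A \<omega> * info \<tau> \<omega> \<partial>P \<tau>) =
      (\<integral>\<omega>. indicator (A \<inter> {\<omega> \<in> \<Omega>. ereal \<tau> \<le> T \<omega>}) \<omega> *
          (post_info (Y_stop \<omega>) - post_info (Y \<tau> \<omega>)) \<partial>P \<tau>)"
    if A: "A \<in> sets (F \<tau>)" for A
  proof -
    have "A \<inter> C \<in> sets (F \<tau>)" using A C_F by auto
    from main[OF this Int_lower2]
    have *: "integrable (P \<tau>) (\<lambda>\<omega>. indicator (A \<inter> C) \<omega> *
          (post_info (Y_stop \<omega>) - post_info (Y \<tau> \<omega>)))"
      "(\<integral>\<omega>. indicator (A \<inter> C) \<omega> * (U (T\<^sub>r \<omega>) \<omega> - U \<tau> \<omega>) \<partial>P \<tau>) =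
      (\<integral>\<omega>. indicator (A \<inter> C) \<omega> * (post_info (Y_stop \<omega>) - post_info (Y \<tau> \<omega>)) \<partial>P \<tau>)"
      by auto
    have "(\<integral>\<omega>. indicator A \<omega> * info \<tau> \<omega> \<partial>P \<tau>) = (\<integral>\<omega>. indicator (A \<inter> C) \<omega> * (U (T\<^sub>r \<omega>) \<omega> - U \<tau> \<omega>) \<partial>P \<tau>)"
      by (intro Bochner_Integration.integral_cong) (auto simp: info_def C_def indicator_def)
    with * show ?thesis by (simp add: C_def)
  qed
qed

lemma info_cond_exp:
  assumes \<tau>: "0 \<le> \<tau>"
  defines "X \<equiv> ext_cond_exp (P \<tau>) (F \<tau>) (\<lambda>\<omega>. if ereal \<tau> < T \<omega> then stopped_at U T \<omega> - ereal (U \<tau> \<omega>) else 0)"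
  shows "AE \<omega> in P \<tau>. X \<omega> = ereal (real_cond_exp (P \<tau>) (F \<tau>) (info \<tau>) \<omega>)"
    and "X \<in> borel_measurable (P \<tau>)"
proof -
  interpret exp_martingale "P \<tau>" F U "- 1" \<tau> by (rule exp_martingale_P[OF \<tau>])
  interpret sub: finite_measure_subalgebra "P \<tau>" "F \<tau>" using subalg[OF \<tau>] by unfold_locales
  have sp: "space (P \<tau>) = \<Omega>" by (rule space_P[OF \<tau>])
  have T_meas[measurable]: "T \<in> borel_measurable (P \<tau>)"
    by (rule stopping_borel[OF stopping_P[OF \<tau>]]) (simp add: sp T_nonneg)
  have Tr_meas: "T\<^sub>r \<in> borel_measurable (P \<tau>)"
    unfolding T\<^sub>r_def using T_meas by (rule borel_measurable_real_of_ereal)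
  have [measurable]: "(\<lambda>\<omega>. U (T\<^sub>r \<omega>) \<omega>) \<in> borel_measurable (P \<tau>)"
    by (rule measurable_at_unbounded_random_time[where x = U, OF X_measurable X_cont Tr_meas]) (simp_all add: sp T\<^sub>r_nonneg)
  have [measurable]: "(\<lambda>\<omega>. Limsup at_top (\<lambda>t. ereal (U t \<omega>))) \<in> borel_measurable (P \<tau>)"
    by (rule measurable_Limsup_at_top[OF X_measurable X_cont])
  note [measurable] = X_measurable[OF \<tau>]
  have meas: "(\<lambda>\<omega>. if ereal \<tau> < T \<omega> then stopped_at U T \<omega> - ereal (U \<tau> \<omega>) else 0) \<in> borel_measurable (P \<tau>)"
    unfolding stopped_at_def T\<^sub>r_def[symmetric] by measurable
  have ae: "AE \<omega> in P \<tau>. (if ereal \<tau> < T \<omega> then stopped_at U T \<omega> - ereal (U \<tau> \<omega>) else 0) = ereal (info \<tau> \<omega>)"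
    using P_finite[OF \<tau>] AE_space
  proof eventually_elim
    case (elim \<omega>)
    then have \<omega>: "\<omega> \<in> \<Omega>" by (simp add: sp)
    consider "ereal \<tau> < T \<omega>" | "ereal \<tau> = T \<omega>" | "T \<omega> < ereal \<tau>" by (metis linorder_cases)
    then show ?case
    proof cases
      case 1
      then show ?thesis using elim \<omega> by (simp add: U_at_T\<^sub>r info_def less_imp_le)
    next
      case 2
      then have "T\<^sub>r \<omega> = \<tau>" by (metis T\<^sub>r_def real_of_ereal.simps(1))
      with 2 show ?thesis by (simp add: info_def)
    next
      case 3
      then have "\<not> ereal \<tau> < T \<omega>" "\<not> ereal \<tau> \<le> T \<omega>" by auto
      then show ?thesis by (simp add: info_def)
    qed
  qed
  show "AE \<omega> in P \<tau>. X \<omega> = ereal (real_cond_exp (P \<tau>) (F \<tau>) (info \<tau>) \<omega>)" "X \<in> borel_measurable (P \<tau>)"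
    unfolding X_def by (rule sub.ext_cond_exp_real[OF meas ae info_after_change(1)[OF \<tau>]])+
qed

lemma worst_case_info_le: "worst_case_info P F U T \<le> ereal (post_info \<eta>)"
  unfolding worst_case_info_def
proof (intro SUP_least esssup_I)
  fix \<tau> :: real assume "\<tau> \<in> {0..}"
  then have \<tau>: "0 \<le> \<tau>" by simp
  interpret exp_martingale "P \<tau>" F U "- 1" \<tau> by (rule exp_martingale_P[OF \<tau>])
  interpret sub: finite_measure_subalgebra "P \<tau>" "F \<tau>" using subalg[OF \<tau>] by unfold_locales
  have sp: "space (P \<tau>) = \<Omega>" by (rule space_P[OF \<tau>])
  let ?g = "post_info \<eta>"
  obtain \<omega>0 where "\<omega>0 \<in> \<Omega>" using not_empty sp by auto
  then have \<eta>0: "0 \<le> \<eta>" using Y_stop_nonneg Y_stop_le by (meson order_trans)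
  then have g0: "0 \<le> ?g" by (rule post_info_nonneg)
  show "ext_cond_exp (P \<tau>) (F \<tau>) (\<lambda>\<omega>. if ereal \<tau> < T \<omega> then stopped_at U T \<omega> - ereal (U \<tau> \<omega>) else 0)
      \<in> borel_measurable (P \<tau>)"
    by (rule info_cond_exp(2)[OF \<tau>])
  have "AE \<omega> in P \<tau>. real_cond_exp (P \<tau>) (F \<tau>) (info \<tau>) \<omega> \<le> ?g"
  proof (rule sub.real_cond_exp_le_if_integrals[OF info_after_change(1)[OF \<tau>]])
    fix A assume A: "A \<in> sets (F \<tau>)"
    have AM: "A \<in> sets (P \<tau>)" by (rule sets_F_M[OF \<tau> A])
    let ?h = "\<lambda>\<omega>. indicator (A \<inter> {\<omega> \<in> \<Omega>. ereal \<tau> \<le> T \<omega>}) \<omega> *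
          (post_info (Y_stop \<omega>) - post_info (Y \<tau> \<omega>))"
    have h: "integrable (P \<tau>) ?h" "(\<integral>\<omega>. indicator A \<omega> * info \<tau> \<omega> \<partial>P \<tau>) = (\<integral>\<omega>. ?h \<omega> \<partial>P \<tau>)"
      using info_after_change(2)[OF \<tau> A] by auto
    have "(\<integral>\<omega>. ?h \<omega> \<partial>P \<tau>) \<le> (\<integral>\<omega>. indicator A \<omega> * ?g \<partial>P \<tau>)"
    proof (rule integral_mono[OF h(1)])
      show "integrable (P \<tau>) (\<lambda>\<omega>. indicator A \<omega> * ?g)"
        using AM by (intro integrable_mult_left integrable_real_indicator) (auto simp: emeasure_eq_measure)
      fix \<omega> assume "\<omega> \<in> space (P \<tau>)"
      then have \<omega>: "\<omega> \<in> \<Omega>" by (simp add: sp)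
      have "post_info (Y_stop \<omega>) \<le> post_info \<eta>"
        by (rule post_info_mono[OF Y_stop_nonneg[OF \<omega>] Y_stop_le[OF \<omega>]])
      moreover have "0 \<le> post_info (Y \<tau> \<omega>)" by (rule post_info_nonneg[OF Y_nonneg[OF \<omega> \<tau>]])
      ultimately show "?h \<omega> \<le> indicator A \<omega> * ?g" using g0 by (auto simp: indicator_def)
    qed
    also have "\<dots> = ?g * prob A" using AM by simp
    finally show "(\<integral>\<omega>. indicator A \<omega> * info \<tau> \<omega> \<partial>P \<tau>) \<le> ?g * prob A" using h(2) by simp
  qed
  with info_cond_exp(1)[OF \<tau>]
  show "AE \<omega> in P \<tau>. ext_cond_exp (P \<tau>) (F \<tau>)
      (\<lambda>\<omega>. if ereal \<tau> < T \<omega> then stopped_at U T \<omega> - ereal (U \<tau> \<omega>) else 0) \<omega> \<le> ereal ?g"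
    by eventually_elim simp
qed

text \<open>With a change at \<open>0\<close> the statistic starts from \<open>0\<close>, and the essential supremum is at least the mean.\<close>

lemma worst_case_info_ge:
  assumes c: "\<And>\<omega>. \<omega> \<in> \<Omega> \<Longrightarrow> T \<omega> < \<infinity> \<Longrightarrow> Y_stop \<omega> = c"
  shows "ereal (post_info c) \<le> worst_case_info P F U T"
proof -
  have zero: "(0::real) \<le> 0" by simp
  interpret exp_martingale "P 0" F U "- 1" 0 by (rule exp_martingale_P[OF zero])
  interpret sub: finite_measure_subalgebra "P 0" "F 0" using subalg[OF zero] by unfold_locales
  have sp: "space (P 0) = \<Omega>" by (rule space_P[OF zero])
  let ?X = "ext_cond_exp (P 0) (F 0) (\<lambda>\<omega>. if ereal 0 < T \<omega> then stopped_at U T \<omega> - ereal (U 0 \<omega>) else 0)"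
  let ?r = "real_cond_exp (P 0) (F 0) (info 0)"
  have top: "space (P 0) \<in> sets (F 0)" using sets.top[of "F 0"] by (simp add: sp space_history)
  have "expectation (info 0) = (\<integral>\<omega>. indicator (space (P 0)) \<omega> * info 0 \<omega> \<partial>P 0)"
    by (intro Bochner_Integration.integral_cong) auto
  also have "\<dots> = (\<integral>\<omega>. indicator (space (P 0) \<inter> {\<omega> \<in> \<Omega>. ereal 0 \<le> T \<omega>}) \<omega> *
          (post_info (Y_stop \<omega>) - post_info (Y 0 \<omega>)) \<partial>P 0)"
    using info_after_change(2)[OF zero top] by simp
  also have "\<dots> = (\<integral>\<omega>. post_info c \<partial>P 0)"
  proof (rule integral_cong_AE)
    show "AE \<omega> in P 0. indicator (space (P 0) \<inter> {\<omega> \<in> \<Omega>. ereal 0 \<le> T \<omega>}) \<omega> *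
          (post_info (Y_stop \<omega>) - post_info (Y 0 \<omega>)) = post_info c"
      using P_finite[OF zero] AE_space
    proof eventually_elim
      case (elim \<omega>)
      then have \<omega>: "\<omega> \<in> \<Omega>" by (simp add: sp)
      have "post_info (Y 0 \<omega>) = 0" by (simp add: Y_def running_min_def post_info_0)
      then show ?case using c[OF \<omega> elim(1)] \<omega> T_nonneg[OF \<omega>] sp by (simp add: zero_ereal_def[symmetric])
    qed
  qed (use info_after_change(2)[OF zero top] in auto)
  also have "\<dots> = post_info c" by (simp add: prob_space)
  finally have exp_info: "expectation (info 0) = post_info c" .
  have "ereal (post_info c) \<le> esssup (P 0) ?X"
  proof (rule ccontr)
    assume "\<not> ?thesis"
    then have "esssup (P 0) ?X < ereal (post_info c)" by (simp only: not_le)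
    then obtain d where d: "esssup (P 0) ?X < ereal d" "ereal d < ereal (post_info c)"
      by (blast dest: ereal_dense2)
    have "AE \<omega> in P 0. ?r \<omega> \<le> d"
      using esssup_AE[of ?X "P 0"] info_cond_exp(1)[OF zero]
    proof eventually_elim
      case (elim \<omega>)
      have "ereal (?r \<omega>) = ?X \<omega>" using elim(2) by (rule sym)
      also note elim(1)
      also note less_imp_le[OF d(1)]
      finally show ?case by simp
    qed
    then have "expectation ?r \<le> (\<integral>\<omega>. d \<partial>P 0)"
      using sub.real_cond_exp_int(1)[OF info_after_change(1)[OF zero]] by (intro integral_mono_AE) auto
    then show False
      using sub.real_cond_exp_int(2)[OF info_after_change(1)[OF zero]] exp_info d(2) by (simp add: prob_space)
  qed
  also have "\<dots> \<le> worst_case_info P F U T"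
    unfolding worst_case_info_def by (rule SUP_upper) simp
  finally show ?thesis .
qed

end

section \<open>The two rules\<close>

context change_model
begin

lemma Y_adapted: "0 \<le> t \<Longrightarrow> Y t \<in> borel_measurable (F t)"
proof -
  assume t: "0 \<le> t"
  interpret exp_martingale Pinf F U 1 0 by (rule exp_martingale_Pinf)
  have "y t = Y t" by (rule ext) (simp add: y_def m_def Y_def)
  then show ?thesis using y_adapted[OF t] by simp
qed

lemma Y_cont: "\<omega> \<in> \<Omega> \<Longrightarrow> continuous_on {0..} (\<lambda>t. Y t \<omega>)"
  unfolding Y_def by (intro continuous_intros continuous_running_min U_cont)

lemma Y_0: "Y 0 \<omega> = 0"
  by (simp add: Y_def running_min_def)

lemma cusum_rule_eq_hit:
  assumes "\<omega> \<in> \<Omega>"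
  shows "cusum_rule K u \<nu> \<omega> = hit (\<lambda>t. Y t \<omega>) \<nu>"
proof -
  have "{t. 0 \<le> t \<and> \<nu> \<le> cusum_stat (\<lambda>t. U t \<omega>) t} = {t. 0 \<le> t \<and> \<nu> \<le> Y t \<omega>}"
    using cusum_stat_eq[OF U_cont[OF assms]] by (auto simp: Y_def)
  then show ?thesis by (simp add: cusum_rule_def cusum_time_def hit_def)
qed

lemma bounded_rule_cusum:
  assumes "0 < \<nu>"
  shows "bounded_rule K \<Omega> \<xi> P0 Pinf P u qv (cusum_rule K u \<nu>) \<nu>"
proof
  fix r :: real assume r: "0 \<le> r"
  interpret Pi: filtered_measure Pinf F by (rule filtered_Pinf)
  have "Pi.stopping (\<lambda>\<omega>. hit (\<lambda>s. Y s \<omega>) \<nu>)"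
    by (rule Pi.stopping_hit[OF Y_adapted]) (simp_all add: Y_cont space_Pinf)
  then have "{\<omega> \<in> \<Omega>. hit (\<lambda>t. Y t \<omega>) \<nu> < ereal r} \<in> sets (F r)"
    using r unfolding Pi.stopping_def space_Pinf by blast
  also have "{\<omega> \<in> \<Omega>. hit (\<lambda>t. Y t \<omega>) \<nu> < ereal r} = {\<omega> \<in> \<Omega>. cusum_rule K u \<nu> \<omega> < ereal r}"
    using cusum_rule_eq_hit by auto
  finally show "{\<omega> \<in> \<Omega>. cusum_rule K u \<nu> \<omega> < ereal r} \<in> sets (F r)" .
next
  fix \<omega> assume \<omega>: "\<omega> \<in> \<Omega>"
  show "0 \<le> cusum_rule K u \<nu> \<omega>" unfolding cusum_rule_eq_hit[OF \<omega>] by (rule hit_nonneg)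
  fix s assume "0 \<le> s" "ereal s \<le> cusum_rule K u \<nu> \<omega>"
  then show "Y s \<omega> \<le> \<nu>"
    unfolding cusum_rule_eq_hit[OF \<omega>] using until_hit[OF Y_cont[OF \<omega>]] Y_0 assms by simp
qed

lemma Y_at_cusum_time:
  assumes "0 < \<nu>" "\<omega> \<in> \<Omega>" "cusum_rule K u \<nu> \<omega> < \<infinity>"
  shows "Y (real_of_ereal (cusum_rule K u \<nu> \<omega>)) \<omega> = \<nu>"
proof -
  obtain t where t: "hit (\<lambda>t. Y t \<omega>) \<nu> = ereal t" "0 \<le> t"
    using assms(3) hit_nonneg[of "\<lambda>t. Y t \<omega>" \<nu>] unfolding cusum_rule_eq_hit[OF assms(2)]
    by (cases "hit (\<lambda>t. Y t \<omega>) \<nu>") auto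
  have "\<nu> \<le> Y t \<omega>" by (rule at_hit[OF Y_cont[OF assms(2)] t])
  moreover have "Y t \<omega> \<le> \<nu>" using until_hit[OF Y_cont[OF assms(2)], of \<nu> t] t Y_0 assms(1) by simp
  ultimately show ?thesis unfolding cusum_rule_eq_hit[OF assms(2)] t by simp
qed

lemma rule_at_zero:
  assumes "\<And>\<omega>. \<omega> \<in> \<Omega> \<Longrightarrow> T \<omega> = 0"
  shows "ext_expectation Pinf (\<lambda>\<omega>. - stopped_at U T \<omega>) = 0"
proof -
  have "ext_expectation Pinf (\<lambda>\<omega>. - stopped_at U T \<omega>) = ereal (\<integral>\<omega>. 0 \<partial>Pinf)"
    by (rule ext_expectation_real, rule AE_I2) (simp_all add: assms space_Pinf stopped_at_def u_0)
  then show ?thesis by simp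
qed

end

locale dcusum_model = change_model +
  fixes lo up :: "nat \<Rightarrow> real"
  assumes lo_pos: "\<And>k. k \<in> {1..K} \<Longrightarrow> 0 < lo k" and up_pos: "\<And>k. k \<in> {1..K} \<Longrightarrow> 0 < up k"
begin

definition D :: real where
  "D = real K * max_threshold K lo up"

abbreviation V :: "real \<Rightarrow> 'a \<Rightarrow> real" where
  "V \<equiv> sampled_llr K lo up u"

abbreviation YV :: "real \<Rightarrow> 'a \<Rightarrow> real" where
  "YV t \<omega> \<equiv> dcusum_stat (\<lambda>s. V s \<omega>) t"

lemma sensor: "k \<in> {1..K} \<Longrightarrow> \<omega> \<in> \<Omega> \<Longrightarrow> sensor_path (lo k) (up k) (\<lambda>s. u k s \<omega>)"
  by unfold_locales (auto intro: lo_pos up_pos u_continuous)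

lemma D_nonneg: "0 \<le> D"
proof -
  have "max (up 1) (lo 1) \<le> max_threshold K lo up"
    unfolding max_threshold_def using K_pos by (intro Max_ge) auto
  moreover have "0 < up 1" using up_pos K_pos by simp
  ultimately show ?thesis by (auto simp: D_def intro!: mult_nonneg_nonneg)
qed

lemma sampling_error:
  assumes \<omega>: "\<omega> \<in> \<Omega>" and t: "0 \<le> t"
  shows "\<bar>V t \<omega> - U t \<omega>\<bar> \<le> D"
proof -
  have "\<bar>V t \<omega> - U t \<omega>\<bar> = \<bar>\<Sum>k\<in>{1..K}. u k (last_comm (lo k) (up k) (\<lambda>s. u k s \<omega>) t) \<omega> - u k t \<omega>\<bar>"
    by (simp add: sampled_llr_def total_llr_def sum_subtractf)
  also have "\<dots> \<le> (\<Sum>k\<in>{1..K}. \<bar>u k (last_comm (lo k) (up k) (\<lambda>s. u k s \<omega>) t) \<omega> - u k t \<omega>\<bar>)"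
    by (rule sum_abs)
  also have "\<dots> \<le> (\<Sum>k\<in>{1..K}. max_threshold K lo up)"
  proof (rule sum_mono)
    fix k assume k: "k \<in> {1..K}"
    have "\<bar>u k (last_comm (lo k) (up k) (\<lambda>s. u k s \<omega>) t) \<omega> - u k t \<omega>\<bar> \<le> max (up k) (lo k)"
      by (rule sensor_path.last_comm(4)[OF sensor[OF k \<omega>] t])
    also have "\<dots> \<le> max_threshold K lo up"
      unfolding max_threshold_def using k by (intro Max_ge) auto
    finally show "\<bar>u k (last_comm (lo k) (up k) (\<lambda>s. u k s \<omega>) t) \<omega> - u k t \<omega>\<bar> \<le> max_threshold K lo up" .
  qed
  also have "\<dots> = D" by (simp add: D_def)
  finally show ?thesis .
qed

lemma V_bounded_below: "\<omega> \<in> \<Omega> \<Longrightarrow> bdd_below ((\<lambda>s. V s \<omega>) ` {0..t})"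
proof -
  assume \<omega>: "\<omega> \<in> \<Omega>"
  show ?thesis
  proof (rule bdd_belowI2)
    fix s assume s: "s \<in> {0..t}"
    then show "running_min (\<lambda>s. U s \<omega>) t - D \<le> V s \<omega>"
      using sampling_error[OF \<omega>, of s] running_min_le[OF U_cont[OF \<omega>], of s t] by auto
  qed
qed

lemma YV_eq: "YV t \<omega> = V t \<omega> - running_min (\<lambda>s. V s \<omega>) t"
  by (simp add: dcusum_stat_def running_min_def)

lemma statistic_error:
  assumes \<omega>: "\<omega> \<in> \<Omega>" and t: "0 \<le> t"
  shows "\<bar>YV t \<omega> - Y t \<omega>\<bar> \<le> 2 * D"
proof -
  obtain s where s: "0 \<le> s" "s \<le> t" "running_min (\<lambda>s. U s \<omega>) t = U s \<omega>"
    using running_min_attained[OF U_cont[OF \<omega>] t] by metis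
  have "running_min (\<lambda>s. V s \<omega>) t \<le> V s \<omega>"
    unfolding running_min_def using s by (intro cINF_lower V_bounded_below[OF \<omega>]) auto
  then have 1: "running_min (\<lambda>s. V s \<omega>) t \<le> running_min (\<lambda>s. U s \<omega>) t + D"
    using sampling_error[OF \<omega> s(1)] s(3) by auto
  have "running_min (\<lambda>s. U s \<omega>) t - D \<le> running_min (\<lambda>s. V s \<omega>) t"
    unfolding running_min_def[of "\<lambda>s. V s \<omega>"]
  proof (rule cINF_greatest)
    fix r assume "r \<in> {0..t}"
    then show "running_min (\<lambda>s. U s \<omega>) t - D \<le> V r \<omega>"
      using sampling_error[OF \<omega>, of r] running_min_le[OF U_cont[OF \<omega>], of r t] by auto
  qed (use t in auto)
  with 1 show ?thesis
    using sampling_error[OF \<omega> t] unfolding YV_eq Y_def by auto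
qed

text \<open>The sampled ratio is a step function that is constant to the right of every time. This is why the
  level \<open>\<nu>\<close> is attained at the alarm, and why rational times suffice for measurability.\<close>

lemma V_locally_constant:
  assumes \<omega>: "\<omega> \<in> \<Omega>" and t: "0 \<le> t"
  obtains e where "0 < e" "\<And>s. t \<le> s \<Longrightarrow> s < t + e \<Longrightarrow> V s \<omega> = V t \<omega>"
proof -
  have "\<forall>k\<in>{1..K}. \<exists>e>0. \<forall>s. t \<le> s \<and> s < t + e \<longrightarrow>
      last_comm (lo k) (up k) (\<lambda>s. u k s \<omega>) s = last_comm (lo k) (up k) (\<lambda>s. u k s \<omega>) t"
    using sensor_path.last_comm_locally_constant[OF sensor[OF _ \<omega>] t] by metis
  then obtain e where e: "\<And>k. k \<in> {1..K} \<Longrightarrow> 0 < e k"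
    "\<And>k s. k \<in> {1..K} \<Longrightarrow> t \<le> s \<Longrightarrow> s < t + e k \<Longrightarrow>
      last_comm (lo k) (up k) (\<lambda>s. u k s \<omega>) s = last_comm (lo k) (up k) (\<lambda>s. u k s \<omega>) t"
    by metis
  have fin: "finite (e ` {1..K})" "e ` {1..K} \<noteq> {}" using K_pos by auto
  show thesis
  proof (rule that[of "Min (e ` {1..K})"])
    show "0 < Min (e ` {1..K})" using e(1) fin by (subst Min_gr_iff) auto
    fix s assume s: "t \<le> s" "s < t + Min (e ` {1..K})"
    have "s < t + e k" if "k \<in> {1..K}" for k
    proof -
      have "Min (e ` {1..K}) \<le> e k" by (rule Min_le[OF fin(1)]) (use that in auto)
      with s(2) show ?thesis by linarith
    qed
    then show "V s \<omega> = V t \<omega>"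
      unfolding sampled_llr_def using e(2)[OF _ s(1)] by (intro sum.cong) auto
  qed
qed

lemma YV_locally_constant:
  assumes \<omega>: "\<omega> \<in> \<Omega>" and t: "0 \<le> t"
  obtains e where "0 < e" "\<And>s. t \<le> s \<Longrightarrow> s < t + e \<Longrightarrow> YV s \<omega> = YV t \<omega>"
proof -
  obtain e where e: "0 < e" "\<And>s. t \<le> s \<Longrightarrow> s < t + e \<Longrightarrow> V s \<omega> = V t \<omega>"
    using V_locally_constant[OF \<omega> t] by metis
  show thesis
  proof (rule that[OF e(1)])
    fix s assume s: "t \<le> s" "s < t + e"
    have "(\<lambda>s. V s \<omega>) ` {0..s} = (\<lambda>s. V s \<omega>) ` {0..t}"
    proof (intro set_eqI iffI)
      fix v assume "v \<in> (\<lambda>s. V s \<omega>) ` {0..s}"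
      then obtain r where r: "0 \<le> r" "r \<le> s" "v = V r \<omega>" by auto
      have "V r \<omega> = V (min r t) \<omega>" using e(2)[of r] r s by (cases "r \<le> t") (auto simp: min_def)
      then show "v \<in> (\<lambda>s. V s \<omega>) ` {0..t}" using r t by auto
    qed (use s in auto)
    then show "YV s \<omega> = YV t \<omega>" using e(2)[OF s] by (simp add: dcusum_stat_def)
  qed
qed

lemma V_adapted: "0 \<le> t \<Longrightarrow> V t \<in> borel_measurable (F t)"
proof -
  assume t: "0 \<le> t"
  interpret Pi: filtered_measure Pinf F by (rule filtered_Pinf)
  show ?thesis
    unfolding sampled_llr_def[abs_def]
  proof (rule borel_measurable_sum)
    fix k assume k: "k \<in> {1..K}"
    show "(\<lambda>\<omega>. u k (last_comm (lo k) (up k) (\<lambda>s. u k s \<omega>) t) \<omega>) \<in> borel_measurable (F t)"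
      by (rule Pi.sampled_adapted[OF sensor_adapted[OF k] _ lo_pos[OF k] up_pos[OF k] t])
        (simp_all add: space_Pinf u_continuous[OF k])
  qed
qed

lemma YV_adapted:
  assumes t: "0 \<le> t"
  shows "YV t \<in> borel_measurable (F t)"
proof -
  interpret Pi: filtered_measure Pinf F by (rule filtered_Pinf)
  let ?R = "({0..t} \<inter> \<rat>) \<union> {t}"
  have V_F: "V s \<in> borel_measurable (F t)" if "0 \<le> s" "s \<le> t" for s
    by (rule Pi.measurable_F_mono[OF that V_adapted[OF that(1)]])
  have cnt: "countable ?R"
    using countable_subset[OF _ countable_rat, of "{0..t} \<inter> \<rat>"] by auto
  have "(\<lambda>\<omega>. V t \<omega> - (INF s\<in>?R. V s \<omega>)) \<in> borel_measurable (F t)"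
    by (intro borel_measurable_diff V_F t order_refl borel_measurable_cINF_real cnt) (use t V_F in auto)
  also have "?this \<longleftrightarrow> ?thesis"
  proof (rule measurable_cong)
    fix \<omega> assume "\<omega> \<in> space (F t)"
    then have \<omega>: "\<omega> \<in> \<Omega>" by (simp add: space_history)
    have "(\<lambda>s. V s \<omega>) ` ?R = (\<lambda>s. V s \<omega>) ` {0..t}"
    proof (intro set_eqI iffI)
      fix v assume "v \<in> (\<lambda>s. V s \<omega>) ` {0..t}"
      then obtain s where s: "0 \<le> s" "s \<le> t" "v = V s \<omega>" by auto
      show "v \<in> (\<lambda>s. V s \<omega>) ` ?R"
      proof (cases "s = t")
        case False
        obtain e where e: "0 < e" "\<And>r. s \<le> r \<Longrightarrow> r < s + e \<Longrightarrow> V r \<omega> = V s \<omega>"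
          using V_locally_constant[OF \<omega> s(1)] by metis
        obtain q where q: "q \<in> \<rat>" "s < q" "q < min (s + e) t"
          using Rats_dense_in_real[of s "min (s + e) t"] e(1) s(2) False by auto
        then have "v = V q \<omega>" using e(2)[of q] s(3) by simp
        then show ?thesis using q s(1) by (intro image_eqI[of _ _ q]) auto
      qed (use s in auto)
    qed (use t in auto)
    then show "V t \<omega> - (INF s\<in>?R. V s \<omega>) = YV t \<omega>" by (simp add: dcusum_stat_def)
  qed
  finally show ?thesis .
qed

lemma dcusum_rule_nonneg: "0 \<le> dcusum_rule K lo up u \<nu> \<omega>"
  unfolding dcusum_rule_def by (rule Inf_greatest) auto

lemma before_dcusum: "0 \<le> t \<Longrightarrow> ereal t < dcusum_rule K lo up u \<nu> \<omega> \<Longrightarrow> YV t \<omega> < \<nu>"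
  unfolding dcusum_rule_def
  using Inf_lower[of "ereal t" "ereal ` {t. 0 \<le> t \<and> \<nu> \<le> YV t \<omega>}"] by (force simp: not_le)

lemma at_dcusum:
  assumes \<omega>: "\<omega> \<in> \<Omega>" and T: "dcusum_rule K lo up u \<nu> \<omega> = ereal t"
  shows "0 \<le> t" "\<nu> \<le> YV t \<omega>"
proof -
  show t: "0 \<le> t" using dcusum_rule_nonneg[of \<nu> \<omega>] T by simp
  show "\<nu> \<le> YV t \<omega>"
  proof (rule ccontr)
    assume no: "\<not> \<nu> \<le> YV t \<omega>"
    obtain e where e: "0 < e" "\<And>s. t \<le> s \<Longrightarrow> s < t + e \<Longrightarrow> YV s \<omega> = YV t \<omega>"
      using YV_locally_constant[OF \<omega> t] by metis
    have "ereal (t + e) \<le> dcusum_rule K lo up u \<nu> \<omega>"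
      unfolding dcusum_rule_def
    proof (rule Inf_greatest)
      fix z assume "z \<in> ereal ` {t. 0 \<le> t \<and> \<nu> \<le> YV t \<omega>}"
      then obtain s where s: "z = ereal s" "0 \<le> s" "\<nu> \<le> YV s \<omega>" by auto
      have "t \<le> s"
        using before_dcusum[OF s(2), of \<nu> \<omega>] s(3) T by (simp add: not_less[symmetric]) (meson not_less)
      then have "t + e \<le> s" using e(2)[of s] s(3) no by (metis not_le)
      then show "ereal (t + e) \<le> z" by (simp add: s(1))
    qed
    with e(1) T show False by simp
  qed
qed

lemma Y_until_dcusum:
  assumes \<nu>: "0 < \<nu>" and \<omega>: "\<omega> \<in> \<Omega>" and s: "0 \<le> s" "ereal s \<le> dcusum_rule K lo up u \<nu> \<omega>"
  shows "Y s \<omega> \<le> \<nu> + 2 * D"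
proof -
  have "ereal s \<le> hit (\<lambda>t. Y t \<omega>) (\<nu> + 2 * D)"
    unfolding hit_def
  proof (rule Inf_greatest)
    fix z assume "z \<in> ereal ` {t. 0 \<le> t \<and> \<nu> + 2 * D \<le> Y t \<omega>}"
    then obtain t where t: "z = ereal t" "0 \<le> t" "\<nu> + 2 * D \<le> Y t \<omega>" by auto
    then have "\<nu> \<le> YV t \<omega>" using statistic_error[OF \<omega> t(2)] by auto
    then have "\<not> ereal t < dcusum_rule K lo up u \<nu> \<omega>" using before_dcusum[OF t(2)] by (meson not_less)
    then show "ereal s \<le> z" using s(2) t(1) by (metis not_less order_trans)
  qed
  then show ?thesis
    using until_hit[OF Y_cont[OF \<omega>], of "\<nu> + 2 * D" s] Y_0 \<nu> D_nonneg s(1) by simp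
qed

lemma bounded_rule_dcusum:
  assumes \<nu>: "0 < \<nu>"
  shows "bounded_rule K \<Omega> \<xi> P0 Pinf P u qv (dcusum_rule K lo up u \<nu>) (\<nu> + 2 * D)"
proof
  fix r :: real assume r: "0 \<le> r"
  interpret Pi: filtered_measure Pinf F by (rule filtered_Pinf)
  have "{\<omega> \<in> \<Omega>. dcusum_rule K lo up u \<nu> \<omega> < ereal r} =
      (\<Union>q\<in>{q \<in> \<rat>. 0 \<le> q \<and> q < r}. {\<omega> \<in> space (F q). \<nu> \<le> YV q \<omega>})" (is "?L = ?R")
  proof (intro set_eqI iffI)
    fix \<omega> assume *: "\<omega> \<in> ?L"
    then have \<omega>: "\<omega> \<in> \<Omega>" by simp
    obtain t where t: "dcusum_rule K lo up u \<nu> \<omega> = ereal t" "t < r"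
      using * dcusum_rule_nonneg[of \<nu> \<omega>] by (cases "dcusum_rule K lo up u \<nu> \<omega>") auto
    note at = at_dcusum[OF \<omega> t(1)]
    obtain e where e: "0 < e" "\<And>s. t \<le> s \<Longrightarrow> s < t + e \<Longrightarrow> YV s \<omega> = YV t \<omega>"
      using YV_locally_constant[OF \<omega> at(1)] by metis
    obtain q where q: "q \<in> \<rat>" "t < q" "q < min (t + e) r"
      using Rats_dense_in_real[of t "min (t + e) r"] e(1) t(2) by auto
    then have "\<nu> \<le> YV q \<omega>" using e(2)[of q] at(2) by simp
    then show "\<omega> \<in> ?R" using q at(1) \<omega> by (auto simp: space_history intro!: bexI[of _ q])
  next
    fix \<omega> assume "\<omega> \<in> ?R"
    then obtain q where q: "0 \<le> q" "q < r" "\<omega> \<in> \<Omega>" "\<nu> \<le> YV q \<omega>" by (auto simp: space_history)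
    have "dcusum_rule K lo up u \<nu> \<omega> \<le> ereal q"
      unfolding dcusum_rule_def using q by (intro Inf_lower) auto
    also have "\<dots> < ereal r" using q by simp
    finally show "\<omega> \<in> ?L" using q by simp
  qed
  also have "\<dots> \<in> sets (F r)"
  proof (rule sets.countable_UN'')
    show "countable {q \<in> \<rat>. 0 \<le> q \<and> q < r}"
      by (rule countable_subset[OF _ countable_rat]) auto
    fix q assume "q \<in> {q \<in> \<rat>. 0 \<le> q \<and> q < r}"
    then have q: "0 \<le> q" "q \<le> r" by auto
    have "{\<omega> \<in> space (F q). \<nu> \<le> YV q \<omega>} \<in> sets (F q)" using YV_adapted[OF q(1)] by measurable
    then show "{\<omega> \<in> space (F q). \<nu> \<le> YV q \<omega>} \<in> sets (F r)" using Pi.F_mono[OF q] by auto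
  qed
  finally show "{\<omega> \<in> \<Omega>. dcusum_rule K lo up u \<nu> \<omega> < ereal r} \<in> sets (F r)" .
next
  fix \<omega> assume \<omega>: "\<omega> \<in> \<Omega>"
  show "0 \<le> dcusum_rule K lo up u \<nu> \<omega>" by (rule dcusum_rule_nonneg)
  fix s assume "0 \<le> s" "ereal s \<le> dcusum_rule K lo up u \<nu> \<omega>"
  then show "Y s \<omega> \<le> \<nu> + 2 * D" by (rule Y_until_dcusum[OF \<nu> \<omega>])
qed

lemma Y_at_dcusum_time:
  assumes "\<omega> \<in> \<Omega>" "dcusum_rule K lo up u \<nu> \<omega> < \<infinity>"
  shows "\<nu> - 2 * D \<le> Y (real_of_ereal (dcusum_rule K lo up u \<nu> \<omega>)) \<omega>"
proof -
  obtain t where t: "dcusum_rule K lo up u \<nu> \<omega> = ereal t"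
    using assms(2) dcusum_rule_nonneg[of \<nu> \<omega>] by (cases "dcusum_rule K lo up u \<nu> \<omega>") auto
  show ?thesis
    using at_dcusum[OF assms(1) t] statistic_error[OF assms(1), of t] by (auto simp: t)
qed

text \<open>Otherwise the decentralized rule would stop with a statistic above \<open>\<nu>\<close>, and \<open>pre_info\<close> increases
  strictly.\<close>

lemma threshold_comparison:
  assumes \<gamma>: "0 < \<gamma>" and \<nu>: "0 < \<nu>" and \<nu>': "0 < \<nu>'"
    and d: "ext_expectation Pinf (\<lambda>\<omega>. - stopped_at U (dcusum_rule K lo up u \<nu>') \<omega>) = ereal \<gamma>"
    and c: "ext_expectation Pinf (\<lambda>\<omega>. - stopped_at U (cusum_rule K u \<nu>) \<omega>) = ereal \<gamma>"
  shows "\<nu>' - 2 * D \<le> \<nu>"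
proof (rule ccontr)
  assume "\<not> ?thesis"
  then have gt: "\<nu> < \<nu>' - 2 * D" by simp
  interpret prob_space Pinf by (rule prob_Pinf)
  interpret C: bounded_rule K \<Omega> \<xi> P0 Pinf P u qv "cusum_rule K u \<nu>" \<nu>
    by (rule bounded_rule_cusum[OF \<nu>])
  interpret Dc: bounded_rule K \<Omega> \<xi> P0 Pinf P u qv "dcusum_rule K lo up u \<nu>'" "\<nu>' + 2 * D"
    by (rule bounded_rule_dcusum[OF \<nu>'])
  have "\<gamma> = (\<integral>\<omega>. pre_info (C.Y_stop \<omega>) \<partial>Pinf)"
    using C.expected_neg_information(2) c by simp
  also have "\<dots> = (\<integral>\<omega>. pre_info \<nu> \<partial>Pinf)"
  proof (rule integral_cong_AE)
    show "AE \<omega> in Pinf. pre_info (C.Y_stop \<omega>) = pre_info \<nu>"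
      using C.Pinf_finite AE_space
      by eventually_elim (simp add: C.Y_stop_def C.T\<^sub>r_def Y_at_cusum_time[OF \<nu>] space_Pinf)
  qed (use C.expected_neg_information(1) in auto)
  also have "\<dots> = pre_info \<nu>" by (simp add: prob_space)
  also have "\<dots> < pre_info (\<nu>' - 2 * D)"
    using pre_info_strict_mono[of \<nu> "\<nu>' - 2 * D"] \<nu> gt by simp
  also have "\<dots> = (\<integral>\<omega>. pre_info (\<nu>' - 2 * D) \<partial>Pinf)" by (simp add: prob_space)
  also have "\<dots> \<le> (\<integral>\<omega>. pre_info (Dc.Y_stop \<omega>) \<partial>Pinf)"
  proof (rule integral_mono_AE[OF _ Dc.expected_neg_information(1)])
    show "AE \<omega> in Pinf. pre_info (\<nu>' - 2 * D) \<le> pre_info (Dc.Y_stop \<omega>)"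
      using Dc.Pinf_finite AE_space
    proof eventually_elim
      case (elim \<omega>)
      then have "\<nu>' - 2 * D \<le> Dc.Y_stop \<omega>"
        unfolding Dc.Y_stop_def Dc.T\<^sub>r_def by (intro Y_at_dcusum_time) (simp_all add: space_Pinf)
      then show ?case
        using pre_info_strict_mono[of "\<nu>' - 2 * D" "Dc.Y_stop \<omega>"] gt \<nu>
        by (cases "\<nu>' - 2 * D = Dc.Y_stop \<omega>") auto
    qed
  qed simp
  also have "\<dots> = \<gamma>" using Dc.expected_neg_information(2) d by simp
  finally show False by simp
qed

end

theorem theorem1:
  fixes K :: nat
    and \<Omega> :: "'a set"
    and \<xi> u :: "nat \<Rightarrow> real \<Rightarrow> 'a \<Rightarrow> real"
    and P0 Pinf :: "'a measure"
    and P :: "real \<Rightarrow> 'a measure"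
    and qv :: "real \<Rightarrow> 'a \<Rightarrow> real"
    and lo up :: "nat \<Rightarrow> real"
    and \<gamma> \<nu> \<nu>' :: real
  assumes "change_model K \<Omega> \<xi> P0 Pinf P u qv"
    and "\<And>k. k \<in> {1..K} \<Longrightarrow> 0 < lo k"
    and "\<And>k. k \<in> {1..K} \<Longrightarrow> 0 < up k"
    and "0 < \<gamma>"
    and "ext_expectation Pinf
           (\<lambda>\<omega>. - stopped_at (total_llr K u) (dcusum_rule K lo up u \<nu>') \<omega>) = ereal \<gamma>"
    and "ext_expectation Pinf
           (\<lambda>\<omega>. - stopped_at (total_llr K u) (cusum_rule K u \<nu>) \<omega>) = ereal \<gamma>"
  shows "worst_case_info P (history \<Omega> \<xi> {1..K}) (total_llr K u) (dcusum_rule K lo up u \<nu>')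
         - worst_case_info P (history \<Omega> \<xi> {1..K}) (total_llr K u) (cusum_rule K u \<nu>)
         \<le> ereal (4 * real K * max_threshold K lo up)"
proof -
  interpret change_model K \<Omega> \<xi> P0 Pinf P u qv by (rule assms(1))
  interpret dcusum_model K \<Omega> \<xi> P0 Pinf P u qv lo up by unfold_locales (use assms in auto)
  \<comment> \<open>With a threshold that is not positive, a rule stops at once and accumulates no information.\<close>
  have \<nu>: "0 < \<nu>"
  proof (rule ccontr)
    assume "\<not> 0 < \<nu>"
    then have "cusum_rule K u \<nu> \<omega> = 0" if "\<omega> \<in> \<Omega>" for \<omega>
      using hit_le_iff[OF Y_cont[OF that], of 0 \<nu>] hit_nonneg[of "\<lambda>t. Y t \<omega>" \<nu>] Y_0[of \<omega>]
      unfolding cusum_rule_eq_hit[OF that] by (auto simp: zero_ereal_def[symmetric] intro!: antisym)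
    from rule_at_zero[OF this] show False using assms(4,6) by simp
  qed
  have \<nu>': "0 < \<nu>'"
  proof (rule ccontr)
    assume no: "\<not> 0 < \<nu>'"
    have "dcusum_rule K lo up u \<nu>' \<omega> = 0" if "\<omega> \<in> \<Omega>" for \<omega>
    proof (rule antisym[OF _ dcusum_rule_nonneg])
      have "dcusum_stat (\<lambda>s. sampled_llr K lo up u s \<omega>) 0 = 0" by (simp add: dcusum_stat_def)
      then have "dcusum_rule K lo up u \<nu>' \<omega> \<le> ereal 0"
        unfolding dcusum_rule_def using no by (intro Inf_lower) auto
      then show "dcusum_rule K lo up u \<nu>' \<omega> \<le> 0" by (simp add: zero_ereal_def)
    qed
    from rule_at_zero[OF this] show False using assms(4,5) by simp
  qed
  interpret C: bounded_rule K \<Omega> \<xi> P0 Pinf P u qv "cusum_rule K u \<nu>" \<nu>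
    by (rule bounded_rule_cusum[OF \<nu>])
  interpret Dc: bounded_rule K \<Omega> \<xi> P0 Pinf P u qv "dcusum_rule K lo up u \<nu>'" "\<nu>' + 2 * D"
    by (rule bounded_rule_dcusum[OF \<nu>'])
  let ?J = "worst_case_info P F U"
  have "\<nu>' + 2 * D \<le> \<nu> + 4 * D"
    using threshold_comparison[OF assms(4) \<nu> \<nu>' assms(5,6)] by simp
  then have "post_info (\<nu>' + 2 * D) \<le> post_info (\<nu> + 4 * D)"
    using \<nu>' D_nonneg by (intro post_info_mono) auto
  also have "\<dots> \<le> post_info \<nu> + 4 * D" using D_nonneg by (simp add: post_info_def)
  finally have le: "post_info (\<nu>' + 2 * D) \<le> post_info \<nu> + 4 * D" .
  have "?J (dcusum_rule K lo up u \<nu>') - ?J (cusum_rule K u \<nu>) \<le>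
      ereal (post_info (\<nu>' + 2 * D)) - ereal (post_info \<nu>)"
  proof (rule ereal_minus_mono[OF Dc.worst_case_info_le])
    show "ereal (post_info \<nu>) \<le> ?J (cusum_rule K u \<nu>)"
      by (rule C.worst_case_info_ge) (simp add: C.Y_stop_def C.T\<^sub>r_def Y_at_cusum_time[OF \<nu>])
  qed
  also have "\<dots> \<le> ereal (4 * D)" using le by simp
  also have "\<dots> = ereal (4 * real K * max_threshold K lo up)" by (simp add: D_def)
  finally show ?thesis .
qed

end
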